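(* Let $h>0$ and let $J$ be a nonzero real number. For $N\in\mathbb{N}$ let $\Lambda=\{1,\dots,N\}$ and, for $t\in\mathbb{R}$, consider the Hamiltonian on $\mathcal{H}^{(N)}=\bigotimes_{j=1}^{N}\mathbb{C}^2$ $$K_{\Lambda}\equiv K_{\Lambda}(t):=-J\sum_{i=1}^{N-1}\sigma_i^z\sigma_{i+1}^z+\frac{t}{2}\sum_{i=1}^{N-1}\left(\sigma_i^x\sigma_{i+1}^x+\sigma_i^y\sigma_{i+1}^y\right)-h\sum_{i=1}^N\sigma_i^z .$$ Let $\sigma(K_\Lambda)$ denote the spectrum of $K_\Lambda$ and $E_\Lambda$ its smallest eigenvalue (the ground-state energy). (a) Suppose $J>0$. Then there exist constants $\bar t>0$ and $C>0$, depending on $J$ and $h$ but not on $N$, such that for all $N>\frac{J}{h}+\frac32$ and all $t$ with $|t|<\bar t$, the ground-state energy $E_\Lambda$ of $K_\Lambda$ is a non-degenerate eigenvalue and the spectral gap above it (the distance from $E_\Lambda$ to $\sigma(K_\Lambda)\setminus\{E_\Lambda\}$) is bounded below by $2J+2h-C\,\frac{J}{h}\,|t|$. (b) Suppose $J<0$ and $|J|>2h$. Then there exist constants $\bar t>0$ and $C>0$, depending on $J$ and $h$ but not on $N$, such that for all $t$ with $|t|<\bar t$ the following hold. - If $N$ is odd, the set $$\mathfrak{S}:=\sigma(K_\Lambda)\cap\left[E_\Lambda,\;E_\Lambda+2|J|-C|t|\right]$$ consists of two points $E_\Lambda$ and $E'_\Lambda$ with $\left|E'_\Lambda-E_\Lambda-2h\right|\le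 C|t|$, and the spectral projection of $K_\Lambda$ associated with $\mathfrak{S}$ has rank $2$. - If $N$ is even, the set $$\mathfrak{S}:=\sigma(K_\Lambda)\cap\left[E_\Lambda,\;E_\Lambda+2|J|-2h-C|t|\right]$$ consists of at most two points $E_\Lambda$ and $E'_\Lambda$ (possibly coinciding), with $|E'_\Lambda-E_\Lambda|\le C|t|$, and the spectral projection of $K_\Lambda$ associated with $\mathfrak{S}$ has rank $2$.
   Context: For each site $j\in\{1,\dots,N\}$, $\sigma_j^x,\sigma_j^y,\sigma_j^z$ are the Pauli matrices $\sigma^x=\begin{pmatrix}0&1\\1&0\end{pmatrix}$, $\sigma^y=\begin{pmatrix}0&-i\\ i&0\end{pmatrix}$, $\sigma^z=\begin{pmatrix}1&0\\0&-1\end{pmatrix}$ acting on the $j$-th tensor factor $\mathbb{C}^2$ of $\mathcal{H}^{(N)}$ and as the identity on all other factors. The chain has open (free) boundary conditions. $K_\Lambda(t)$ is the Hamiltonian of the $XXZ$ chain in a magnetic field, viewed as a perturbation in $t$ of an Ising Hamiltonian; $J>0$ is the ferromagnetic and $J<0$ the antiferromagnetic case. The spectral projection associated with a set $\mathfrak{S}$ of eigenvalues is the orthogonal projection onto the span of all eigenvectors with eigenvalue in $\mathfrak{S}$ (so its rank counts eigenvalues with multiplicity).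
   Formalization: In (b), at t = 0 only, the right endpoint of the interval defining 𝔖 is excluded: there, for N ≥ 2, one-kink Ising states have energy exactly E+2|J| (N odd) or E+2|J|−2h (N even), so the printed claim fails. N ≥ 1 is assumed in (b). *)

theory Defs
  imports
    "Jordan_Normal_Form.Spectral_Radius"
    "Jordan_Normal_Form.Schur_Decomposition"
    "Jordan_Normal_Form.Matrix_Kernel"
    "Jordan_Normal_Form.DL_Rank"
    "HOL-Analysis.Elementary_Metric_Spaces"
begin

section \<open>Tensor products and Pauli matrices\<close>

text \<open>Kronecker product. Operators on the N-fold tensor power of \<open>\<complex>\<^sup>2\<close> are written as
  \<open>2 ^ N \<times> 2 ^ N\<close> matrices in the product basis, with site 1 the leftmost (most significant)
  tensor factor.\<close>

definition kron :: "complex mat \<Rightarrow> complex mat \<Rightarrow> complex mat" where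
  "kron A B = mat (dim_row A * dim_row B) (dim_col A * dim_col B)
     (\<lambda>(r, c). A $$ (r div dim_row B, c div dim_col B) * B $$ (r mod dim_row B, c mod dim_col B))"

definition sigma_x :: "complex mat" where
  "sigma_x = mat_of_rows_list 2 [[0, 1], [1, 0]]"

definition sigma_y :: "complex mat" where
  "sigma_y = mat_of_rows_list 2 [[0, - \<i>], [\<i>, 0]]"

definition sigma_z :: "complex mat" where
  "sigma_z = mat_of_rows_list 2 [[1, 0], [0, - 1]]"

definition site_op :: "nat \<Rightarrow> complex mat \<Rightarrow> nat \<Rightarrow> complex mat" where
  "site_op N A j = kron (kron (1\<^sub>m (2 ^ (j - 1))) A) (1\<^sub>m (2 ^ (N - j)))"


section \<open>The XXZ Hamiltonian\<close>

text \<open>\<open>XXZ N J h t\<close> is the Hamiltonian of the open chain with sites \<open>1, \<dots>, N\<close>. For \<open>N = 1\<close> the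
  sums over bonds are empty and hence the zero matrix.\<close>

definition XXZ :: "nat \<Rightarrow> real \<Rightarrow> real \<Rightarrow> real \<Rightarrow> complex mat" where
  "XXZ N J h t =
     complex_of_real (- J) \<cdot>\<^sub>m
       (\<Oplus>\<^bsub>module_mat TYPE(complex) (2 ^ N) (2 ^ N)\<^esub> i\<in>{1..<N}.
          site_op N sigma_z i * site_op N sigma_z (i + 1))
   + complex_of_real (t / 2) \<cdot>\<^sub>m
       (\<Oplus>\<^bsub>module_mat TYPE(complex) (2 ^ N) (2 ^ N)\<^esub> i\<in>{1..<N}.
          site_op N sigma_x i * site_op N sigma_x (i + 1)
          + site_op N sigma_y i * site_op N sigma_y (i + 1))
   - complex_of_real h \<cdot>\<^sub>m
       (\<Oplus>\<^bsub>module_mat TYPE(complex) (2 ^ N) (2 ^ N)\<^esub> i\<in>{1..N}. site_op N sigma_z i)"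


section \<open>Spectral notions\<close>

text \<open>The Hamiltonian is Hermitian, so nothing is lost by restricting its spectrum to the real line:
  see \<open>spectrum_XXZ\<close> below.\<close>

definition real_spectrum :: "complex mat \<Rightarrow> real set" where
  "real_spectrum A = {x. complex_of_real x \<in> spectrum A}"

definition ground_energy :: "complex mat \<Rightarrow> real" where
  "ground_energy A = Min (real_spectrum A)"

definition nondegenerate_eigenvalue :: "complex mat \<Rightarrow> real \<Rightarrow> bool" where
  "nondegenerate_eigenvalue A x \<longleftrightarrow>
     eigenvalue A (complex_of_real x) \<and> kernel_dim (char_matrix A (complex_of_real x)) = 1"

definition spectral_gap :: "complex mat \<Rightarrow> real" where
  "spectral_gap A = infdist (ground_energy A) (real_spectrum A - {ground_energy A})"

definition spectral_subspace :: "complex mat \<Rightarrow> real set \<Rightarrow> complex vec set" where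
  "spectral_subspace A S = LinearCombinations.module.span class_ring
     (module_vec TYPE(complex) (dim_row A))
     {v. \<exists>x\<in>S. eigenvector A v (complex_of_real x)}"

definition orthogonal_projection_onto :: "complex mat \<Rightarrow> nat \<Rightarrow> complex vec set \<Rightarrow> bool" where
  "orthogonal_projection_onto P n W \<longleftrightarrow>
     P \<in> carrier_mat n n \<and> mat_adjoint P = P \<and> P * P = P \<and> {P *\<^sub>v v | v. v \<in> carrier_vec n} = W"

text \<open>The projection exists and is unique, see \<open>spectral_projection_onto\<close> and
  \<open>orthogonal_projection_unique\<close> below.\<close>

definition spectral_projection :: "complex mat \<Rightarrow> real set \<Rightarrow> complex mat" where
  "spectral_projection A S =
     (THE P. orthogonal_projection_onto P (dim_row A) (spectral_subspace A S))"

definition mat_rank :: "complex mat \<Rightarrow> nat" where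
  "mat_rank P = vec_space.rank (dim_row P) P"

text \<open>The interval \<open>[a, b]\<close> of low energies. At the unperturbed point \<open>t = 0\<close> the right end point is
  left out: there the upper bounds used in the theorem can themselves be eigenvalues of the Ising
  Hamiltonian, namely the energies of its lowest one-kink states, and are not to be counted.\<close>

definition low_energy_interval :: "real \<Rightarrow> real \<Rightarrow> real \<Rightarrow> real set" where
  "low_energy_interval t a b = (if t = 0 then {a..<b} else {a..b})"


section \<open>Well-definedness\<close>

lemma mat_adjoint_carrier:
  "A \<in> carrier_mat n m \<Longrightarrow> mat_adjoint A \<in> carrier_mat m n"
  by (intro carrier_matI) (auto simp: mat_adjoint_def)

lemma mat_adjoint_index:
  "\<lbrakk>A \<in> carrier_mat n m; i < m; j < n\<rbrakk> \<Longrightarrow> mat_adjoint A $$ (i, j) = conjugate (A $$ (j, i))"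
  unfolding mat_adjoint_def mat_of_rows_def by auto

lemma mat_adjoint_eqI:
  assumes "A \<in> carrier_mat n n"
    and "\<And>i j. i < n \<Longrightarrow> j < n \<Longrightarrow> A $$ (i, j) = conjugate (A $$ (j, i))"
  shows "mat_adjoint A = A"
proof (rule eq_matI)
  show "dim_row (mat_adjoint A) = dim_row A" "dim_col (mat_adjoint A) = dim_col A"
    using assms(1) by (auto simp: mat_adjoint_def)
  fix i j assume "i < dim_row A" "j < dim_col A"
  then have ij: "i < n" "j < n" using assms(1) by auto
  show "mat_adjoint A $$ (i, j) = A $$ (i, j)"
    unfolding mat_adjoint_index[OF assms(1) ij] by (rule assms(2)[OF ij, symmetric])
qed

lemma mat_adjoint_index_self:
  assumes "A \<in> carrier_mat n n" "mat_adjoint A = A" "i < n" "j < n"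
  shows "conjugate (A $$ (j, i)) = A $$ (i, j)"
  using mat_adjoint_index[OF assms(1,3,4)] assms(2) by simp

lemma mat_adjoint_mult:
  assumes "(A :: complex mat) \<in> carrier_mat n m" "B \<in> carrier_mat m k"
  shows "mat_adjoint (A * B) = mat_adjoint B * mat_adjoint A"
proof (rule eq_matI)
  show "dim_row (mat_adjoint (A * B)) = dim_row (mat_adjoint B * mat_adjoint A)"
    "dim_col (mat_adjoint (A * B)) = dim_col (mat_adjoint B * mat_adjoint A)"
    using assms by (auto simp: mat_adjoint_def)
  fix i j assume "i < dim_row (mat_adjoint B * mat_adjoint A)"
    "j < dim_col (mat_adjoint B * mat_adjoint A)"
  then have ij: "i < k" "j < n" using assms by (auto simp: mat_adjoint_def)
  have AB: "A * B \<in> carrier_mat n k" using assms by auto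
  have "mat_adjoint (A * B) $$ (i, j) = conjugate (\<Sum>l = 0..<m. A $$ (j, l) * B $$ (l, i))"
    using mat_adjoint_index[OF AB ij] ij assms by (simp add: scalar_prod_def)
  also have "\<dots> = (\<Sum>l = 0..<m. mat_adjoint B $$ (i, l) * mat_adjoint A $$ (l, j))"
    using ij by (simp add: mat_adjoint_index[OF assms(1)] mat_adjoint_index[OF assms(2)] mult.commute)
  also have "\<dots> = (mat_adjoint B * mat_adjoint A) $$ (i, j)"
    using ij mat_adjoint_carrier[OF assms(1)] mat_adjoint_carrier[OF assms(2)]
    by (auto simp: scalar_prod_def)
  finally show "mat_adjoint (A * B) $$ (i, j) = (mat_adjoint B * mat_adjoint A) $$ (i, j)" .
qed

lemma kron_carrier [simp]:
  "\<lbrakk>A \<in> carrier_mat a a'; B \<in> carrier_mat b b'\<rbrakk> \<Longrightarrow> kron A B \<in> carrier_mat (a * b) (a' * b')"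
  unfolding kron_def by auto

lemma kron_index:
  "\<lbrakk>A \<in> carrier_mat a a'; B \<in> carrier_mat b b'; r < a * b; c < a' * b'\<rbrakk> \<Longrightarrow>
    kron A B $$ (r, c) = A $$ (r div b, c div b') * B $$ (r mod b, c mod b')"
  unfolding kron_def by auto

lemma div_mod_less:
  fixes r a b :: nat
  assumes "r < a * b" shows "r div b < a" "r mod b < b"
proof -
  have "b > 0" using assms by (cases b) auto
  then show "r div b < a" "r mod b < b"
    using assms by (auto simp: less_mult_imp_div_less)
qed

lemma kron_adjoint_self:
  assumes "A \<in> carrier_mat a a" "B \<in> carrier_mat b b" "mat_adjoint A = A" "mat_adjoint B = B"
  shows "mat_adjoint (kron A B) = kron A B"
proof (rule mat_adjoint_eqI)
  show "kron A B \<in> carrier_mat (a * b) (a * b)" using assms by simp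
  fix r c assume rc: "r < a * b" "c < a * b"
  show "kron A B $$ (r, c) = conjugate (kron A B $$ (c, r))"
    unfolding kron_index[OF assms(1,2) rc] kron_index[OF assms(1,2) rc(2,1)]
    using mat_adjoint_index_self[OF assms(1,3), of "r div b" "c div b"]
      mat_adjoint_index_self[OF assms(2,4), of "r mod b" "c mod b"]
      div_mod_less[OF rc(1)] div_mod_less[OF rc(2)] by simp
qed

lemma kron_assoc:
  assumes "A \<in> carrier_mat a a" "B \<in> carrier_mat b b" "C \<in> carrier_mat c c"
  shows "kron (kron A B) C = kron A (kron B C)"
proof (rule eq_matI)
  have AB: "kron A B \<in> carrier_mat (a * b) (a * b)" and BC: "kron B C \<in> carrier_mat (b * c) (b * c)"
    using assms by auto
  show "dim_row (kron (kron A B) C) = dim_row (kron A (kron B C))"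
    "dim_col (kron (kron A B) C) = dim_col (kron A (kron B C))"
    unfolding kron_def by auto
  fix r s assume "r < dim_row (kron A (kron B C))" "s < dim_col (kron A (kron B C))"
  then have rs: "r < a * b * c" "s < a * b * c" "r < a * (b * c)" "s < a * (b * c)"
    using assms unfolding kron_def by (auto simp: mult.assoc)
  have *: "x div c mod b = x mod (b * c) div c" "x mod c = x mod (b * c) mod c"
    "x div c div b = x div (b * c)" for x :: nat
  proof -
    show "x div c mod b = x mod (b * c) div c"
      by (cases "c = 0") (simp_all add: mod_mult2_eq[of x c b, folded mult.commute[of b c]])
    show "x mod c = x mod (b * c) mod c" by (simp add: mod_mod_cancel)
    show "x div c div b = x div (b * c)" by (metis div_mult2_eq mult.commute)
  qed
  show "kron (kron A B) C $$ (r, s) = kron A (kron B C) $$ (r, s)"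
    unfolding kron_index[OF AB assms(3) rs(1,2)] kron_index[OF assms(1) BC rs(3,4)]
      kron_index[OF assms(1,2) div_mod_less(1)[OF rs(1)] div_mod_less(1)[OF rs(2)]]
      kron_index[OF assms(2,3) div_mod_less(2)[OF rs(3)] div_mod_less(2)[OF rs(4)]]
    by (simp only: *(1,3) *(2)[symmetric] mult.assoc)
qed

lemma kron_one:
  "kron (1\<^sub>m a) (1\<^sub>m b) = 1\<^sub>m (a * b)"
proof (rule eq_matI)
  fix r c assume "r < dim_row (1\<^sub>m (a * b) :: complex mat)" "c < dim_col (1\<^sub>m (a * b) :: complex mat)"
  then have rc: "r < a * b" "c < a * b" by auto
  have "r = c \<longleftrightarrow> r div b = c div b \<and> r mod b = c mod b"
    by (metis div_mult_mod_eq)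
  then show "kron (1\<^sub>m a) (1\<^sub>m b) $$ (r, c) = 1\<^sub>m (a * b) $$ (r, c)"
    using rc div_mod_less[OF rc(1)] div_mod_less[OF rc(2)]
    by (auto simp: kron_index[of _ a a _ b b])
qed (auto simp: kron_def)

lemma kron_split:
  assumes P: "P \<in> carrier_mat a a" and Q: "Q \<in> carrier_mat b b"
  shows "kron P (1\<^sub>m b) * kron (1\<^sub>m a) Q = kron P Q" "kron (1\<^sub>m a) Q * kron P (1\<^sub>m b) = kron P Q"
proof -
  have c: "kron P (1\<^sub>m b) \<in> carrier_mat (a * b) (a * b)" "kron (1\<^sub>m a) Q \<in> carrier_mat (a * b) (a * b)"
    "kron P Q \<in> carrier_mat (a * b) (a * b)" using P Q by auto
  {
    fix r s assume rs: "r < a * b" "s < a * b"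
    note l = div_mod_less[OF rs(1)] div_mod_less[OF rs(2)]
    have bnd: "x * b + y < a * b" if "x < a" "y < b" for x y
    proof -
      have "x * b + y < Suc x * b" using that by simp
      also have "\<dots> \<le> a * b" using that by (intro mult_le_mono1) simp
      finally show ?thesis .
    qed
    define k1 where "k1 = s div b * b + r mod b"
    define k2 where "k2 = r div b * b + s mod b"
    have k: "k1 < a * b" "k1 div b = s div b" "k1 mod b = r mod b"
      "k2 < a * b" "k2 div b = r div b" "k2 mod b = s mod b"
      unfolding k1_def k2_def using l bnd by auto
    have "(kron P (1\<^sub>m b) * kron (1\<^sub>m a) Q) $$ (r, s)
        = (\<Sum>k = 0..<a * b. kron P (1\<^sub>m b) $$ (r, k) * kron (1\<^sub>m a) Q $$ (k, s))"
      using rs c by (auto simp: scalar_prod_def)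
    also have "\<dots> = (\<Sum>k = 0..<a * b. if k = k1 then P $$ (r div b, s div b) * Q $$ (r mod b, s mod b) else 0)"
    proof (rule sum.cong[OF refl])
      fix x assume "x \<in> {0..<a * b}"
      then have x: "x < a * b" by simp
      have "x = k1 \<longleftrightarrow> x div b = s div b \<and> x mod b = r mod b"
        using k by (metis div_mult_mod_eq)
      then show "kron P (1\<^sub>m b) $$ (r, x) * kron (1\<^sub>m a) Q $$ (x, s) =
          (if x = k1 then P $$ (r div b, s div b) * Q $$ (r mod b, s mod b) else 0)"
        using l div_mod_less[OF x] P Q rs x
        by (auto simp: kron_index[of _ a a _ b b])
    qed
    also have "\<dots> = kron P Q $$ (r, s)" using k kron_index[OF P Q rs] by simp
    finally have 1: "(kron P (1\<^sub>m b) * kron (1\<^sub>m a) Q) $$ (r, s) = kron P Q $$ (r, s)" .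
    have "(kron (1\<^sub>m a) Q * kron P (1\<^sub>m b)) $$ (r, s)
        = (\<Sum>k = 0..<a * b. kron (1\<^sub>m a) Q $$ (r, k) * kron P (1\<^sub>m b) $$ (k, s))"
      using rs c by (auto simp: scalar_prod_def)
    also have "\<dots> = (\<Sum>k = 0..<a * b. if k = k2 then P $$ (r div b, s div b) * Q $$ (r mod b, s mod b) else 0)"
    proof (rule sum.cong[OF refl])
      fix x assume "x \<in> {0..<a * b}"
      then have x: "x < a * b" by simp
      have "x = k2 \<longleftrightarrow> x div b = r div b \<and> x mod b = s mod b"
        using k by (metis div_mult_mod_eq)
      then show "kron (1\<^sub>m a) Q $$ (r, x) * kron P (1\<^sub>m b) $$ (x, s) =
          (if x = k2 then P $$ (r div b, s div b) * Q $$ (r mod b, s mod b) else 0)"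
        using l div_mod_less[OF x] P Q rs x
        by (auto simp: kron_index[of _ a a _ b b])
    qed
    also have "\<dots> = kron P Q $$ (r, s)" using k kron_index[OF P Q rs] by simp
    finally have 2: "(kron (1\<^sub>m a) Q * kron P (1\<^sub>m b)) $$ (r, s) = kron P Q $$ (r, s)" .
    note 1 2
  } note e = this
  show "kron P (1\<^sub>m b) * kron (1\<^sub>m a) Q = kron P Q" using e(1) c by (intro eq_matI) auto
  show "kron (1\<^sub>m a) Q * kron P (1\<^sub>m b) = kron P Q" using e(2) c by (intro eq_matI) auto
qed

lemma site_op_carrier:
  assumes "A \<in> carrier_mat 2 2" "1 \<le> j" "j \<le> N"
  shows "site_op N A j \<in> carrier_mat (2 ^ N) (2 ^ N)"
proof -
  have "(2::nat) ^ (j - 1) * 2 * 2 ^ (N - j) = 2 ^ (j - 1 + 1 + (N - j))" by (simp add: power_add)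
  also have "j - 1 + 1 + (N - j) = N" using assms by simp
  finally have e: "(2::nat) ^ (j - 1) * 2 * 2 ^ (N - j) = 2 ^ N" .
  have "site_op N A j \<in> carrier_mat (2 ^ (j - 1) * 2 * 2 ^ (N - j)) (2 ^ (j - 1) * 2 * 2 ^ (N - j))"
    unfolding site_op_def using assms by (intro kron_carrier) auto
  then show ?thesis unfolding e .
qed

lemma one_adjoint_self: "mat_adjoint (1\<^sub>m n :: complex mat) = 1\<^sub>m n"
  by (rule mat_adjoint_eqI[of _ n]) auto

lemma site_op_adjoint_self:
  assumes "A \<in> carrier_mat 2 2" "mat_adjoint A = A"
  shows "mat_adjoint (site_op N A j) = site_op N A j"
  unfolding site_op_def using assms one_adjoint_self
  by (intro kron_adjoint_self[of _ "2 ^ (j - 1) * 2" _ "2 ^ (N - j)"]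
        kron_adjoint_self[of _ "2 ^ (j - 1)" _ 2] kron_carrier) auto

lemma site_op_neighbours_commute:
  assumes A: "A \<in> carrier_mat 2 2" and B: "B \<in> carrier_mat 2 2" and i: "1 \<le> i" "i < N"
  shows "site_op N A i * site_op N B (i + 1) = site_op N B (i + 1) * site_op N A i"
proof -
  define P where "P = kron (1\<^sub>m (2 ^ (i - 1))) A"
  define Q where "Q = kron B (1\<^sub>m (2 ^ (N - (i + 1))))"
  have ei: "(2::nat) ^ (i - 1) * 2 = 2 ^ i" using i by (metis One_nat_def Suc_pred' less_eq_Suc_le power_Suc2)
  have eN: "2 * (2::nat) ^ (N - (i + 1)) = 2 ^ (N - i)" using i
    by (metis Suc_diff_Suc Suc_eq_plus1 power_Suc)
  have P: "P \<in> carrier_mat (2 ^ i) (2 ^ i)" unfolding P_def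
    using kron_carrier[OF one_carrier_mat[of "2 ^ (i - 1)"] A] unfolding ei .
  have Q: "Q \<in> carrier_mat (2 ^ (N - i)) (2 ^ (N - i))" unfolding Q_def
    using kron_carrier[OF B one_carrier_mat[of "2 ^ (N - (i + 1))"]] unfolding eN .
  have 1: "site_op N A i = kron P (1\<^sub>m (2 ^ (N - i)))" unfolding site_op_def P_def ..
  have 2: "site_op N B (i + 1) = kron (1\<^sub>m (2 ^ i)) Q" unfolding site_op_def Q_def
    using kron_assoc[OF one_carrier_mat[of "2 ^ i"] B one_carrier_mat[of "2 ^ (N - (i + 1))"]] by simp
  show ?thesis unfolding 1 2 kron_split[OF P Q] ..
qed

lemma sigma_carrier:
  "sigma_x \<in> carrier_mat 2 2" "sigma_y \<in> carrier_mat 2 2" "sigma_z \<in> carrier_mat 2 2"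
  unfolding sigma_x_def sigma_y_def sigma_z_def mat_of_rows_list_def by auto

lemma sigma_adjoint_self:
  "mat_adjoint sigma_x = sigma_x" "mat_adjoint sigma_y = sigma_y" "mat_adjoint sigma_z = sigma_z"
  by (rule mat_adjoint_eqI[of _ 2, OF sigma_carrier(1)] mat_adjoint_eqI[of _ 2, OF sigma_carrier(2)]
      mat_adjoint_eqI[of _ 2, OF sigma_carrier(3)];
      auto simp: sigma_x_def sigma_y_def sigma_z_def mat_of_rows_list_def less_2_cases_iff)+

definition self_adjoint_mat :: "nat \<Rightarrow> complex mat \<Rightarrow> bool" where
  "self_adjoint_mat n A \<longleftrightarrow> A \<in> carrier_mat n n \<and> mat_adjoint A = A"

lemma self_adjoint_add:
  assumes "self_adjoint_mat n A" "self_adjoint_mat n B" shows "self_adjoint_mat n (A + B)"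
proof -
  have c: "A \<in> carrier_mat n n" "B \<in> carrier_mat n n" using assms by (auto simp: self_adjoint_mat_def)
  then have "(A + B) $$ (i, j) = conjugate ((A + B) $$ (j, i))" if "i < n" "j < n" for i j
    using that c assms mat_adjoint_index_self[of A n i j] mat_adjoint_index_self[of B n i j]
    by (auto simp: self_adjoint_mat_def)
  then show ?thesis unfolding self_adjoint_mat_def
    using c by (auto intro!: mat_adjoint_eqI[of _ n])
qed

lemma self_adjoint_minus:
  assumes "self_adjoint_mat n A" "self_adjoint_mat n B" shows "self_adjoint_mat n (A - B)"
proof -
  have c: "A \<in> carrier_mat n n" "B \<in> carrier_mat n n" using assms by (auto simp: self_adjoint_mat_def)
  then have "(A - B) $$ (i, j) = conjugate ((A - B) $$ (j, i))" if "i < n" "j < n" for i j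
    using that c assms mat_adjoint_index_self[of A n i j] mat_adjoint_index_self[of B n i j]
    by (auto simp: self_adjoint_mat_def)
  then show ?thesis unfolding self_adjoint_mat_def
    using c by (auto intro!: mat_adjoint_eqI[of _ n])
qed

lemma self_adjoint_smult:
  assumes "self_adjoint_mat n A" shows "self_adjoint_mat n (complex_of_real x \<cdot>\<^sub>m A)"
proof -
  have c: "A \<in> carrier_mat n n" using assms by (auto simp: self_adjoint_mat_def)
  then have "(complex_of_real x \<cdot>\<^sub>m A) $$ (i, j) = conjugate ((complex_of_real x \<cdot>\<^sub>m A) $$ (j, i))"
    if "i < n" "j < n" for i j
    using that c assms mat_adjoint_index_self[of A n i j]
    by (auto simp: self_adjoint_mat_def)
  then show ?thesis unfolding self_adjoint_mat_def
    using c by (auto intro!: mat_adjoint_eqI[of _ n])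
qed

lemma self_adjoint_finsum:
  assumes "finite I" "\<And>i. i \<in> I \<Longrightarrow> self_adjoint_mat n (f i)"
  shows "self_adjoint_mat n (\<Oplus>\<^bsub>module_mat TYPE(complex) n n\<^esub> i\<in>I. f i)"
proof -
  interpret M: matrix_vs n n "TYPE(complex)" .
  show ?thesis using assms
  proof (induction I rule: finite_induct)
    case empty
    then show ?case
      by (auto simp: self_adjoint_mat_def module_mat_simps intro!: mat_adjoint_eqI[of _ n])
  next
    case (insert x F)
    then have "f \<in> F \<rightarrow> carrier_mat n n" "f x \<in> carrier_mat n n"
      by (auto simp: self_adjoint_mat_def)
    from M.finsum_insert[OF insert(1,2) this] show ?case
      using insert self_adjoint_add by simp
  qed
qed

lemma self_adjoint_bond:
  assumes "A \<in> carrier_mat 2 2" "mat_adjoint A = A" "1 \<le> i" "i < N"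
  shows "self_adjoint_mat (2 ^ N) (site_op N A i * site_op N A (i + 1))"
proof -
  have c: "site_op N A i \<in> carrier_mat (2 ^ N) (2 ^ N)" "site_op N A (i + 1) \<in> carrier_mat (2 ^ N) (2 ^ N)"
    using assms by (auto intro!: site_op_carrier)
  show ?thesis unfolding self_adjoint_mat_def
    using c mat_adjoint_mult[OF c] site_op_adjoint_self[OF assms(1,2)]
      site_op_neighbours_commute[OF assms(1,1,3,4)] by auto
qed

lemma XXZ_self_adjoint: "self_adjoint_mat (2 ^ N) (XXZ N J h t)"
proof -
  have "self_adjoint_mat (2 ^ N) (site_op N sigma_z i)" if "i \<in> {1..N}" for i
    using that sigma_carrier sigma_adjoint_self
    by (auto simp: self_adjoint_mat_def intro!: site_op_carrier site_op_adjoint_self)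
  then show ?thesis unfolding XXZ_def
    by (intro self_adjoint_minus self_adjoint_add self_adjoint_smult self_adjoint_finsum
        self_adjoint_bond sigma_carrier sigma_adjoint_self) auto
qed

lemma self_adjoint_inner:
  assumes "self_adjoint_mat n A" "v \<in> carrier_vec n" "w \<in> carrier_vec n"
  shows "(A *\<^sub>v v) \<bullet>c w = v \<bullet>c (A *\<^sub>v w)"
proof -
  have A: "A \<in> carrier_mat n n" "mat_adjoint A = A" using assms by (auto simp: self_adjoint_mat_def)
  have "(A *\<^sub>v v) \<bullet>c w = (\<Sum>i = 0..<n. \<Sum>j = 0..<n. A $$ (i, j) * v $ j * conjugate (w $ i))"
    using A assms by (auto simp: scalar_prod_def sum_distrib_right intro!: sum.cong)
  also have "\<dots> = (\<Sum>j = 0..<n. \<Sum>i = 0..<n. A $$ (i, j) * v $ j * conjugate (w $ i))"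
    by (rule sum.swap)
  also have "\<dots> = v \<bullet>c (A *\<^sub>v w)"
    using A assms mat_adjoint_index_self[OF A]
    by (auto simp: scalar_prod_def sum_distrib_left ac_simps intro!: sum.cong)
  finally show ?thesis .
qed

lemma spectrum_eq_real_spectrum:
  assumes "self_adjoint_mat n A"
  shows "spectrum A = complex_of_real ` real_spectrum A"
proof -
  have "z \<in> complex_of_real ` real_spectrum A" if z: "z \<in> spectrum A" for z
  proof -
    from z obtain v where v: "v \<in> carrier_vec n" "v \<noteq> 0\<^sub>v n" "A *\<^sub>v v = z \<cdot>\<^sub>v v"
      using assms by (auto simp: spectrum_def eigenvalue_def eigenvector_def self_adjoint_mat_def)
    have "z * (v \<bullet>c v) = (A *\<^sub>v v) \<bullet>c v" using v by simp
    also have "\<dots> = v \<bullet>c (A *\<^sub>v v)" by (rule self_adjoint_inner[OF assms v(1) v(1)])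
    also have "\<dots> = cnj z * (v \<bullet>c v)" using v by (simp add: conjugate_smult_vec)
    finally have "z = cnj z" using v conjugate_square_eq_0_vec[OF v(1)] by auto
    then have "z = complex_of_real (Re z)" by (simp add: complex_eq_iff)
    then show ?thesis using z unfolding real_spectrum_def by (metis image_eqI mem_Collect_eq)
  qed
  then show ?thesis by (auto simp: real_spectrum_def)
qed

lemma orthogonal_projection_unique:
  assumes "orthogonal_projection_onto P n W" "orthogonal_projection_onto Q n W"
  shows "P = Q"
proof -
  have *: "P * Q = Q" if P: "orthogonal_projection_onto P n W" and Q: "orthogonal_projection_onto Q n W" for P Q
  proof (rule eq_matI)
    have c: "P \<in> carrier_mat n n" "Q \<in> carrier_mat n n" "P * P = P"
      using P Q by (auto simp: orthogonal_projection_onto_def)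
    show "dim_row (P * Q) = dim_row Q" "dim_col (P * Q) = dim_col Q" using c by auto
    fix i j assume "i < dim_row Q" "j < dim_col Q"
    then have ij: "i < n" "j < n" using c by auto
    have "col Q j = Q *\<^sub>v unit_vec n j" using c ij by (intro eq_vecI) auto
    then have "col Q j \<in> {Q *\<^sub>v v | v. v \<in> carrier_vec n}" using unit_vec_carrier by blast
    then have "col Q j \<in> {P *\<^sub>v v | v. v \<in> carrier_vec n}"
      using P Q unfolding orthogonal_projection_onto_def by (elim conjE) (simp only:)
    then obtain v where v: "v \<in> carrier_vec n" "col Q j = P *\<^sub>v v" by auto
    have "P *\<^sub>v col Q j = col Q j"
      using v c assoc_mult_mat_vec[OF c(1) c(1) v(1)] by simp
    then have "(P *\<^sub>v col Q j) $ i = Q $$ (i, j)" using c ij by simp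
    then show "(P * Q) $$ (i, j) = Q $$ (i, j)" using c ij by simp
  qed
  have c: "P \<in> carrier_mat n n" "Q \<in> carrier_mat n n" "mat_adjoint P = P" "mat_adjoint Q = Q"
    using assms by (auto simp: orthogonal_projection_onto_def)
  have "Q = P * Q" using *[OF assms] by simp
  then have "mat_adjoint Q = Q * P" using mat_adjoint_mult[OF c(1,2)] c by simp
  then show ?thesis using *[OF assms(2,1)] c by simp
qed

lemma orthogonal_projection_exists:
  fixes W :: "complex vec set"
  assumes W: "W \<subseteq> carrier_vec n" "0\<^sub>v n \<in> W"
    and add: "\<And>v w. v \<in> W \<Longrightarrow> w \<in> W \<Longrightarrow> v + w \<in> W"
    and smult: "\<And>a v. v \<in> W \<Longrightarrow> a \<cdot>\<^sub>v v \<in> W"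
  shows "\<exists>P. orthogonal_projection_onto P n W"
proof -
  define proj where "proj P \<longleftrightarrow> self_adjoint_mat n P \<and> P * P = P \<and> (\<forall>v\<in>carrier_vec n. P *\<^sub>v v \<in> W)" for P
  define tr where "tr P = (\<Sum>i<n. P $$ (i, i))" for P :: "complex mat"
  define T where "T = {k. \<exists>P. proj P \<and> tr P = of_nat k}"
  have diag: "Re (P $$ (i, i)) \<le> 1" if P: "proj P" and i: "i < n" for P i
  proof -
    have c: "P \<in> carrier_mat n n" "mat_adjoint P = P" "P * P = P"
      using P by (auto simp: proj_def self_adjoint_mat_def)
    have "(P * P) $$ (i, i) = (\<Sum>j = 0..<n. P $$ (i, j) * P $$ (j, i))"
      using c(1) i by (simp add: scalar_prod_def)
    then have "P $$ (i, i) = (\<Sum>j = 0..<n. P $$ (i, j) * P $$ (j, i))"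
      unfolding c(3) .
    also have "\<dots> = (\<Sum>j = 0..<n. complex_of_real ((cmod (P $$ (i, j)))\<^sup>2))"
    proof (rule sum.cong[OF refl])
      fix j assume "j \<in> {0..<n}"
      then have "P $$ (j, i) = cnj (P $$ (i, j))"
        using mat_adjoint_index_self[OF c(1,2), of j i] i by simp
      then show "P $$ (i, j) * P $$ (j, i) = complex_of_real ((cmod (P $$ (i, j)))\<^sup>2)"
        by (simp add: complex_norm_square del: of_real_power)
    qed
    finally have "Re (P $$ (i, i)) = (\<Sum>j = 0..<n. (cmod (P $$ (i, j)))\<^sup>2)"
      by (metis Re_complex_of_real of_real_sum)
    also have "\<dots> \<ge> (cmod (P $$ (i, i)))\<^sup>2"
      using i by (intro member_le_sum) auto
    finally have "(cmod (P $$ (i, i)))\<^sup>2 \<le> Re (P $$ (i, i))" .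
    moreover have "Re (P $$ (i, i)) \<le> cmod (P $$ (i, i))" by (rule complex_Re_le_cmod)
    ultimately have "cmod (P $$ (i, i)) * cmod (P $$ (i, i)) \<le> cmod (P $$ (i, i)) * 1"
      by (simp add: power2_eq_square)
    then have "cmod (P $$ (i, i)) \<le> 1"
      by (cases "P $$ (i, i) = 0") auto
    then show ?thesis using complex_Re_le_cmod[of "P $$ (i, i)"] by linarith
  qed
  have bound: "k \<le> n" if k: "k \<in> T" for k
  proof -
    obtain P where P: "proj P" "tr P = of_nat k" using k unfolding T_def by auto
    have "real k = (\<Sum>i<n. Re (P $$ (i, i)))" using P(2) unfolding tr_def
      by (metis Re_sum complex_Re_of_nat)
    also have "\<dots> \<le> (\<Sum>i<n. 1)" using diag[OF P(1)] by (intro sum_mono) auto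
    finally show ?thesis by simp
  qed
  have "0\<^sub>m n n *\<^sub>v v = (0\<^sub>v n :: complex vec)" if "v \<in> carrier_vec n" for v
    using that by (intro eq_vecI) auto
  then have "proj (0\<^sub>m n n)" "tr (0\<^sub>m n n) = of_nat 0"
    using W by (auto simp: proj_def self_adjoint_mat_def tr_def intro!: mat_adjoint_eqI[of _ n])
  then have "T \<noteq> {}" unfolding T_def by blast
  moreover have fin: "finite T" using bound by (meson finite_nat_set_iff_bounded_le)
  ultimately obtain P where P: "proj P" "tr P = of_nat (Max T)" using Max_in[of T] unfolding T_def by auto
  have c: "P \<in> carrier_mat n n" "mat_adjoint P = P" "P * P = P" "self_adjoint_mat n P"
    and PW: "\<And>v. v \<in> carrier_vec n \<Longrightarrow> P *\<^sub>v v \<in> W"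
    using P by (auto simp: proj_def self_adjoint_mat_def)
  have fixed: "P *\<^sub>v w = w" if w: "w \<in> W" for w
  proof (rule ccontr)
    assume neq: "P *\<^sub>v w \<noteq> w"
    have wc: "w \<in> carrier_vec n" "P *\<^sub>v w \<in> carrier_vec n" using w W c by auto
    define u where "u = w + (- 1) \<cdot>\<^sub>v (P *\<^sub>v w)"
    have uW: "u \<in> W" unfolding u_def using w PW wc by (intro add smult) auto
    then have uc: "u \<in> carrier_vec n" using W by auto
    have u0: "u \<noteq> 0\<^sub>v n"
    proof
      assume u: "u = 0\<^sub>v n"
      have "P *\<^sub>v w = w"
      proof (rule eq_vecI)
        fix i assume i: "i < dim_vec w"
        have "u $ i = w $ i - (P *\<^sub>v w) $ i"
          unfolding u_def using i wc c(1) by (simp del: index_mult_mat_vec)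
        then show "(P *\<^sub>v w) $ i = w $ i" using u i wc by (simp del: index_mult_mat_vec)
      qed (use wc c in auto)
      then show False using neq by simp
    qed
    have "P *\<^sub>v u = P *\<^sub>v w + (- 1) \<cdot>\<^sub>v (P *\<^sub>v (P *\<^sub>v w))"
      unfolding u_def using c wc by (simp add: mult_add_distrib_mat_vec mult_mat_vec)
    also have "P *\<^sub>v (P *\<^sub>v w) = P *\<^sub>v w"
      using assoc_mult_mat_vec[OF c(1) c(1) wc(1)] c(3) by simp
    also have "P *\<^sub>v w + (- 1) \<cdot>\<^sub>v (P *\<^sub>v w) = 0\<^sub>v n"
      using c(1) by (intro eq_vecI) (simp_all del: index_mult_mat_vec)
    finally have Pu: "P *\<^sub>v u = 0\<^sub>v n" .
    define s where "s = u \<bullet>c u"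
    have s0: "s \<noteq> 0" unfolding s_def using u0 uc by simp
    have s_sum: "s = (\<Sum>i = 0..<n. u $ i * cnj (u $ i))"
      unfolding s_def using uc by (simp add: scalar_prod_def)
    have s_real: "cnj s = s" unfolding s_sum by (simp add: mult.commute)
    define R where "R = mat n n (\<lambda>(i, j). u $ i * cnj (u $ j) / s)"
    have Rc: "R \<in> carrier_mat n n" unfolding R_def by simp
    have Rs: "mat_adjoint R = R"
      by (rule mat_adjoint_eqI[OF Rc]) (auto simp: R_def s_real)
    have PR: "P * R = 0\<^sub>m n n"
    proof (rule eq_matI)
      fix i j assume "i < dim_row (0\<^sub>m n n :: complex mat)" "j < dim_col (0\<^sub>m n n :: complex mat)"
      then have ij: "i < n" "j < n" by auto
      have "(P *\<^sub>v u) $ i = 0" using Pu ij by simp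
      then have z: "(\<Sum>k = 0..<n. P $$ (i, k) * u $ k) = 0"
        using ij c uc by (simp add: scalar_prod_def)
      have "(P * R) $$ (i, j) = (\<Sum>k = 0..<n. P $$ (i, k) * (u $ k * cnj (u $ j) / s))"
        using ij c Rc by (simp add: scalar_prod_def R_def)
      also have "\<dots> = (\<Sum>k = 0..<n. P $$ (i, k) * u $ k) * (cnj (u $ j) / s)"
        unfolding sum_distrib_right by (intro sum.cong) auto
      finally show "(P * R) $$ (i, j) = 0\<^sub>m n n $$ (i, j)" using z ij by simp
    qed (use c Rc in auto)
    have RP: "R * P = 0\<^sub>m n n"
    proof -
      have "R * P = mat_adjoint (P * R)" using mat_adjoint_mult[OF c(1) Rc] c(2) Rs by simp
      also have "\<dots> = 0\<^sub>m n n" unfolding PR by (rule mat_adjoint_eqI[of _ n]) auto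
      finally show ?thesis .
    qed
    have RR: "R * R = R"
    proof (rule eq_matI)
      fix i j assume "i < dim_row R" "j < dim_col R"
      then have ij: "i < n" "j < n" using Rc by auto
      have "(R * R) $$ (i, j) = (\<Sum>k = 0..<n. (u $ i * cnj (u $ k) / s) * (u $ k * cnj (u $ j) / s))"
        using ij by (simp add: scalar_prod_def R_def)
      also have "\<dots> = (\<Sum>k = 0..<n. u $ k * cnj (u $ k)) * (u $ i * cnj (u $ j) / (s * s))"
        unfolding sum_distrib_right by (intro sum.cong) auto
      also have "\<dots> = R $$ (i, j)" using ij s0 by (simp add: R_def flip: s_sum)
      finally show "(R * R) $$ (i, j) = R $$ (i, j)" .
    qed (use Rc in auto)
    have idem: "(P + R) * (P + R) = P + R"
      using c Rc PR RP RR by (simp add: add_mult_distrib_mat[of _ n n] mult_add_distrib_mat[of _ n n])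
    have range: "(P + R) *\<^sub>v v \<in> W" if v: "v \<in> carrier_vec n" for v
    proof -
      have "R *\<^sub>v v = ((v \<bullet>c u) / s) \<cdot>\<^sub>v u"
      proof (rule eq_vecI)
        fix i assume "i < dim_vec (((v \<bullet>c u) / s) \<cdot>\<^sub>v u)"
        then have i: "i < n" using uc by simp
        have "(R *\<^sub>v v) $ i = (\<Sum>k = 0..<n. u $ i * cnj (u $ k) / s * v $ k)"
          using i v by (simp add: R_def scalar_prod_def)
        also have "\<dots> = (\<Sum>k = 0..<n. v $ k * cnj (u $ k)) / s * u $ i"
          unfolding sum_distrib_right sum_divide_distrib by (intro sum.cong) auto
        finally show "(R *\<^sub>v v) $ i = (((v \<bullet>c u) / s) \<cdot>\<^sub>v u) $ i"
          using i uc v by (simp add: scalar_prod_def)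
      qed (use uc Rc in auto)
      then have "R *\<^sub>v v \<in> W" using smult[OF uW] by simp
      then show ?thesis using add[OF PW[OF v]] add_mult_distrib_mat_vec[OF c(1) Rc v] by simp
    qed
    have "proj (P + R)" unfolding proj_def using idem range self_adjoint_add[OF c(4)] Rc Rs
      by (auto simp: self_adjoint_mat_def)
    moreover have "tr (P + R) = of_nat (Suc (Max T))"
    proof -
      have "tr R = 1" unfolding tr_def R_def using s0
        by (simp add: s_sum lessThan_atLeast0 flip: sum_divide_distrib)
      moreover have "tr (P + R) = tr P + tr R" unfolding tr_def
        using c Rc by (simp add: sum.distrib)
      ultimately show ?thesis using P by simp
    qed
    ultimately have "Suc (Max T) \<in> T" unfolding T_def by blast
    then show False using Max_ge[OF fin] by fastforce
  qed
  have "W = {P *\<^sub>v v | v. v \<in> carrier_vec n}"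
  proof
    show "W \<subseteq> {P *\<^sub>v v | v. v \<in> carrier_vec n}"
    proof
      fix w assume "w \<in> W"
      then have "w = P *\<^sub>v w" "w \<in> carrier_vec n" using fixed[of w] W by auto
      then show "w \<in> {P *\<^sub>v v | v. v \<in> carrier_vec n}" by blast
    qed
    show "{P *\<^sub>v v | v. v \<in> carrier_vec n} \<subseteq> W" using PW by auto
  qed
  then show ?thesis using c unfolding orthogonal_projection_onto_def by auto
qed

lemma spectral_projection_onto:
  assumes A: "A \<in> carrier_mat n n"
  shows "orthogonal_projection_onto (spectral_projection A S) n (spectral_subspace A S)"
proof -
  interpret V: vec_space "TYPE(complex)" n .
  let ?U = "{v. \<exists>x\<in>S. eigenvector A v (complex_of_real x)}"
  have U: "?U \<subseteq> carrier_vec n" using A by (auto simp: eigenvector_def)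
  have W: "spectral_subspace A S = V.span ?U" using A by (auto simp: spectral_subspace_def)
  have sub: "submodule class_ring (V.span ?U) V.V" using V.span_is_submodule U by simp
  have "\<exists>P. orthogonal_projection_onto P n (V.span ?U)"
  proof (rule orthogonal_projection_exists)
    show "V.span ?U \<subseteq> carrier_vec n" using V.span_is_subset2 U by simp
    show "0\<^sub>v n \<in> V.span ?U" using submodule.zero_closed[OF sub] by (simp add: module_vec_simps)
    show "v + w \<in> V.span ?U" if "v \<in> V.span ?U" "w \<in> V.span ?U" for v w
      using submodule.m_closed[OF sub that] by (simp add: module_vec_simps)
    show "a \<cdot>\<^sub>v v \<in> V.span ?U" if "v \<in> V.span ?U" for a v
      using submodule.smult_closed[OF sub _ that, of a] by (simp add: module_vec_simps class_ring_simps)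
  qed
  then obtain P where P: "orthogonal_projection_onto P n (V.span ?U)" by blast
  have d: "dim_row A = n" using A by simp
  show ?thesis unfolding spectral_projection_def W d
    using P orthogonal_projection_unique[OF _ P] by (rule theI)
qed
lemma spectrum_XXZ: "spectrum (XXZ N J h t) = complex_of_real ` real_spectrum (XXZ N J h t)"
  by (rule spectrum_eq_real_spectrum[OF XXZ_self_adjoint])

end

theory Submission
  imports Defs
begin

text \<open>
  Ferromagnetic case: the state with all spins up is an exact eigenvector, and in the product basis
  the off-diagonal part of a column has absolute sum \<open>\<bar>t\<bar>\<close> times the number of kinks, while a kink costs
  the energy \<open>2 J\<close>. A Gershgorin estimate gives the gap.

  Antiferromagnetic case, \<open>J = - g\<close>: describe a configuration by its first spin and by the set \<open>B\<close>
  of its ferromagnetic bonds. In each sector of the global spin flip the Hamiltonian without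
  field becomes \<open>2 g \<bar>B\<bar>\<close> plus the hopping terms "if bond \<open>i\<close> is not in \<open>B\<close>, toggle the bonds \<open>i - 1\<close> and
  \<open>i + 1\<close>", and its vacuum \<open>B = {}\<close> is a Neel state. The ground state is sought in the form \<open>exp v\<close> in
  the algebra of functions of finite sets whose product is the convolution over disjoint unions.
  Since every hopping term is local, this leads to a polynomial fixed point equation for the clusters \<open>v\<close>
  in which all extensive quantities cancel; it is solvable for small \<open>t\<close>, uniformly in the length,
  with \<open>\<Sum>\<bar>v B\<bar> \<le> 1\<close> over all \<open>B\<close> through a given bond. Conjugation by \<open>exp v\<close> turns the Hamiltonian into
  \<open>e + 2 g \<bar>B\<bar>\<close> plus a remainder that kills the vacuum and whose column at \<open>B\<close> has absolute sum
  at most \<open>300 \<bar>t\<bar> \<bar>B\<bar>\<close>, so that Gershgorin's argument applies again. Multiplication by \<open>exp (- v)\<close> only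
  enlarges sets; as magnetization \<open>m\<close> forces \<open>\<bar>B\<bar> \<ge> \<bar>m\<bar> - 1\<close>, the estimate improves with \<open>\<bar>m\<bar>\<close>
  enough to absorb the magnetic field.
\<close>


section \<open>Functions of finite sets\<close>

text \<open>The hopping part has norm of order \<open>\<bar>t\<bar> * N\<close>, so perturbation
  theory in operator norm gives no range of \<open>t\<close> uniform in \<open>N\<close>. What
  survives is a bound of its columns relative to the excitation energy. For the ferromagnet this
  holds at once, since the vacuum column vanishes. A Neel state is moved by every hopping term: its
  column has size \<open>\<bar>t\<bar> * (N - 1)\<close> against excitation energy 0. The
  conjugation by an exponential repairs this one column, and because it respects locality the other
  columns stay proportional to \<open>card B\<close>. It is not unitary and destroys symmetry in
  general; hence absolute column sums throughout instead of Hilbert space norms. Amplitudes are real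
  because the Hamiltonian is real in the product basis. The magnetization is conserved, so the field
  is a constant in each magnetization class and never enters the cluster equation; \<open>h\<close>
  comes back only in the final comparison of thresholds. Existence of the clusters rests on a single
  a priori bound, invariance of the unit ball, and a majorant with nonnegative coefficients takes
  the place of a Lipschitz estimate.\<close>

text \<open>The product below is that of polynomials in commuting variables with vanishing squares.\<close>
typedef galg = "{f :: nat set \<Rightarrow> real. \<forall>B. infinite B \<longrightarrow> f B = 0}"
  morphisms coef Abs_galg
  by (rule exI[of _ "\<lambda>_. 0"]) simp

setup_lifting type_definition_galg

lemma galg_eqI: "(\<And>B. finite B \<Longrightarrow> coef f B = coef g B) \<Longrightarrow> f = g"
  by transfer (metis ext)

lemma coef_infinite [simp]: "infinite B \<Longrightarrow> coef f B = 0"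
  by transfer simp

lemma sum_Pow_Diff: "(\<Sum>C\<in>Pow B. f C (B - C)) = (\<Sum>C\<in>Pow B. f (B - C) C)"
  by (rule sum.reindex_bij_witness[of _ "\<lambda>C. B - C" "\<lambda>C. B - C"])
     (auto simp: double_diff Diff_Diff_Int Int_absorb1)

text \<open>Both sides run over the ordered splittings of \<open>B\<close> into three disjoint
  parts; the left groups them by the union of the first two parts, the right by the first
  part.\<close>

lemma sum_Pow_assoc:
  fixes f g h :: "nat set \<Rightarrow> real"
  assumes "finite B"
  shows "(\<Sum>C\<in>Pow B. (\<Sum>D\<in>Pow C. f D * g (C - D)) * h (B - C)) =
    (\<Sum>C\<in>Pow B. f C * (\<Sum>D\<in>Pow (B - C). g D * h (B - C - D)))"
proof -
  have "(\<Sum>C\<in>Pow B. (\<Sum>D\<in>Pow C. f D * g (C - D)) * h (B - C)) =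
      (\<Sum>(C, D)\<in>Sigma (Pow B) Pow. f D * g (C - D) * h (B - C))"
    using assms by (subst sum.Sigma[symmetric]) (auto simp: sum_distrib_right finite_subset)
  also have "\<dots> = (\<Sum>(C, D)\<in>Sigma (Pow B) (\<lambda>C. Pow (B - C)). f C * (g D * h (B - C - D)))"
    by (rule sum.reindex_bij_witness[of _ "\<lambda>(C, D). (C \<union> D, C)" "\<lambda>(C, D). (D, C - D)"])
       (auto simp: Un_Diff Diff_Un Diff_Int_distrib mult.assoc intro!: arg_cong2[of _ _ _ _ "(*)"] arg_cong[of _ _ g] arg_cong[of _ _ h])
  also have "\<dots> = (\<Sum>C\<in>Pow B. f C * (\<Sum>D\<in>Pow (B - C). g D * h (B - C - D)))"
    using assms by (subst sum.Sigma[symmetric]) (auto simp: sum_distrib_left)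
  finally show ?thesis .
qed

instantiation galg :: comm_ring_1
begin

lift_definition zero_galg :: galg is "\<lambda>_. 0" by simp
lift_definition one_galg :: galg is "\<lambda>B. if B = {} then 1 else 0" by auto
lift_definition plus_galg :: "galg \<Rightarrow> galg \<Rightarrow> galg" is "\<lambda>f g B. f B + g B" by simp
lift_definition minus_galg :: "galg \<Rightarrow> galg \<Rightarrow> galg" is "\<lambda>f g B. f B - g B" by simp
lift_definition uminus_galg :: "galg \<Rightarrow> galg" is "\<lambda>f B. - f B" by simp
text \<open>For infinite \<open>B\<close> the index set \<open>Pow B\<close> is infinite and the sum
  has the default value 0, so the product stays in the type.\<close>

lift_definition times_galg :: "galg \<Rightarrow> galg \<Rightarrow> galg" is "\<lambda>f g B. \<Sum>C\<in>Pow B. f C * g (B - C)"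
  by (simp add: finite_Pow_iff)

instance
proof
  fix a b c :: galg
  show "a * b * c = a * (b * c)"
  proof (rule galg_eqI)
    fix B :: "nat set" assume "finite B"
    then show "coef (a * b * c) B = coef (a * (b * c)) B"
      using sum_Pow_assoc[of B "coef a" "coef b" "coef c"] by (simp add: times_galg.rep_eq)
  qed
  show "a * b = b * a"
    by (rule galg_eqI) (simp add: times_galg.rep_eq sum_Pow_Diff[of "\<lambda>C D. coef a C * coef b D"] mult.commute)
  show "1 * a = a"
  proof (rule galg_eqI)
    fix B :: "nat set" assume "finite B"
    then have "coef (1 * a) B = (\<Sum>C\<in>Pow B. if C = {} then coef a B else 0)"
      unfolding times_galg.rep_eq one_galg.rep_eq by (intro sum.cong) auto
    then show "coef (1 * a) B = coef a B" using \<open>finite B\<close> by simp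
  qed
  show "(a + b) * c = a * c + b * c"
    by (rule galg_eqI) (simp add: times_galg.rep_eq plus_galg.rep_eq distrib_right sum.distrib)
  show "(0::galg) \<noteq> 1"
  proof
    assume "(0::galg) = 1"
    then have "coef 0 {} = coef 1 {}" by simp
    then show False by (simp add: zero_galg.rep_eq one_galg.rep_eq)
  qed
qed (transfer; auto)+

end

lemma coef_simps [simp]:
  "coef 0 B = 0" "coef 1 B = (if B = {} then 1 else 0)" "coef (f + g) B = coef f B + coef g B"
  "coef (f - g) B = coef f B - coef g B" "coef (- f) B = - coef f B"
  by (simp_all add: zero_galg.rep_eq one_galg.rep_eq plus_galg.rep_eq minus_galg.rep_eq uminus_galg.rep_eq)

lemma coef_mult: "coef (f * g) B = (\<Sum>C\<in>Pow B. coef f C * coef g (B - C))"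
  by (simp add: times_galg.rep_eq)

lemma coef_sum [simp]: "coef (sum f A) B = (\<Sum>i\<in>A. coef (f i) B)"
  by (induction A rule: infinite_finite_induct) auto

lift_definition sc :: "real \<Rightarrow> galg \<Rightarrow> galg" is "\<lambda>c f B. c * f B" by simp
lift_definition mon :: "nat set \<Rightarrow> galg" is "\<lambda>C B. if finite B \<and> B = C then 1 else 0" by simp
text \<open>Every element is affine in each variable, \<open>f = rho x f + var x * dd x f\<close>:
  \<open>rho x\<close> sets the variable to 0 and \<open>dd x\<close> is the partial derivative.
  Below, \<open>num\<close> is the Euler operator, the particle number of physics.\<close>

lift_definition rho :: "nat \<Rightarrow> galg \<Rightarrow> galg" is "\<lambda>x f B. if x \<in> B then 0 else f B" by simp
lift_definition dd :: "nat \<Rightarrow> galg \<Rightarrow> galg" is "\<lambda>x f B. if x \<in> B then 0 else f (insert x B)" by simp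
lift_definition num :: "galg \<Rightarrow> galg" is "\<lambda>f B. real (card B) * f B" by simp

lemmas coef_ops [simp] = sc.rep_eq rho.rep_eq dd.rep_eq num.rep_eq
lemma coef_mon [simp]: "coef (mon C) B = (if finite B \<and> B = C then 1 else 0)"
  by (simp add: mon.rep_eq)

lemma sc_mult: "sc c f * g = sc c (f * g)" "f * sc c g = sc c (f * g)"
  by (rule galg_eqI; simp add: coef_mult sum_distrib_left mult.assoc mult.left_commute)+

lemma coef_mon_mult:
  assumes "finite C"
  shows "coef (mon C * f) B = (if C \<subseteq> B then coef f (B - C) else 0)"
proof (cases "finite B")
  case True
  have "coef (mon C * f) B = (\<Sum>D\<in>Pow B. if D = C then coef f (B - C) else 0)"
    unfolding coef_mult using assms by (intro sum.cong) auto
  then show ?thesis using True by simp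
next
  case False
  then show ?thesis using assms by (simp add: finite_Diff2)
qed

definition var :: "nat \<Rightarrow> galg" where "var x = mon {x}"

lemma coef_var_mult [simp]: "coef (var x * f) B = (if x \<in> B then coef f (B - {x}) else 0)"
  by (simp add: var_def coef_mon_mult)

lemma coef_var: "coef (var x) B = (if B = {x} then 1 else 0)"
  by (simp add: var_def)

lemma mon_mult_self: assumes "finite C" "C \<noteq> {}" shows "mon C * mon C = 0"
  by (rule galg_eqI) (use assms in \<open>auto simp: coef_mon_mult\<close>)

lemma var_mult_self [simp]: "var x * var x = 0" "var x * (var x * f) = 0"
proof -
  show "var x * var x = 0" unfolding var_def by (rule mon_mult_self) auto
  then show "var x * (var x * f) = 0" by (simp flip: mult.assoc)
qed

lemma rho_var_decomp: "f = rho x f + var x * dd x f"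
  by (rule galg_eqI) (auto simp: insert_absorb)

lemma rho_mult: "rho x (f * g) = rho x f * rho x g"
proof (rule galg_eqI)
  fix B :: "nat set" assume "finite B"
  show "coef (rho x (f * g)) B = coef (rho x f * rho x g) B"
  proof (cases "x \<in> B")
    case True
    then have "coef (rho x f) C * coef (rho x g) (B - C) = 0" for C by simp
    then have "coef (rho x f * rho x g) B = 0" unfolding coef_mult by (intro sum.neutral) blast
    then show ?thesis using True by simp
  next
    case False
    then show ?thesis by (simp add: coef_mult) (intro sum.cong; auto)
  qed
qed

text \<open>In a splitting of \<open>insert x B\<close> the point \<open>x\<close> lies in exactly
  one part, and the other factor enters through \<open>rho x\<close>. So \<open>dd x\<close> is a
  derivation twisted by \<open>rho x\<close>.\<close>

lemma dd_mult: "dd x (f * g) = dd x f * rho x g + rho x f * dd x g"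
proof (rule galg_eqI)
  fix B :: "nat set" assume "finite B"
  show "coef (dd x (f * g)) B = coef (dd x f * rho x g + rho x f * dd x g) B"
  proof (cases "x \<in> B")
    case True
    then have "coef (dd x f) C * coef (rho x g) (B - C) = 0"
       "coef (rho x f) C * coef (dd x g) (B - C) = 0" for C by auto
    then have "coef (dd x f * rho x g) B = 0" "coef (rho x f * dd x g) B = 0"
      unfolding coef_mult by (blast intro: sum.neutral)+
    then show ?thesis using True by simp
  next
    case False
    have inj: "inj_on (insert x) (Pow B)" using False by (auto simp: inj_on_def)
    have "coef (dd x (f * g)) B = (\<Sum>C\<in>Pow B \<union> insert x ` Pow B. coef f C * coef g (insert x B - C))"
      using False by (simp add: coef_mult Pow_insert)
    also have "\<dots> = (\<Sum>C\<in>Pow B. coef f C * coef g (insert x B - C)) +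
        (\<Sum>C\<in>insert x ` Pow B. coef f C * coef g (insert x B - C))"
      using False \<open>finite B\<close> by (intro sum.union_disjoint) auto
    also have "(\<Sum>C\<in>insert x ` Pow B. coef f C * coef g (insert x B - C)) =
        (\<Sum>C\<in>Pow B. coef f (insert x C) * coef g (B - C))"
      using False by (subst sum.reindex[OF inj]) (auto intro!: sum.cong arg_cong[of _ _ "coef g"])
    also have "\<dots> = coef (dd x f * rho x g) B"
      unfolding coef_mult using False by (intro sum.cong) auto
    also have "(\<Sum>C\<in>Pow B. coef f C * coef g (insert x B - C)) = coef (rho x f * dd x g) B"
      unfolding coef_mult using False by (intro sum.cong) (auto simp: insert_Diff_if)
    finally show ?thesis by simp
  qed
qed

lemma num_mult: "num (f * g) = num f * g + f * num g"
proof (rule galg_eqI)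
  fix B :: "nat set" assume B: "finite B"
  have "coef (num (f * g)) B = (\<Sum>C\<in>Pow B. real (card B) * (coef f C * coef g (B - C)))"
    by (simp add: coef_mult sum_distrib_left)
  also have "\<dots> = (\<Sum>C\<in>Pow B. real (card C) * coef f C * coef g (B - C) +
      coef f C * (real (card (B - C)) * coef g (B - C)))"
  proof (intro sum.cong refl)
    fix C assume "C \<in> Pow B"
    then have "card B = card C + card (B - C)"
      using B by (metis PowD card_Diff_subset card_mono finite_subset le_add_diff_inverse)
    then show "real (card B) * (coef f C * coef g (B - C)) = real (card C) * coef f C * coef g (B - C) +
      coef f C * (real (card (B - C)) * coef g (B - C))" by (simp add: algebra_simps)
  qed
  also have "\<dots> = coef (num f * g + f * num g) B"
    by (simp add: coef_mult sum.distrib)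
  finally show "coef (num (f * g)) B = coef (num f * g + f * num g) B" .
qed

lemma linear_simps:
  "rho x (f + g) = rho x f + rho x g" "dd x (f + g) = dd x f + dd x g" "num (f + g) = num f + num g"
  "rho x 1 = 1" "dd x 1 = 0" "num 1 = 0" "rho x (dd x f) = dd x f"
  by (rule galg_eqI; simp add: algebra_simps)+

text \<open>Creation plus annihilation at \<open>x\<close>: the Pauli matrix \<open>sigma_x\<close>
  acting on a bond variable.\<close>

definition flip :: "nat \<Rightarrow> galg \<Rightarrow> galg" where "flip x f = var x * f + dd x f"

lemma coef_flip [simp]: "coef (flip x f) B = coef f (if x \<in> B then B - {x} else insert x B)"
  by (simp add: flip_def)

section \<open>Weighted norms\<close>

definition nrm :: "nat set \<Rightarrow> galg \<Rightarrow> real" where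
  "nrm U f = (\<Sum>B\<in>Pow U. \<bar>coef f B\<bar>)"

text \<open>The factor \<open>1 / card B\<close> is the energy denominator of the cluster equation:
  since \<open>inv_num\<close> divides by a multiple of \<open>card B\<close>, the mass of a new
  iterate through \<open>p\<close> is controlled by \<open>wnrm U p\<close> of the hopping
  terms.\<close>

definition wnrm :: "nat set \<Rightarrow> nat \<Rightarrow> galg \<Rightarrow> real" where
  "wnrm U p f = (\<Sum>B\<in>Pow U. if p \<in> B then \<bar>coef f B\<bar> / card B else 0)"

lemma nrm_nonneg [simp]: "0 \<le> nrm U f" "0 \<le> wnrm U p f"
  unfolding nrm_def wnrm_def by (auto intro!: sum_nonneg)

lemma nrm_add: "nrm U (f + g) \<le> nrm U f + nrm U g"
  unfolding nrm_def sum.distrib[symmetric] by (intro sum_mono) simp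

lemma wnrm_add: "wnrm U p (f + g) \<le> wnrm U p f + wnrm U p g"
  unfolding wnrm_def sum.distrib[symmetric]
  by (intro sum_mono) (auto simp flip: add_divide_distrib intro!: divide_right_mono)

lemma nrm_sc: "nrm U (sc c f) = \<bar>c\<bar> * nrm U f" "wnrm U p (sc c f) = \<bar>c\<bar> * wnrm U p f"
  unfolding nrm_def wnrm_def sum_distrib_left by (auto simp: abs_mult intro!: sum.cong)

lemma nrm_one: "nrm U 1 = (if finite U then 1 else 0)" "wnrm U p 1 = 0"
  unfolding nrm_def wnrm_def by (auto simp: if_distrib[of abs] finite_Pow_iff intro!: sum.neutral cong: if_cong)

lemma nrm_diff: "nrm U (f - g) \<le> nrm U f + nrm U g"
  unfolding nrm_def sum.distrib[symmetric] by (intro sum_mono) simp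

lemma nrm_sum: "nrm U (sum f A) \<le> (\<Sum>i\<in>A. nrm U (f i))"
proof (induction A rule: infinite_finite_induct)
  case (insert x F)
  then show ?case using nrm_add[of U "f x" "sum f F"] by simp
qed (simp_all add: nrm_def)

lemma nrm_cong: "(\<And>B. B \<subseteq> U \<Longrightarrow> coef f B = coef g B) \<Longrightarrow> nrm U f = nrm U g"
  unfolding nrm_def by (intro sum.cong) auto

lemma sum_Pow_Sigma:
  fixes k :: "'a set \<Rightarrow> 'a set \<Rightarrow> 'b::comm_monoid_add"
  assumes "finite U"
  shows "(\<Sum>B\<in>Pow U. \<Sum>C\<in>Pow B. k C (B - C)) = (\<Sum>C\<in>Pow U. \<Sum>D\<in>Pow (U - C). k C D)"
proof -
  have f: "finite B" if "B \<in> Pow U" for B using that assms finite_subset by auto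
  have "(\<Sum>B\<in>Pow U. \<Sum>C\<in>Pow B. k C (B - C)) = (\<Sum>(B, C)\<in>Sigma (Pow U) Pow. k C (B - C))"
    using assms f by (subst sum.Sigma) auto
  also have "\<dots> = (\<Sum>(C, D)\<in>Sigma (Pow U) (\<lambda>C. Pow (U - C)). k C D)"
    by (rule sum.reindex_bij_witness[of _ "\<lambda>(C, D). (C \<union> D, C)" "\<lambda>(B, C). (C, B - C)"])
       (auto intro!: arg_cong2[of _ _ _ _ k])
  also have "\<dots> = (\<Sum>C\<in>Pow U. \<Sum>D\<in>Pow (U - C). k C D)"
    using assms by (subst sum.Sigma) auto
  finally show ?thesis .
qed

lemma nrm_mult: "nrm U (f * g) \<le> nrm U f * nrm U g"
proof (cases "finite U")
  case True
  have "nrm U (f * g) \<le> (\<Sum>B\<in>Pow U. \<Sum>C\<in>Pow B. \<bar>coef f C\<bar> * \<bar>coef g (B - C)\<bar>)"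
    unfolding nrm_def coef_mult by (intro sum_mono order.trans[OF sum_abs]) (simp add: abs_mult)
  also have "\<dots> = (\<Sum>C\<in>Pow U. \<Sum>D\<in>Pow (U - C). \<bar>coef f C\<bar> * \<bar>coef g D\<bar>)"
    using True by (rule sum_Pow_Sigma)
  also have "\<dots> \<le> (\<Sum>C\<in>Pow U. \<Sum>D\<in>Pow U. \<bar>coef f C\<bar> * \<bar>coef g D\<bar>)"
    using True by (intro sum_mono sum_mono2) auto
  also have "\<dots> = nrm U f * nrm U g" by (simp add: nrm_def sum_product)
  finally show ?thesis .
qed (simp add: nrm_def finite_Pow_iff)

text \<open>If \<open>p\<close> lies in \<open>B\<close>, it lies in exactly one of \<open>C\<close>
  and \<open>B - C\<close>, and the weight \<open>1 / card B\<close> is at most the weight of that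
  part. This gives a bound of Leibniz form.\<close>

lemma wnrm_mult: "wnrm U p (f * g) \<le> wnrm U p f * nrm U g + nrm U f * wnrm U p g"
proof (cases "finite U")
  case True
  have fin: "finite B" if "B \<subseteq> U" for B using that True finite_subset by auto
  define a where "a C = (if p \<in> C then \<bar>coef f C\<bar> / card C else 0)" for C
  define b where "b C = (if p \<in> C then \<bar>coef g C\<bar> / card C else 0)" for C
  have nn: "0 \<le> a C" "0 \<le> b C" for C by (auto simp: a_def b_def)
  have "wnrm U p (f * g) \<le> (\<Sum>B\<in>Pow U. \<Sum>C\<in>Pow B. a C * \<bar>coef g (B - C)\<bar> + \<bar>coef f C\<bar> * b (B - C))"
    unfolding wnrm_def
  proof (intro sum_mono)
    fix B assume "B \<in> Pow U"
    then have B: "finite B" using fin by auto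
    show "(if p \<in> B then \<bar>coef (f * g) B\<bar> / card B else 0) \<le>
        (\<Sum>C\<in>Pow B. a C * \<bar>coef g (B - C)\<bar> + \<bar>coef f C\<bar> * b (B - C))"
    proof (cases "p \<in> B")
      case p: True
      have "\<bar>coef (f * g) B\<bar> / card B \<le> (\<Sum>C\<in>Pow B. \<bar>coef f C\<bar> * \<bar>coef g (B - C)\<bar>) / card B"
        unfolding coef_mult by (intro divide_right_mono order.trans[OF sum_abs]) (auto simp: abs_mult)
      also have "\<dots> = (\<Sum>C\<in>Pow B. \<bar>coef f C\<bar> * \<bar>coef g (B - C)\<bar> / card B)"
        by (rule sum_divide_distrib)
      also have "\<dots> \<le> (\<Sum>C\<in>Pow B. a C * \<bar>coef g (B - C)\<bar> + \<bar>coef f C\<bar> * b (B - C))"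
      proof (intro sum_mono)
        fix C assume C: "C \<in> Pow B"
        have fC: "finite C" "finite (B - C)" using C B finite_subset by auto
        have le: "card C \<le> card B" "card (B - C) \<le> card B" using C B by (auto intro: card_mono)
        show "\<bar>coef f C\<bar> * \<bar>coef g (B - C)\<bar> / card B \<le> a C * \<bar>coef g (B - C)\<bar> + \<bar>coef f C\<bar> * b (B - C)"
        proof (cases "p \<in> C")
          case pC: True
          then have "0 < card C" using fC by (auto simp: card_gt_0_iff)
          then have "\<bar>coef f C\<bar> * \<bar>coef g (B - C)\<bar> / card B \<le> \<bar>coef f C\<bar> * \<bar>coef g (B - C)\<bar> / card C"
            using le by (intro divide_left_mono) auto
          then show ?thesis using pC nn(2)[of "B - C"] by (simp add: a_def b_def)
        next
          case pC: False
          then have "0 < card (B - C)" using fC p by (auto simp: card_gt_0_iff)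
          then have "\<bar>coef f C\<bar> * \<bar>coef g (B - C)\<bar> / card B \<le> \<bar>coef f C\<bar> * \<bar>coef g (B - C)\<bar> / card (B - C)"
            using le by (intro divide_left_mono) auto
          then show ?thesis using pC p by (simp add: a_def b_def)
        qed
      qed
      finally show ?thesis using p by simp
    qed (auto intro!: sum_nonneg nn mult_nonneg_nonneg add_nonneg_nonneg)
  qed
  also have "\<dots> = (\<Sum>C\<in>Pow U. \<Sum>D\<in>Pow (U - C). a C * \<bar>coef g D\<bar> + \<bar>coef f C\<bar> * b D)"
    using True by (rule sum_Pow_Sigma)
  also have "\<dots> \<le> (\<Sum>C\<in>Pow U. \<Sum>D\<in>Pow U. a C * \<bar>coef g D\<bar> + \<bar>coef f C\<bar> * b D)"
    using True nn by (intro sum_mono sum_mono2) auto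
  also have "\<dots> = wnrm U p f * nrm U g + nrm U f * wnrm U p g"
    by (simp add: nrm_def wnrm_def sum_product sum.distrib a_def b_def)
  finally show ?thesis .
qed (simp add: nrm_def wnrm_def finite_Pow_iff)

lemma nrm_rho: "nrm U (rho x f) \<le> nrm U f" "wnrm U p (rho x f) \<le> wnrm U p f"
  unfolding nrm_def wnrm_def by (auto intro!: sum_mono)

lemma nrm_var: "nrm U (var x) \<le> 1" "wnrm U p (var x) \<le> (if x = p then 1 else 0)"
proof -
  have *: "(\<Sum>B\<in>Pow U. if B = {x} then c else 0) \<le> c" if "0 \<le> c" for c :: real
    using that by (cases "finite (Pow U)") auto
  show "nrm U (var x) \<le> 1" unfolding nrm_def coef_var using *[of 1] by (simp add: if_distrib[of abs] cong: if_cong)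
  have "wnrm U p (var x) = (\<Sum>B\<in>Pow U. if B = {x} then (if x = p then 1 else 0) else 0)"
    unfolding wnrm_def coef_var by (intro sum.cong) auto
  then show "wnrm U p (var x) \<le> (if x = p then 1 else 0)" using *[of "if x = p then 1 else 0"] by simp
qed

lemma sum_Pow_insert:
  fixes k :: "'a set \<Rightarrow> real"
  assumes "x \<in> U"
  shows "(\<Sum>B\<in>Pow U. if x \<in> B then 0 else k (insert x B)) = (\<Sum>B\<in>Pow U. if x \<in> B then k B else 0)"
proof (cases "finite U")
  case True
  have "(\<Sum>B\<in>Pow U. if x \<in> B then 0 else k (insert x B)) = (\<Sum>B\<in>{B\<in>Pow U. x \<notin> B}. k (insert x B))"
    using True by (intro sum.mono_neutral_cong_right) auto
  also have "\<dots> = (\<Sum>B\<in>{B\<in>Pow U. x \<in> B}. k B)"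
    using assms by (intro sum.reindex_bij_witness[of _ "\<lambda>B. B - {x}" "insert x"]) auto
  also have "\<dots> = (\<Sum>B\<in>Pow U. if x \<in> B then k B else 0)"
    using True by (intro sum.mono_neutral_cong_left) auto
  finally show ?thesis .
qed (simp add: finite_Pow_iff)

lemma nrm_dd_eq:
  assumes "x \<in> U"
  shows "nrm U (dd x f) = (\<Sum>B\<in>Pow U. if x \<in> B then \<bar>coef f B\<bar> else 0)"
  unfolding nrm_def sum_Pow_insert[OF assms, of "\<lambda>B. \<bar>coef f B\<bar>", symmetric] by (intro sum.cong) auto

lemma nrm_dd: "x \<in> U \<Longrightarrow> nrm U (dd x f) \<le> nrm U f"
  unfolding nrm_dd_eq unfolding nrm_def by (intro sum_mono) auto

lemma wnrm_dd_eq: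
  assumes "finite U" "x \<in> U"
  shows "wnrm U p (dd x f) =
    (\<Sum>B\<in>Pow U. if x \<in> B then (if p \<in> B \<and> p \<noteq> x then \<bar>coef f B\<bar> / real (card B - 1) else 0) else 0)"
  unfolding wnrm_def sum_Pow_insert[OF assms(2), of "\<lambda>B. if p \<in> B \<and> p \<noteq> x then \<bar>coef f B\<bar> / real (card B - 1) else 0", symmetric]
  using finite_subset[OF _ assms(1)] by (intro sum.cong) auto

text \<open>Removing \<open>x\<close> turns the weight \<open>1 / card B\<close> into
  \<open>1 / (card B - 1)\<close>. As \<open>B\<close> contains the two points \<open>x\<close> and
  \<open>p\<close>, the weight at most doubles.\<close>

lemma wnrm_dd:
  assumes "finite U" "x \<in> U"
  shows "wnrm U p (dd x f) \<le> 2 * wnrm U p f"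
  unfolding wnrm_dd_eq[OF assms] unfolding wnrm_def sum_distrib_left
proof (intro sum_mono)
  fix B assume "B \<in> Pow U"
  then have B: "finite B" using assms finite_subset by auto
  have "\<bar>coef f B\<bar> / real (card B - 1) \<le> 2 * (\<bar>coef f B\<bar> / real (card B))" if "x \<in> B" "p \<in> B" "p \<noteq> x"
  proof -
    have "card {x, p} \<le> card B" using that B by (intro card_mono) auto
    then have c: "2 \<le> card B" using that by simp
    have "\<bar>coef f B\<bar> / real (card B - 1) \<le> \<bar>coef f B\<bar> / (real (card B) / 2)"
      using c by (intro divide_left_mono) (auto simp: of_nat_diff)
    then show ?thesis by (simp add: mult.commute)
  qed
  then show "(if x \<in> B then if p \<in> B \<and> p \<noteq> x then \<bar>coef f B\<bar> / real (card B - 1) else 0 else 0)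
         \<le> 2 * (if p \<in> B then \<bar>coef f B\<bar> / real (card B) else 0)"
    by simp
qed

text \<open>Removing one of the \<open>card B - 1\<close> points of \<open>B\<close> other than \<open>p\<close> costs exactly the energy
  denominator: this is why no spatial decay of \<open>f\<close> has to be tracked.\<close>
lemma sum_wnrm_dd:
  assumes U: "finite U"
  shows "(\<Sum>x\<in>U. wnrm U p (dd x f)) \<le> (\<Sum>B\<in>Pow U. if p \<in> B then \<bar>coef f B\<bar> else 0)"
proof -
  have "(\<Sum>x\<in>U. wnrm U p (dd x f)) = (\<Sum>B\<in>Pow U. \<Sum>x\<in>U.
      (if x \<in> B then (if p \<in> B \<and> p \<noteq> x then \<bar>coef f B\<bar> / real (card B - 1) else 0) else 0))"
    using U by (simp add: wnrm_dd_eq) (rule sum.swap)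
  also have "\<dots> \<le> (\<Sum>B\<in>Pow U. if p \<in> B then \<bar>coef f B\<bar> else 0)"
  proof (intro sum_mono)
    fix B assume B: "B \<in> Pow U"
    then have fB: "finite B" using U finite_subset by auto
    show "(\<Sum>x\<in>U. if x \<in> B then (if p \<in> B \<and> p \<noteq> x then \<bar>coef f B\<bar> / real (card B - 1) else 0) else 0)
        \<le> (if p \<in> B then \<bar>coef f B\<bar> else 0)"
    proof (cases "p \<in> B")
      case True
      have "(\<Sum>x\<in>U. if x \<in> B then (if p \<in> B \<and> p \<noteq> x then \<bar>coef f B\<bar> / real (card B - 1) else 0) else 0)
          = (\<Sum>x\<in>B - {p}. \<bar>coef f B\<bar> / real (card B - 1))"
        using True U B by (intro sum.mono_neutral_cong_right) auto
      also have "\<dots> \<le> \<bar>coef f B\<bar>" using True fB by simp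
      finally show ?thesis using True by simp
    qed (auto intro!: sum_nonpos)
  qed
  finally show ?thesis .
qed

section \<open>Exponentials and conjugated hopping terms\<close>

text \<open>Since \<open>mon C\<close> has square 0, the factor
  \<open>1 + sc (coef v C) (mon C)\<close> is the exponential of
  \<open>sc (coef v C) (mon C)\<close>. For \<open>cluster U v\<close> and finite \<open>U\<close>
  the product is therefore the exponential of \<open>v\<close>, with no series to sum.\<close>

definition expo :: "nat set \<Rightarrow> galg \<Rightarrow> galg" where
  "expo U v = (\<Prod>C\<in>Pow U - {{}}. 1 + sc (coef v C) (mon C))"

definition expo_inv :: "nat set \<Rightarrow> galg \<Rightarrow> galg" where
  "expo_inv U v = (\<Prod>C\<in>Pow U - {{}}. 1 - sc (coef v C) (mon C))"

definition cluster :: "nat set \<Rightarrow> galg \<Rightarrow> bool" where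
  "cluster U v \<longleftrightarrow> (\<forall>B. coef v B \<noteq> 0 \<longrightarrow> B \<subseteq> U \<and> B \<noteq> {})"

lemma cluster_sum:
  assumes "finite U" "cluster U v"
  shows "v = (\<Sum>C\<in>Pow U - {{}}. sc (coef v C) (mon C))"
proof (rule galg_eqI)
  fix B :: "nat set" assume "finite B"
  then have "coef (\<Sum>C\<in>Pow U - {{}}. sc (coef v C) (mon C)) B =
      (\<Sum>C\<in>Pow U - {{}}. if C = B then coef v B else 0)"
    by (simp, intro sum.cong) auto
  then show "coef v B = coef (\<Sum>C\<in>Pow U - {{}}. sc (coef v C) (mon C)) B"
    using assms by (auto simp: cluster_def)
qed

lemma sc_zero [simp]: "sc c 0 = 0" by (rule galg_eqI) simp

lemma expo_inv: "finite U \<Longrightarrow> expo U v * expo_inv U v = 1"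
  unfolding expo_def expo_inv_def prod.distrib[symmetric]
proof (rule prod.neutral, rule ballI)
  fix C :: "nat set" assume "finite U" "C \<in> Pow U - {{}}"
  then have "C \<subseteq> U" "C \<noteq> {}" by auto
  then have "mon C * mon C = 0" using mon_mult_self finite_subset \<open>finite U\<close> by blast
  then show "(1 + sc (coef v C) (mon C)) * (1 - sc (coef v C) (mon C)) = 1"
    by (simp add: algebra_simps sc_mult)
qed

text \<open>Logarithmic derivative of a product, for a derivation \<open>d\<close> twisted by a
  multiplicative \<open>r\<close>. For factors \<open>p C = 1 + q C\<close> the assumption
  \<open>step\<close> amounts to \<open>d (q C) * r (q C) = 0\<close>. It covers
  \<open>dd x\<close>, with \<open>r = rho x\<close>, as well as \<open>num\<close>, with
  \<open>r\<close> the identity.\<close>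

lemma derivation_prod:
  assumes mult: "\<And>f g. d (f * g) = d f * r g + r f * d g" "\<And>f g. r (f * g) = r f * r g"
    and one: "d 1 = 0" "r 1 = 1" and add: "\<And>f g. d (f + g) = d f + d g" "d 0 = (0::galg)"
    and step: "\<And>C. C \<in> F \<Longrightarrow> d (p C) = d (q C) * r (p C)"
  shows "d (prod p F) = d (sum q F) * r (prod p F)"
  using step
proof (induction F rule: infinite_finite_induct)
  case (insert x F)
  then show ?case by (simp add: mult add algebra_simps)
qed (simp_all add: one add)

lemma linear_zero [simp]: "rho x 0 = 0" "dd x 0 = 0" "num 0 = 0"
  by (rule galg_eqI; simp)+

lemma expo_dd:
  assumes "finite U" "cluster U v"
  shows "dd x (expo U v) = dd x v * rho x (expo U v)"
proof -
  have "dd x (expo U v) = dd x (\<Sum>C\<in>Pow U - {{}}. sc (coef v C) (mon C)) * rho x (expo U v)"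
    unfolding expo_def
  proof (rule derivation_prod)
    fix C assume "C \<in> Pow U - {{}}"
    have "dd x (sc c (mon C)) * rho x (sc c (mon C)) = 0" for c
    proof (cases "x \<in> C")
      case True
      then have "rho x (sc c (mon C)) = 0" by (intro galg_eqI) auto
      then show ?thesis by simp
    next
      case False
      then have "dd x (sc c (mon C)) = 0" by (intro galg_eqI) auto
      then show ?thesis by simp
    qed
    then show "dd x (1 + sc (coef v C) (mon C)) = dd x (sc (coef v C) (mon C)) * rho x (1 + sc (coef v C) (mon C))"
      by (simp add: linear_simps algebra_simps)
  qed (auto simp: dd_mult rho_mult linear_simps)
  then show ?thesis using cluster_sum[OF assms] by simp
qed

lemma expo_num:
  assumes "finite U" "cluster U v"
  shows "num (expo U v) = num v * expo U v"
proof -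
  have "num (expo U v) = num (\<Sum>C\<in>Pow U - {{}}. sc (coef v C) (mon C)) * expo U v"
    unfolding expo_def
  proof (rule derivation_prod[where r = "\<lambda>f. f"])
    fix C assume C: "C \<in> Pow U - {{}}"
    then have "mon C * mon C = 0" using mon_mult_self finite_subset assms(1) by blast
    moreover have "num (sc c (mon C)) = sc (c * card C) (mon C)" for c
      by (rule galg_eqI) auto
    ultimately show "num (1 + sc (coef v C) (mon C)) = num (sc (coef v C) (mon C)) * (1 + sc (coef v C) (mon C))"
      by (simp add: linear_simps algebra_simps sc_mult)
  qed (auto simp: num_mult linear_simps)
  then show ?thesis using cluster_sum[OF assms] by simp
qed

lemma coef_prod_empty: "coef (prod f A) {} = (\<Prod>i\<in>A. coef (f i) {})"
  by (induction A rule: infinite_finite_induct) (auto simp: coef_mult)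

lemma expo_empty [simp]: "coef (expo U v) {} = 1"
  unfolding expo_def coef_prod_empty by (rule prod.neutral) auto

text \<open>For \<open>s = -1\<close>, \<open>flip_conj\<close> and \<open>rho_conj\<close> are \<open>flip\<close> and \<open>rho\<close> conjugated by the exponential of
  \<open>v\<close>, see \<open>flip_expo\<close> and \<open>rho_expo\<close>. The sign \<open>s = 1\<close> gives majorants with nonnegative
  coefficients.\<close>

definition rho_conj :: "real \<Rightarrow> galg \<Rightarrow> nat \<Rightarrow> galg \<Rightarrow> galg" where
  "rho_conj s v x f = (1 + sc s (var x * dd x v)) * rho x f"

definition flip_conj :: "real \<Rightarrow> galg \<Rightarrow> nat \<Rightarrow> galg \<Rightarrow> galg" where
  "flip_conj s v x f = var x * f + (1 + sc s (var x * dd x v)) * (dd x v * rho x f + dd x f)"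

text \<open>A bond outside \<open>U\<close> lies beyond an end of the chain, so toggling it does
  nothing. The open boundary condition enters here.\<close>

definition flip_in :: "nat set \<Rightarrow> nat \<Rightarrow> galg \<Rightarrow> galg" where
  "flip_in U x f = (if x \<in> U then flip x f else f)"

definition flip_conj_in :: "nat set \<Rightarrow> real \<Rightarrow> galg \<Rightarrow> nat \<Rightarrow> galg \<Rightarrow> galg" where
  "flip_conj_in U s v x f = (if x \<in> U then flip_conj s v x f else f)"

definition hop :: "nat set \<Rightarrow> nat \<Rightarrow> galg \<Rightarrow> galg" where
  "hop U i f = rho i (flip_in U (i - 1) (flip_in U (i + 1) f))"

definition hop_conj :: "nat set \<Rightarrow> real \<Rightarrow> galg \<Rightarrow> nat \<Rightarrow> galg \<Rightarrow> galg" where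
  "hop_conj U s v i f = rho_conj s v i (flip_conj_in U s v (i - 1) (flip_conj_in U s v (i + 1) f))"

lemma sc_neg: "sc (- c) f = - sc c f" "sc 1 f = f" "sc 0 f = 0"
  by (rule galg_eqI; simp)+

text \<open>The chain rule gives \<open>expo U v = rho x (expo U v) * (1 + var x * dd x v)\<close>,
  and the last factor has the inverse \<open>1 - var x * dd x v\<close> because \<open>var x\<close>
  has square 0.\<close>

lemma rho_expo_eq:
  assumes "finite U" "cluster U v"
  shows "rho x (expo U v) = expo U v * (1 - var x * dd x v)"
proof -
  let ?e = "expo U v"
  have "?e = rho x ?e * (1 + var x * dd x v)"
    using rho_var_decomp[of ?e x] expo_dd[OF assms, of x] by (simp add: algebra_simps)
  then have "?e * (1 - var x * dd x v) = rho x ?e * ((1 + var x * dd x v) * (1 - var x * dd x v))"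
    by (metis mult.assoc)
  also have "(1 + var x * dd x v) * (1 - var x * dd x v) = 1 - (var x * var x) * (dd x v * dd x v)"
    by (simp add: algebra_simps)
  finally show ?thesis by simp
qed

lemma rho_expo:
  assumes "finite U" "cluster U v"
  shows "rho x (expo U v * f) = expo U v * rho_conj (-1) v x f"
  by (simp add: rho_mult rho_expo_eq[OF assms] rho_conj_def sc_neg mult.assoc)

lemma flip_expo:
  assumes "finite U" "cluster U v"
  shows "flip x (expo U v * f) = expo U v * flip_conj (-1) v x f"
  by (simp add: flip_def dd_mult rho_expo_eq[OF assms] flip_conj_def sc_neg expo_dd[OF assms] algebra_simps)

text \<open>The exponential comes out in front, and what remains is polynomial in \<open>v\<close>
  and sees only those clusters of \<open>v\<close> that meet one of the bonds \<open>i - 1\<close>,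
  \<open>i\<close>, \<open>i + 1\<close>. No quantity growing with the length is left.\<close>

lemma hop_expo:
  assumes "finite U" "cluster U v"
  shows "hop U i (expo U v * f) = expo U v * hop_conj U (-1) v i f"
  by (simp add: hop_def hop_conj_def flip_in_def flip_conj_in_def flip_expo[OF assms] rho_expo[OF assms])

text \<open>A monomial away from the three bonds behaves like a constant under \<open>rho\<close>
  and \<open>dd\<close> there. This locality restricts \<open>remainder\<close> on
  \<open>mon C\<close> to at most \<open>3 * card C\<close> bonds.\<close>

lemma hop_conj_mon:
  assumes "i \<notin> C" "i - 1 \<notin> C" "i + 1 \<notin> C"
  shows "hop_conj U s v i (mon C * f) = mon C * hop_conj U s v i f"
proof -
  have 1: "rho x (mon C) = mon C" "dd x (mon C) = 0" if "x \<notin> C" for x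
    using that by (auto intro!: galg_eqI)
  have 2: "flip_conj_in U s v x (mon C * f) = mon C * flip_conj_in U s v x f" if "x \<notin> C" for x f
    using 1[OF that] by (simp add: flip_conj_in_def flip_conj_def rho_mult dd_mult algebra_simps)
  show ?thesis unfolding hop_conj_def 2[OF assms(3)] 2[OF assms(2)] rho_conj_def
    using 1[OF assms(1)] by (simp add: rho_mult algebra_simps)
qed

lemma conj_linear:
  "rho_conj s v x (f + g) = rho_conj s v x f + rho_conj s v x g"
  "rho_conj s v x (sc c f) = sc c (rho_conj s v x f)"
  "flip_conj_in U s v x (f + g) = flip_conj_in U s v x f + flip_conj_in U s v x g"
  "flip_conj_in U s v x (sc c f) = sc c (flip_conj_in U s v x f)"
proof -
  have sc: "rho x (sc c f) = sc c (rho x f)" "dd x (sc c f) = sc c (dd x f)"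
    "sc c (f + g) = sc c f + sc c g" "sc s (sc c f) = sc c (sc s f)" for c f g x
    by (rule galg_eqI; simp add: algebra_simps)+
  show "rho_conj s v x (f + g) = rho_conj s v x f + rho_conj s v x g"
    "rho_conj s v x (sc c f) = sc c (rho_conj s v x f)"
    "flip_conj_in U s v x (f + g) = flip_conj_in U s v x f + flip_conj_in U s v x g"
    "flip_conj_in U s v x (sc c f) = sc c (flip_conj_in U s v x f)"
    by (simp_all add: rho_conj_def flip_conj_in_def flip_conj_def linear_simps sc sc_mult algebra_simps)
qed

lemma hop_conj_linear:
  "hop_conj U s v i (f + g) = hop_conj U s v i f + hop_conj U s v i g"
  "hop_conj U s v i (sc c f) = sc c (hop_conj U s v i f)"
  by (simp_all add: hop_conj_def conj_linear)

lemma coef_mult_cong: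
  assumes "\<And>B. B \<subseteq> U \<Longrightarrow> coef f B = coef f' B" "\<And>B. B \<subseteq> U \<Longrightarrow> coef g B = coef g' B" "B \<subseteq> U"
  shows "coef (f * g) B = coef (f' * g') B"
  unfolding coef_mult
proof (rule sum.cong[OF refl])
  fix C assume "C \<in> Pow B"
  then have "C \<subseteq> U" "B - C \<subseteq> U" using assms(3) by auto
  then show "coef f C * coef g (B - C) = coef f' C * coef g' (B - C)" by (simp add: assms(1,2))
qed

lemma hop_conj_cong:
  assumes "\<And>B. B \<subseteq> U \<Longrightarrow> coef f B = coef g B" "B \<subseteq> U" "i \<in> U"
  shows "coef (hop_conj U s v i f) B = coef (hop_conj U s v i g) B"
proof -
  have 1: "coef (flip_conj_in U s v x f) B = coef (flip_conj_in U s v x g) B"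
    if "\<And>B. B \<subseteq> U \<Longrightarrow> coef f B = coef g B" "B \<subseteq> U" for f g B x
    unfolding flip_conj_in_def flip_conj_def using that
    by (auto simp del: coef_var_mult intro!: coef_mult_cong[of U] arg_cong2[of _ _ _ _ "(+)"])
  show ?thesis unfolding hop_conj_def rho_conj_def
    using assms 1[OF 1[OF assms(1)]] by (intro coef_mult_cong[of U]) auto
qed

section \<open>Norm bounds for the conjugated hopping terms\<close>

definition cmass :: "nat set \<Rightarrow> nat \<Rightarrow> galg \<Rightarrow> real" where
  "cmass U p v = (\<Sum>B\<in>Pow U. if p \<in> B then \<bar>coef v B\<bar> else 0)"

text \<open>The price, measured in \<open>wnrm U p\<close>, of an operator acting at bond
  \<open>x\<close>: either a cluster of \<open>v\<close> joins \<open>x\<close> to \<open>p\<close>,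
  or \<open>x = p\<close> and \<open>var x\<close> itself creates the point
  \<open>p\<close>.\<close>

definition near_weight :: "nat set \<Rightarrow> galg \<Rightarrow> nat \<Rightarrow> nat \<Rightarrow> real" where
  "near_weight U v p x = (if x \<in> U then wnrm U p (dd x v) + (if x = p then 1 else 0) else 0)"

lemma near_weight_nonneg: "0 \<le> near_weight U v p x" by (simp add: near_weight_def)

text \<open>Mass at most 1 means that multiplication by \<open>dd x v\<close> does not increase
  \<open>nrm U\<close>, and neither does multiplication by \<open>var x\<close>. Hence the factor 2
  for \<open>rho_conj\<close> and 5 = 1 + 2 * 2 for a flip. In \<open>wnrm U p\<close> the inner sum
  of a flip costs 3 = 1 + 2, the 2 coming from \<open>wnrm_dd\<close>, and the flip costs 7 = 1 + 2
  * 3.\<close>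

lemma conj_bounds:
  assumes U: "finite U" and v: "\<And>x. x \<in> U \<Longrightarrow> cmass U x v \<le> 1" and s: "\<bar>s\<bar> \<le> 1"
  shows flip_conj_in_nrm: "nrm U (flip_conj_in U s v x f) \<le> 5 * nrm U f"
    and flip_conj_in_wnrm:
      "wnrm U p (flip_conj_in U s v x f) \<le> 7 * near_weight U v p x * nrm U f + 7 * wnrm U p f"
    and rho_conj_nrm: "x \<in> U \<Longrightarrow> nrm U (rho_conj s v x f) \<le> 2 * nrm U f"
    and rho_conj_wnrm:
      "x \<in> U \<Longrightarrow> wnrm U p (rho_conj s v x f) \<le> near_weight U v p x * nrm U f + 2 * wnrm U p f"
proof -
  define \<delta> where "\<delta> = (if x = p then 1 else 0 :: real)"
  define A where "A = wnrm U p (dd x v)"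
  have A: "0 \<le> A" "0 \<le> \<delta>" by (auto simp: A_def \<delta>_def)
  have vn: "nrm U (var x) \<le> 1" "wnrm U p (var x) \<le> \<delta>" using nrm_var(1)[of U x] nrm_var(2)[of U p x] by (auto simp: \<delta>_def)
  {
    assume x: "x \<in> U"
    have r: "nrm U (dd x v) \<le> 1" using v[OF x] nrm_dd_eq[OF x, of v] by (simp add: cmass_def)
    have mul: "nrm U (dd x v * g) \<le> nrm U g" "wnrm U p (dd x v * g) \<le> A * nrm U g + wnrm U p g"
      "nrm U (var x * g) \<le> nrm U g" "wnrm U p (var x * g) \<le> \<delta> * nrm U g + wnrm U p g" for g
    proof -
      have *: "a * b \<le> b" if "a \<le> 1" "0 \<le> b" for a b :: real
        using that mult_right_mono[of a 1 b] by simp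
      show "nrm U (dd x v * g) \<le> nrm U g" "nrm U (var x * g) \<le> nrm U g"
        using nrm_mult[of U "dd x v" g] *[OF r, of "nrm U g"] nrm_mult[of U "var x" g] *[OF vn(1), of "nrm U g"]
        by auto
      show "wnrm U p (dd x v * g) \<le> A * nrm U g + wnrm U p g"
        using wnrm_mult[of U p "dd x v" g] *[OF r, of "wnrm U p g"] by (auto simp: A_def)
      show "wnrm U p (var x * g) \<le> \<delta> * nrm U g + wnrm U p g"
        using wnrm_mult[of U p "var x" g] *[OF vn(1), of "wnrm U p g"]
          mult_right_mono[OF vn(2), of "nrm U g"] by auto
    qed
    have scs: "nrm U (sc s g) \<le> nrm U g" "wnrm U p (sc s g) \<le> wnrm U p g" for g
      using s mult_right_mono[OF s, of "nrm U g"] mult_right_mono[OF s, of "wnrm U p g"] by (auto simp: nrm_sc)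
    have D: "nrm U ((1 + sc s (var x * dd x v)) * g) \<le> 2 * nrm U g"
      "wnrm U p ((1 + sc s (var x * dd x v)) * g) \<le> (A + \<delta>) * nrm U g + 2 * wnrm U p g" for g
    proof -
      have e: "(1 + sc s (var x * dd x v)) * g = g + sc s (var x * (dd x v * g))"
        by (simp add: algebra_simps sc_mult)
      show "nrm U ((1 + sc s (var x * dd x v)) * g) \<le> 2 * nrm U g"
        unfolding e using nrm_add[of U g "sc s (var x * (dd x v * g))"] scs(1)[of "var x * (dd x v * g)"]
          mul(1)[of g] mul(3)[of "dd x v * g"] by linarith
      show "wnrm U p ((1 + sc s (var x * dd x v)) * g) \<le> (A + \<delta>) * nrm U g + 2 * wnrm U p g"
        unfolding e using wnrm_add[of U p g "sc s (var x * (dd x v * g))"] scs(2)[of "var x * (dd x v * g)"]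
          mul(2)[of g] mul(4)[of "dd x v * g"] mult_left_mono[OF mul(1)[of g] A(2)]
        by (simp add: algebra_simps)
    qed
    show "nrm U (rho_conj s v x f) \<le> 2 * nrm U f"
      unfolding rho_conj_def using D(1)[of "rho x f"] nrm_rho(1)[of U x f] by linarith
    show "wnrm U p (rho_conj s v x f) \<le> near_weight U v p x * nrm U f + 2 * wnrm U p f"
      using x D(2)[of "rho x f"] nrm_rho(1)[of U x f] mult_left_mono[OF nrm_rho(1)[of U x f], of "A + \<delta>"] A
        nrm_rho(2)[of U p x f]
      unfolding rho_conj_def near_weight_def A_def[symmetric] \<delta>_def[symmetric] by simp
    define g where "g = dd x v * rho x f + dd x f"
    have g: "nrm U g \<le> 2 * nrm U f" "wnrm U p g \<le> A * nrm U f + 3 * wnrm U p f"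
    proof -
      show "nrm U g \<le> 2 * nrm U f" unfolding g_def
        using nrm_add[of U "dd x v * rho x f" "dd x f"] mul(1)[of "rho x f"] nrm_rho(1)[of U x f] nrm_dd[OF x, of f]
        by linarith
      show "wnrm U p g \<le> A * nrm U f + 3 * wnrm U p f" unfolding g_def
        using wnrm_add[of U p "dd x v * rho x f" "dd x f"] mul(2)[of "rho x f"] nrm_rho(1)[of U x f]
          nrm_rho(2)[of U p x f] wnrm_dd[OF U x, of p f] mult_left_mono[OF nrm_rho(1)[of U x f] A(1)]
        by linarith
    qed
    have e: "flip_conj s v x f = var x * f + (1 + sc s (var x * dd x v)) * g"
      by (simp add: flip_conj_def g_def)
    have "nrm U (flip_conj s v x f) \<le> 5 * nrm U f"
      unfolding e using nrm_add[of U "var x * f" "(1 + sc s (var x * dd x v)) * g"] D(1)[of g] g(1) mul(3)[of f]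
      by linarith
    moreover have "wnrm U p (flip_conj s v x f) \<le> 7 * (A + \<delta>) * nrm U f + 7 * wnrm U p f"
    proof -
      have "wnrm U p (flip_conj s v x f) \<le> \<delta> * nrm U f + wnrm U p f + (A + \<delta>) * nrm U g + 2 * wnrm U p g"
        unfolding e using wnrm_add[of U p "var x * f" "(1 + sc s (var x * dd x v)) * g"] D(2)[of g] mul(4)[of f]
        by linarith
      also have "\<dots> \<le> \<delta> * nrm U f + wnrm U p f + (A + \<delta>) * (2 * nrm U f) + 2 * (A * nrm U f + 3 * wnrm U p f)"
        using g A by (intro add_mono mult_left_mono) auto
      also have "\<dots> \<le> 7 * (A + \<delta>) * nrm U f + 7 * wnrm U p f"
        using A mult_nonneg_nonneg[OF A(1) nrm_nonneg(1)[of U f]] mult_nonneg_nonneg[OF A(2) nrm_nonneg(1)[of U f]]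
        by (simp add: algebra_simps)
      finally show ?thesis .
    qed
    ultimately have "nrm U (flip_conj_in U s v x f) \<le> 5 * nrm U f"
      "wnrm U p (flip_conj_in U s v x f) \<le> 7 * near_weight U v p x * nrm U f + 7 * wnrm U p f"
      using x by (auto simp: flip_conj_in_def near_weight_def A_def \<delta>_def)
  } note * = this
  show "nrm U (flip_conj_in U s v x f) \<le> 5 * nrm U f"
    "wnrm U p (flip_conj_in U s v x f) \<le> 7 * near_weight U v p x * nrm U f + 7 * wnrm U p f"
    using * nrm_nonneg(1)[of U f] nrm_nonneg(2)[of U p f]
    by (cases "x \<in> U"; simp add: flip_conj_in_def near_weight_def)+
qed

text \<open>Two flips and one \<open>rho_conj\<close>: 50 = 5 * 5 * 2.\<close>

lemma hop_conj_nrm: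
  assumes "finite U" "\<And>x. x \<in> U \<Longrightarrow> cmass U x v \<le> 1" "\<bar>s\<bar> \<le> 1" "i \<in> U"
  shows "nrm U (hop_conj U s v i f) \<le> 50 * nrm U f"
  unfolding hop_conj_def
  using rho_conj_nrm[OF assms(1-3) assms(4), of "flip_conj_in U s v (i - 1) (flip_conj_in U s v (i + 1) f)"]
    flip_conj_in_nrm[OF assms(1-3), of "i - 1" "flip_conj_in U s v (i + 1) f"]
    flip_conj_in_nrm[OF assms(1-3), of "i + 1" f] by linarith

text \<open>The bonds \<open>i\<close>, \<open>i - 1\<close>, \<open>i + 1\<close> come out with
  coefficients 25 = 5 * 5, 70 = 2 * 7 * 5 and 98 = 2 * 7 * 7; all are replaced by the
  largest.\<close>

lemma hop_conj_one_wnrm: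
  assumes "finite U" "\<And>x. x \<in> U \<Longrightarrow> cmass U x v \<le> 1" "\<bar>s\<bar> \<le> 1" "i \<in> U"
  shows "wnrm U p (hop_conj U s v i 1) \<le>
    98 * (near_weight U v p (i - 1) + near_weight U v p i + near_weight U v p (i + 1))"
proof -
  let ?w = "near_weight U v p"
  define f where "f = flip_conj_in U s v (i + 1) 1"
  define g where "g = flip_conj_in U s v (i - 1) f"
  have f: "nrm U f \<le> 5" "wnrm U p f \<le> 7 * ?w (i + 1)"
    using flip_conj_in_nrm[OF assms(1-3), of "i + 1" 1] flip_conj_in_wnrm[OF assms(1-3), of p "i + 1" 1] assms(1)
    by (simp_all add: f_def nrm_one)
  have g: "nrm U g \<le> 25" "wnrm U p g \<le> 35 * ?w (i - 1) + 49 * ?w (i + 1)"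
    using flip_conj_in_nrm[OF assms(1-3), of "i - 1" f] flip_conj_in_wnrm[OF assms(1-3), of p "i - 1" f] f
      mult_left_mono[OF f(1) near_weight_nonneg[of U v p "i - 1"]]
    by (simp_all add: g_def)
  show ?thesis
    using rho_conj_wnrm[OF assms(1-3) assms(4), of p g] g mult_left_mono[OF g(1) near_weight_nonneg[of U v p i]]
      near_weight_nonneg[of U v p i] near_weight_nonneg[of U v p "i - 1"]
    by (simp add: hop_conj_def f_def g_def)
qed

lemma sum_near_weight:
  assumes U: "finite U" and p: "cmass U p v \<le> 1"
  shows "(\<Sum>x\<in>U. near_weight U v p x) \<le> 2"
proof -
  have "(\<Sum>x\<in>U. near_weight U v p x) = (\<Sum>x\<in>U. wnrm U p (dd x v)) + (\<Sum>x\<in>U. if x = p then 1 else 0)"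
    by (simp add: near_weight_def sum.distrib)
  also have "(\<Sum>x\<in>U. if x = p then 1 else 0 :: real) \<le> 1" using U by simp
  also have "(\<Sum>x\<in>U. wnrm U p (dd x v)) \<le> 1" using sum_wnrm_dd[OF U, of p v] p by (simp add: cmass_def)
  finally show ?thesis by simp
qed

text \<open>The bound 588 = 98 * 6 arises because each of the three shifted sums of
  \<open>near_weight\<close> is at most 2: 1 from the clusters through \<open>p\<close> and 1 from
  the term with \<open>x = p\<close>.\<close>

lemma sum_hop_conj_one_wnrm:
  assumes U: "finite U" "0 \<notin> U" and v: "\<And>x. x \<in> U \<Longrightarrow> cmass U x v \<le> 1" and s: "\<bar>s\<bar> \<le> 1" and p: "p \<in> U"
  shows "(\<Sum>i\<in>U. wnrm U p (hop_conj U s v i 1)) \<le> 588"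
proof -
  let ?w = "near_weight U v p"
  have shift: "(\<Sum>i\<in>U. ?w (k i)) \<le> 2" if inj: "inj_on k U" for k
  proof -
    have "(\<Sum>i\<in>U. ?w (k i)) = sum ?w (k ` U)" using inj by (simp add: sum.reindex)
    also have "\<dots> = sum ?w (k ` U \<inter> U)"
      using U by (intro sum.mono_neutral_right) (auto simp: near_weight_def)
    also have "\<dots> \<le> sum ?w U" using U near_weight_nonneg by (intro sum_mono2) auto
    finally show ?thesis using sum_near_weight[OF U(1) v[OF p]] by linarith
  qed
  \<comment> \<open>Truncated subtraction identifies 0 and 1, so injectivity relies on
    \<open>0 \<notin> U\<close>.\<close>
  have "inj_on (\<lambda>i. i - 1) U"
  proof (rule inj_onI)
    fix x y assume "x \<in> U" "y \<in> U" "x - 1 = y - 1"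
    moreover from this have "x \<noteq> 0" "y \<noteq> 0" using U(2) by metis+
    ultimately show "x = y" by simp
  qed
  then have s3: "(\<Sum>i\<in>U. ?w (i - 1)) \<le> 2" "(\<Sum>i\<in>U. ?w i) \<le> 2" "(\<Sum>i\<in>U. ?w (i + 1)) \<le> 2"
    by (auto intro!: shift)
  have "(\<Sum>i\<in>U. wnrm U p (hop_conj U s v i 1)) \<le> (\<Sum>i\<in>U. 98 * (?w (i - 1) + ?w i + ?w (i + 1)))"
    by (intro sum_mono hop_conj_one_wnrm U v s)
  also have "\<dots> = 98 * ((\<Sum>i\<in>U. ?w (i - 1)) + (\<Sum>i\<in>U. ?w i) + (\<Sum>i\<in>U. ?w (i + 1)))"
    by (simp add: sum_distrib_left sum.distrib)
  also have "\<dots> \<le> 98 * (2 + 2 + 2)" using s3 by (intro mult_left_mono add_mono) auto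
  finally show ?thesis by simp
qed

section \<open>The cluster equation\<close>

lift_definition inv_num :: "nat set \<Rightarrow> real \<Rightarrow> galg \<Rightarrow> galg" is
  "\<lambda>U c f B. if finite B \<and> B \<subseteq> U \<and> B \<noteq> {} then f B / (c * real (card B)) else 0" by simp

text \<open>For \<open>s = -1\<close> and \<open>\<tau> i = - t i\<close>, a fixed point
  \<open>v\<close> makes \<open>sc c (num v)\<close> cancel the hopping terms
  \<open>sc (t i) (hop_conj U (-1) v i 1)\<close> at all nonempty subsets of \<open>U\<close>. Only
  a constant remains, which says that \<open>expo U v\<close> solves the eigenvalue equation of
  \<open>bond_ham\<close>.\<close>

definition cluster_map :: "nat set \<Rightarrow> real \<Rightarrow> real \<Rightarrow> (nat \<Rightarrow> real) \<Rightarrow> galg \<Rightarrow> galg" where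
  "cluster_map U c s \<tau> v = inv_num U c (\<Sum>i\<in>U. sc (\<tau> i) (hop_conj U s v i 1))"

lemma coef_cluster_map:
  "coef (cluster_map U c s \<tau> v) B = (if finite B \<and> B \<subseteq> U \<and> B \<noteq> {}
     then (\<Sum>i\<in>U. \<tau> i * coef (hop_conj U s v i 1) B) / (c * real (card B)) else 0)"
  by (simp add: cluster_map_def inv_num.rep_eq)

lemma cluster_cluster_map: "cluster U (cluster_map U c s \<tau> v)"
  by (auto simp: cluster_def coef_cluster_map)

text \<open>Invariance of the unit ball: division by \<open>c * card B\<close> turns
  \<open>cmass\<close> into \<open>wnrm\<close>, whose sum over the hopping terms is at most 588.
  This is the origin of the smallness condition \<open>588 * T \<le> c\<close>.\<close>

lemma cmass_cluster_map:
  assumes U: "finite U" "0 \<notin> U" and v: "\<And>x. x \<in> U \<Longrightarrow> cmass U x v \<le> 1" and s: "\<bar>s\<bar> \<le> 1"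
    and p: "p \<in> U" and \<tau>: "\<And>i. \<bar>\<tau> i\<bar> \<le> T" and c: "588 * T \<le> c" "0 < c"
  shows "cmass U p (cluster_map U c s \<tau> v) \<le> 1"
proof -
  have T: "0 \<le> T" using \<tau>[of 0] by linarith
  let ?h = "\<lambda>i. hop_conj U s v i 1"
  have "cmass U p (cluster_map U c s \<tau> v) \<le>
      (\<Sum>B\<in>Pow U. (T / c) * (\<Sum>i\<in>U. if p \<in> B then \<bar>coef (?h i) B\<bar> / card B else 0))"
    unfolding cmass_def
  proof (intro sum_mono)
    fix B assume "B \<in> Pow U"
    then have B: "B \<subseteq> U" "finite B" using U finite_subset by auto
    show "(if p \<in> B then \<bar>coef (cluster_map U c s \<tau> v) B\<bar> else 0) \<le>
        (T / c) * (\<Sum>i\<in>U. if p \<in> B then \<bar>coef (?h i) B\<bar> / card B else 0)"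
    proof (cases "p \<in> B")
      case True
      have "\<bar>\<Sum>i\<in>U. \<tau> i * coef (?h i) B\<bar> \<le> (\<Sum>i\<in>U. T * \<bar>coef (?h i) B\<bar>)"
        using \<tau> by (intro order.trans[OF sum_abs] sum_mono) (auto simp: abs_mult intro!: mult_right_mono)
      then have "\<bar>coef (cluster_map U c s \<tau> v) B\<bar> \<le> (\<Sum>i\<in>U. T * \<bar>coef (?h i) B\<bar>) / (c * card B)"
        using True B c by (auto simp: coef_cluster_map abs_mult intro!: divide_right_mono)
      also have "\<dots> = (T / c) * (\<Sum>i\<in>U. \<bar>coef (?h i) B\<bar> / card B)"
        by (simp add: sum_distrib_left sum_divide_distrib)
      finally show ?thesis using True by simp
    qed simp
  qed
  also have "\<dots> = (T / c) * (\<Sum>i\<in>U. wnrm U p (?h i))"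
    unfolding wnrm_def sum_distrib_left[symmetric] by (subst sum.swap) simp
  also have "\<dots> \<le> (T / c) * 588"
    using T c by (intro mult_left_mono sum_hop_conj_one_wnrm U v s p) auto
  also have "\<dots> \<le> 1" using c by (simp add: field_simps)
  finally show ?thesis .
qed

text \<open>For a polynomial map (on \<open>u\<close>, \<open>v\<close>) and its majorant (on \<open>b\<close>, \<open>a\<close>), this relation propagates from
  the arguments to the values. It turns the convergence of the monotone majorant iteration into
  convergence of the iteration itself.\<close>
definition dominated :: "galg \<Rightarrow> galg \<Rightarrow> galg \<Rightarrow> galg \<Rightarrow> bool" where
  "dominated u v b a \<longleftrightarrow>
     (\<forall>B. \<bar>coef v B\<bar> \<le> coef a B \<and> \<bar>coef u B - coef v B\<bar> \<le> coef b B - coef a B)"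

text \<open>The difference telescopes as \<open>(u - v) * u' + v * (u' - v')\<close>, and
  \<open>\<bar>u'\<bar> \<le> b'\<close> follows by adding the two assumptions on the primed
  variables.\<close>

lemma dominated_real:
  fixes u v a b :: real
  assumes "\<bar>v\<bar> \<le> a" "\<bar>u - v\<bar> \<le> b - a" "\<bar>v'\<bar> \<le> a'" "\<bar>u' - v'\<bar> \<le> b' - a'"
  shows "\<bar>v * v'\<bar> \<le> a * a'" "\<bar>u * u' - v * v'\<bar> \<le> b * b' - a * a'"
proof -
  show "\<bar>v * v'\<bar> \<le> a * a'" unfolding abs_mult using assms by (intro mult_mono) auto
  have "\<bar>u * u' - v * v'\<bar> = \<bar>(u - v) * u' + v * (u' - v')\<bar>" by (simp add: algebra_simps)
  also have "\<dots> \<le> \<bar>u - v\<bar> * \<bar>u'\<bar> + \<bar>v\<bar> * \<bar>u' - v'\<bar>"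
    by (rule order.trans[OF abs_triangle_ineq]) (simp add: abs_mult)
  also have "\<dots> \<le> (b - a) * b' + a * (b' - a')"
    using assms by (intro add_mono mult_mono) auto
  finally show "\<bar>u * u' - v * v'\<bar> \<le> b * b' - a * a'" by (simp add: algebra_simps)
qed

lemma dominated_mult:
  assumes "dominated u v b a" "dominated u' v' b' a'"
  shows "dominated (u * u') (v * v') (b * b') (a * a')"
  unfolding dominated_def coef_mult
proof (intro allI conjI)
  fix B
  note * = assms[unfolded dominated_def, rule_format]
  show "\<bar>\<Sum>C\<in>Pow B. coef v C * coef v' (B - C)\<bar> \<le> (\<Sum>C\<in>Pow B. coef a C * coef a' (B - C))"
    by (intro order.trans[OF sum_abs] sum_mono dominated_real(1)) (use * in auto)
  show "\<bar>(\<Sum>C\<in>Pow B. coef u C * coef u' (B - C)) - (\<Sum>C\<in>Pow B. coef v C * coef v' (B - C))\<bar>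
      \<le> (\<Sum>C\<in>Pow B. coef b C * coef b' (B - C)) - (\<Sum>C\<in>Pow B. coef a C * coef a' (B - C))"
    unfolding sum_subtractf[symmetric]
    by (intro order.trans[OF sum_abs] sum_mono dominated_real(2)) (use * in auto)
qed

lemma dominated_add:
  assumes "dominated u v b a" "dominated u' v' b' a'"
  shows "dominated (u + u') (v + v') (b + b') (a + a')"
  unfolding dominated_def
proof
  fix B
  show "\<bar>coef (v + v') B\<bar> \<le> coef (a + a') B \<and>
      \<bar>coef (u + u') B - coef (v + v') B\<bar> \<le> coef (b + b') B - coef (a + a') B"
    using assms[unfolded dominated_def, rule_format, of B] by (simp only: coef_simps) linarith
qed

lemma dominated_sc:
  assumes "dominated u v b a" "\<bar>s\<bar> \<le> r"
  shows "dominated (sc s u) (sc s v) (sc r b) (sc r a)"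
  unfolding dominated_def
proof
  fix B
  note * = assms(1)[unfolded dominated_def, rule_format, of B]
  show "\<bar>coef (sc s v) B\<bar> \<le> coef (sc r a) B \<and>
      \<bar>coef (sc s u) B - coef (sc s v) B\<bar> \<le> coef (sc r b) B - coef (sc r a) B"
    using dominated_real[of s r s r, OF assms(2) _ conjunct1[OF *] conjunct2[OF *]] by simp
qed

lemma dominated_const: "(\<And>B. 0 \<le> coef a B) \<Longrightarrow> dominated a a a a"
  by (simp add: dominated_def)

lemma dominated_var: "dominated (var x) (var x) (var x) (var x)" "dominated 1 1 1 1" "dominated 0 0 0 0"
  by (auto intro!: dominated_const simp: coef_var)

lemma dominated_ops:
  assumes "dominated u v b a"
  shows "dominated (rho x u) (rho x v) (rho x b) (rho x a)" "dominated (dd x u) (dd x v) (dd x b) (dd x a)"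
  using assms unfolding dominated_def by simp_all

lemma dominated_sum:
  assumes "\<And>i. i \<in> I \<Longrightarrow> dominated (u i) (v i) (b i) (a i)"
  shows "dominated (sum u I) (sum v I) (sum b I) (sum a I)"
  using assms by (induction I rule: infinite_finite_induct) (auto intro: dominated_add dominated_var)

lemma dominated_hop_conj:
  assumes v: "dominated u v b a"
  shows "dominated (hop_conj U (-1) u i 1) (hop_conj U (-1) v i 1) (hop_conj U 1 b i 1) (hop_conj U 1 a i 1)"
proof -
  have rho: "dominated (rho_conj (-1) u x f) (rho_conj (-1) v x g) (rho_conj 1 b x h) (rho_conj 1 a x k)"
    if "dominated f g h k" for f g h k x
    unfolding rho_conj_def using v that
    by (intro dominated_mult dominated_add dominated_sc dominated_var dominated_ops) auto
  have flip: "dominated (flip_conj_in U (-1) u x f) (flip_conj_in U (-1) v x g)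
      (flip_conj_in U 1 b x h) (flip_conj_in U 1 a x k)"
    if "dominated f g h k" for f g h k x
  proof (cases "x \<in> U")
    case True
    have "dominated (flip_conj (-1) u x f) (flip_conj (-1) v x g) (flip_conj 1 b x h) (flip_conj 1 a x k)"
      unfolding flip_conj_def using v that
      by (intro dominated_mult dominated_add dominated_sc dominated_var dominated_ops) auto
    then show ?thesis using True by (simp add: flip_conj_in_def)
  qed (use that in \<open>simp add: flip_conj_in_def\<close>)
  show ?thesis unfolding hop_conj_def by (intro rho flip dominated_var)
qed

lemma dominated_cluster_map:
  assumes "dominated u v b a" "\<And>i. \<bar>\<tau> i\<bar> \<le> T" "0 < c"
  shows "dominated (cluster_map U c (-1) \<tau> u) (cluster_map U c (-1) \<tau> v)
    (cluster_map U c 1 (\<lambda>_. T) b) (cluster_map U c 1 (\<lambda>_. T) a)"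
proof -
  have *: "dominated (inv_num U c f) (inv_num U c g) (inv_num U c h) (inv_num U c k)" if d: "dominated f g h k" for f g h k
    unfolding dominated_def
  proof
    fix B
    have "\<bar>coef g B\<bar> \<le> coef k B" "\<bar>coef f B - coef g B\<bar> \<le> coef h B - coef k B"
      using d by (auto simp: dominated_def)
    moreover have "0 \<le> c * real (card B)" using assms(3) by simp
    ultimately have "\<bar>coef g B\<bar> / (c * real (card B)) \<le> coef k B / (c * real (card B))"
      "\<bar>coef f B - coef g B\<bar> / (c * real (card B)) \<le> (coef h B - coef k B) / (c * real (card B))"
      by (intro divide_right_mono; simp)+
    then show "\<bar>coef (inv_num U c g) B\<bar> \<le> coef (inv_num U c k) B \<and>
        \<bar>coef (inv_num U c f) B - coef (inv_num U c g) B\<bar> \<le> coef (inv_num U c h) B - coef (inv_num U c k) B"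
      using \<open>0 < c\<close> by (simp add: inv_num.rep_eq diff_divide_distrib[symmetric] abs_mult)
  qed
  show ?thesis unfolding cluster_map_def
    using assms by (intro * dominated_sum dominated_sc dominated_hop_conj)
qed

section \<open>Coefficientwise limits and the fixed point\<close>

definition ctends :: "(nat \<Rightarrow> galg) \<Rightarrow> galg \<Rightarrow> bool" where
  "ctends f g \<longleftrightarrow> (\<forall>B. (\<lambda>k. coef (f k) B) \<longlonglongrightarrow> coef g B)"

lemma ctends_ops:
  assumes "ctends f g"
  shows "ctends (\<lambda>k. rho x (f k)) (rho x g)" "ctends (\<lambda>k. dd x (f k)) (dd x g)" "ctends (\<lambda>k. sc s (f k)) (sc s g)"
  using assms unfolding ctends_def by (auto intro!: tendsto_intros)

lemma ctends_arith:
  assumes "ctends f g" "ctends f' g'"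
  shows "ctends (\<lambda>k. f k + f' k) (g + g')" "ctends (\<lambda>k. f k * f' k) (g * g')"
  using assms unfolding ctends_def by (auto simp: coef_mult intro!: tendsto_intros)

lemma ctends_const: "ctends (\<lambda>k. g) g" by (simp add: ctends_def)

lemma tendsto_If_const: "(P \<Longrightarrow> (f \<longlongrightarrow> a) F) \<Longrightarrow> (\<not> P \<Longrightarrow> (g \<longlongrightarrow> b) F) \<Longrightarrow>
    ((\<lambda>k. if P then f k else g k) \<longlongrightarrow> (if P then a else b)) F"
  by simp

lemma ctends_cluster_map:
  assumes v: "ctends v w"
  shows "ctends (\<lambda>k. cluster_map U c s \<tau> (v k)) (cluster_map U c s \<tau> w)"
proof -
  have rho: "ctends (\<lambda>k. rho_conj s (v k) x (f k)) (rho_conj s w x g)" if "ctends f g" for f g x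
    unfolding rho_conj_def using v that by (intro ctends_arith ctends_ops ctends_const)
  have flip: "ctends (\<lambda>k. flip_conj_in U s (v k) x (f k)) (flip_conj_in U s w x g)" if "ctends f g" for f g x
  proof (cases "x \<in> U")
    case True
    have "ctends (\<lambda>k. flip_conj s (v k) x (f k)) (flip_conj s w x g)"
      unfolding flip_conj_def using v that by (intro ctends_arith ctends_ops ctends_const)
    then show ?thesis using True by (simp add: flip_conj_in_def)
  qed (use that in \<open>simp add: flip_conj_in_def\<close>)
  have "ctends (\<lambda>k. hop_conj U s (v k) i 1) (hop_conj U s w i 1)" for i
    unfolding hop_conj_def by (intro rho flip ctends_const)
  then have "(\<lambda>k. \<Sum>i\<in>U. \<tau> i * coef (hop_conj U s (v k) i 1) B) \<longlonglongrightarrow> (\<Sum>i\<in>U. \<tau> i * coef (hop_conj U s w i 1) B)" for B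
    unfolding ctends_def by (intro tendsto_intros) auto
  from tendsto_mult_right[OF this] show ?thesis
    unfolding ctends_def coef_cluster_map divide_inverse by (intro allI) (rule tendsto_If_const; simp)
qed

lemma cluster_map_fixed_point:
  assumes U: "finite U" "0 \<notin> U" and \<tau>: "\<And>i. \<bar>\<tau> i\<bar> \<le> T" and c: "588 * T \<le> c" "0 < c"
  shows "\<exists>v. cluster_map U c (-1) \<tau> v = v \<and> (\<forall>p\<in>U. cmass U p v \<le> 1)"
proof -
  define a where "a k = (cluster_map U c 1 (\<lambda>_. T) ^^ k) 0" for k
  define v where "v k = (cluster_map U c (-1) \<tau> ^^ k) 0" for k
  have step: "a (Suc k) = cluster_map U c 1 (\<lambda>_. T) (a k)" "v (Suc k) = cluster_map U c (-1) \<tau> (v k)" for k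
    by (simp_all add: a_def v_def)
  have T: "\<bar>T\<bar> \<le> T" using \<tau>[of 0] by simp
  have dom: "dominated (v (Suc k)) (v k) (a (Suc k)) (a k)" for k
  proof (induction k)
    case 0
    have "dominated (cluster_map U c (-1) \<tau> 0) (cluster_map U c (-1) \<tau> 0)
      (cluster_map U c 1 (\<lambda>_. T) 0) (cluster_map U c 1 (\<lambda>_. T) 0)"
      by (rule dominated_cluster_map[OF dominated_var(3) \<tau> c(2)])
    then show ?case by (auto simp: a_def v_def dominated_def)
  next
    case (Suc k)
    then show ?case using dominated_cluster_map[OF Suc \<tau> c(2), of U] by (simp add: step)
  qed
  have mass: "\<forall>p\<in>U. cmass U p (a k) \<le> 1 \<and> cmass U p (v k) \<le> 1" for k
  proof (induction k)
    case (Suc k)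
    then show ?case unfolding step
      using cmass_cluster_map[OF U, of "a k" 1 _ "\<lambda>_. T" T c] cmass_cluster_map[OF U, of "v k" "-1" _ \<tau> T c] T \<tau> c
      by auto
  qed (simp add: a_def v_def cmass_def cong: if_cong)
  have conv: "convergent (\<lambda>k. coef (v k) B)" for B
  proof (cases "finite B \<and> B \<subseteq> U \<and> B \<noteq> {}")
    case True
    then obtain p where p: "p \<in> B" "p \<in> U" by auto
    have le: "coef (a k) B \<le> 1" for k
    proof -
      have "\<bar>coef (a k) B\<bar> \<le> cmass U p (a k)" unfolding cmass_def
        using member_le_sum[of B "Pow U" "\<lambda>B. if p \<in> B then \<bar>coef (a k) B\<bar> else 0"] U p True by simp
      then show ?thesis using mass[of k] p by force
    qed
    \<comment> \<open>The partial sums telescope to \<open>coef (a n) B\<close>, which is bounded by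
      the mass through a point \<open>p\<close> of \<open>B\<close>. Nonnegative increments then
      give summability without any contraction constant.\<close>
    have bnd: "summable (\<lambda>k. coef (a (Suc k)) B - coef (a k) B)"
    proof (rule summableI_nonneg_bounded[where x = 1])
      fix n
      show "0 \<le> coef (a (Suc n)) B - coef (a n) B"
        using conjunct2[OF dom[of n, unfolded dominated_def, rule_format, of B]] by linarith
      show "(\<Sum>k<n. coef (a (Suc k)) B - coef (a k) B) \<le> 1"
        unfolding sum_lessThan_telescope[of "\<lambda>k. coef (a k) B"] using le[of n] by (simp add: a_def[of 0])
    qed
    have "summable (\<lambda>k. coef (v (Suc k)) B - coef (v k) B)"
      by (rule summable_comparison_test[OF _ bnd]) (use dom in \<open>auto simp: dominated_def\<close>)
    then have "convergent (\<lambda>n. \<Sum>k<n. coef (v (Suc k)) B - coef (v k) B)" by (simp add: summable_iff_convergent)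
    then show ?thesis
      unfolding sum_lessThan_telescope[of "\<lambda>k. coef (v k) B"] by (simp add: v_def[of 0])
  next
    case False
    then have "coef (v k) B = 0" for k by (cases k) (auto simp: v_def coef_cluster_map)
    then show ?thesis by (simp add: convergent_const)
  qed
  define w where "w = Abs_galg (\<lambda>B. lim (\<lambda>k. coef (v k) B))"
  have w: "coef w B = lim (\<lambda>k. coef (v k) B)" for B
    unfolding w_def by (subst Abs_galg_inverse) auto
  have ct: "ctends v w" unfolding ctends_def w using conv by (simp add: convergent_LIMSEQ_iff)
  have "coef (cluster_map U c (-1) \<tau> w) B = coef w B" for B
  proof (rule LIMSEQ_unique)
    show "(\<lambda>k. coef (v (Suc k)) B) \<longlonglongrightarrow> coef (cluster_map U c (-1) \<tau> w) B"
      unfolding step using ctends_cluster_map[OF ct] by (simp add: ctends_def)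
    show "(\<lambda>k. coef (v (Suc k)) B) \<longlonglongrightarrow> coef w B"
      using ct LIMSEQ_Suc[of "\<lambda>k. coef (v k) B"] by (simp add: ctends_def)
  qed
  then have "cluster_map U c (-1) \<tau> w = w" by (intro galg_eqI) simp
  moreover have "cmass U p w \<le> 1" if p: "p \<in> U" for p
  proof (rule LIMSEQ_le_const2)
    show "(\<lambda>k. cmass U p (v k)) \<longlonglongrightarrow> cmass U p w"
      unfolding cmass_def using ct by (auto simp: ctends_def intro!: tendsto_intros)
    show "\<exists>N. \<forall>n\<ge>N. cmass U p (v n) \<le> 1" using mass p by blast
  qed
  ultimately show ?thesis by blast
qed

section \<open>Ground state and gap of the bond Hamiltonian\<close>

definition bond_ham :: "nat set \<Rightarrow> real \<Rightarrow> (nat \<Rightarrow> real) \<Rightarrow> galg \<Rightarrow> galg" where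
  "bond_ham U c t f = sc c (num f) + (\<Sum>i\<in>U. sc (t i) (hop U i f))"

text \<open>The conjugated hopping minus multiplication by its value on the vacuum function 1.
  Together with \<open>sc c (num v)\<close> the subtracted multiplications add up to the constant
  \<open>e\<close> of the cluster equation.\<close>

definition remainder :: "nat set \<Rightarrow> (nat \<Rightarrow> real) \<Rightarrow> galg \<Rightarrow> galg \<Rightarrow> galg" where
  "remainder U t v f = (\<Sum>i\<in>U. sc (t i) (hop_conj U (-1) v i f - f * hop_conj U (-1) v i 1))"

lemma remainder_linear:
  "remainder U t v (f + g) = remainder U t v f + remainder U t v g"
  "remainder U t v (sc c f) = sc c (remainder U t v f)"
  "remainder U t v (sum k A) = (\<Sum>i\<in>A. remainder U t v (k i))"
proof -
  show add: "remainder U t v (f + g) = remainder U t v f + remainder U t v g" for f g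
    unfolding remainder_def hop_conj_linear sum.distrib[symmetric]
    by (intro sum.cong galg_eqI) (auto simp: distrib_right algebra_simps)
  show sc: "remainder U t v (sc c f) = sc c (remainder U t v f)" for c f
    unfolding remainder_def hop_conj_linear
    by (intro galg_eqI) (auto simp: sc_mult sum_distrib_left algebra_simps intro!: sum.cong)
  have "remainder U t v 0 = 0" using sc[of 0 0] by (simp add: sc_neg)
  then show "remainder U t v (sum k A) = (\<Sum>i\<in>A. remainder U t v (k i))"
    by (induction A rule: infinite_finite_induct) (auto simp: add)
qed

lemma remainder_cong:
  assumes "\<And>B. B \<subseteq> U \<Longrightarrow> coef f B = coef g B" "B \<subseteq> U"
  shows "coef (remainder U t v f) B = coef (remainder U t v g) B"
  unfolding remainder_def using assms
  by (auto intro!: sum.cong simp: hop_conj_cong[of U f g] coef_mult_cong[of U f g])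

lemma nrm_mon: "nrm U (mon C) \<le> 1"
proof -
  have "nrm U (mon C) \<le> (\<Sum>B\<in>Pow U. if B = C then 1 else 0)"
    unfolding nrm_def by (intro sum_mono) auto
  also have "\<dots> \<le> 1" by (cases "finite (Pow U)") auto
  finally show ?thesis .
qed

text \<open>Only bonds in \<open>C\<close> or next to it contribute, at most
  \<open>3 * card C\<close> of them. Each costs at most \<open>100 * T\<close>: 50 for the hopping
  applied to the monomial and 50 for the subtracted product.\<close>

lemma remainder_mon_nrm:
  assumes U: "finite U" "C \<subseteq> U" and v: "\<And>x. x \<in> U \<Longrightarrow> cmass U x v \<le> 1" and t: "\<And>i. \<bar>t i\<bar> \<le> T"
  shows "nrm U (remainder U t v (mon C)) \<le> 300 * T * card C"
proof -
  have T: "0 \<le> T" using t[of 0] by linarith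
  have fC: "finite C" using U finite_subset by blast
  let ?Z = "C \<union> Suc ` C \<union> (\<lambda>i. i - 1) ` C"
  let ?h = "\<lambda>i. hop_conj U (-1) v i (mon C) - mon C * hop_conj U (-1) v i 1"
  have Z: "finite ?Z" "card ?Z \<le> 3 * card C"
  proof -
    have "card ?Z \<le> card C + card (Suc ` C) + card ((\<lambda>i. i - 1) ` C)"
      by (meson add_le_mono1 card_Un_le order.trans)
    also have "\<dots> \<le> card C + card C + card C"
      by (intro add_mono card_image_le fC) auto
    finally show "card ?Z \<le> 3 * card C" by simp
  qed (use fC in auto)
  have each: "nrm U (sc (t i) (?h i)) \<le> (if i \<in> ?Z then 100 * T else 0)" if i: "i \<in> U" for i
  proof (cases "i \<in> ?Z")
    case True
    have s: "\<bar>- 1 :: real\<bar> \<le> 1" by simp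
    have "nrm U (hop_conj U (-1) v i (mon C)) \<le> 50" "nrm U (hop_conj U (-1) v i 1) \<le> 50"
      using hop_conj_nrm[OF U(1) v s i, of "mon C"] hop_conj_nrm[OF U(1) v s i, of 1] nrm_mon[of U C] U
      by (auto simp: nrm_one)
    moreover from this(2) have "nrm U (mon C * hop_conj U (-1) v i 1) \<le> 1 * 50"
      by (intro order.trans[OF nrm_mult] mult_mono nrm_mon) auto
    ultimately have "nrm U (?h i) \<le> 100"
      using nrm_diff[of U "hop_conj U (-1) v i (mon C)" "mon C * hop_conj U (-1) v i 1"] by linarith
    then have "\<bar>t i\<bar> * nrm U (?h i) \<le> T * 100" using t T by (intro mult_mono) auto
    then show ?thesis using True by (simp add: nrm_sc)
  next
    case False
    then have "i \<notin> C" "i - 1 \<notin> C" "i + 1 \<notin> C"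
    proof -
      \<comment> \<open>For \<open>i = 0\<close> truncated subtraction gives
        \<open>i - 1 = i\<close>; this case is caught by the part \<open>C\<close> of the
        neighbourhood.\<close>
      show "i - 1 \<notin> C"
      proof
        assume "i - 1 \<in> C"
        then have "Suc (i - 1) \<in> ?Z" "i - 1 \<in> ?Z" by auto
        then show False using False by (cases i) auto
      qed
      show "i + 1 \<notin> C"
      proof
        assume "i + 1 \<in> C"
        then have "(i + 1) - 1 \<in> ?Z" by blast
        then show False using False by simp
      qed
    qed (use False in auto)
    then have "hop_conj U (-1) v i (mon C * 1) = mon C * hop_conj U (-1) v i 1"
      by (rule hop_conj_mon)
    then show ?thesis using False by (simp add: nrm_def)
  qed
  have "nrm U (remainder U t v (mon C)) \<le> (\<Sum>i\<in>U. if i \<in> ?Z then 100 * T else 0)"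
    unfolding remainder_def by (intro order.trans[OF nrm_sum] sum_mono each)
  also have "\<dots> \<le> (\<Sum>i\<in>?Z. 100 * T)"
    unfolding sum.inter_restrict[OF U(1), symmetric] using Z T by (intro sum_mono2) auto
  also have "\<dots> = 100 * T * card ?Z" by simp
  also have "\<dots> \<le> 100 * T * (3 * card C)" using Z T by (intro mult_left_mono) linarith+
  finally show ?thesis by simp
qed

lemma remainder_nrm:
  assumes U: "finite U" and v: "\<And>x. x \<in> U \<Longrightarrow> cmass U x v \<le> 1" and t: "\<And>i. \<bar>t i\<bar> \<le> T"
  shows "nrm U (remainder U t v f) \<le> (\<Sum>C\<in>Pow U. 300 * T * card C * \<bar>coef f C\<bar>)"
proof -
  define g where "g = (\<Sum>C\<in>Pow U. sc (coef f C) (mon C))"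
  have g: "coef f B = coef g B" if "B \<subseteq> U" for B
  proof -
    have "coef g B = (\<Sum>C\<in>Pow U. if C = B then coef f B else 0)"
      unfolding g_def using that finite_subset[OF that U] by (simp, intro sum.cong) auto
    then show ?thesis using that U by simp
  qed
  have "nrm U (remainder U t v f) = nrm U (remainder U t v g)"
    by (rule nrm_cong) (rule remainder_cong[OF g])
  also have "\<dots> = nrm U (\<Sum>C\<in>Pow U. sc (coef f C) (remainder U t v (mon C)))"
    by (simp add: g_def remainder_linear)
  also have "\<dots> \<le> (\<Sum>C\<in>Pow U. nrm U (sc (coef f C) (remainder U t v (mon C))))"
    by (rule nrm_sum)
  also have "\<dots> \<le> (\<Sum>C\<in>Pow U. \<bar>coef f C\<bar> * (300 * T * card C))"
    unfolding nrm_sc using U v t by (intro sum_mono mult_left_mono remainder_mon_nrm) auto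
  finally show ?thesis by (simp add: mult.commute)
qed

text \<open>By the Leibniz rule for \<open>num\<close> and by \<open>hop_expo\<close>, everything
  left after pulling out \<open>expo U v\<close> is \<open>sc c (num f)\<close>,
  \<open>remainder U t v f\<close> and \<open>f\<close> times the left side of the cluster equation.
  The latter is known only at subsets of \<open>U\<close>, so the identity is stated there.\<close>

lemma bond_ham_expo:
  assumes U: "finite U" "cluster U v" and B: "B \<subseteq> U"
    and v: "\<And>B. B \<subseteq> U \<Longrightarrow> coef (sc c (num v) + (\<Sum>i\<in>U. sc (t i) (hop_conj U (-1) v i 1))) B = coef (sc e 1) B"
  shows "coef (bond_ham U c t (expo U v * f)) B = coef (expo U v * (sc c (num f) + remainder U t v f + sc e f)) B"
proof -
  let ?\<psi> = "expo U v" and ?k = "sc c (num v) + (\<Sum>i\<in>U. sc (t i) (hop_conj U (-1) v i 1))"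
  have scd: "sc a (f + g) = sc a f + sc a g" "sc a (f - g) = sc a f - sc a g" for a f g
    by (rule galg_eqI; simp add: algebra_simps)+
  have num: "num (?\<psi> * f) = ?\<psi> * (num v * f) + ?\<psi> * num f"
    by (simp add: num_mult expo_num[OF U] mult_ac)
  have "bond_ham U c t (?\<psi> * f) = ?\<psi> * (sc c (num f) + (\<Sum>i\<in>U. sc (t i) (hop_conj U (-1) v i f)) + sc c (num v) * f)"
    by (simp add: bond_ham_def hop_expo[OF U] num sc_mult scd distrib_left sum_distrib_left add_ac)
  also have "\<dots> = ?\<psi> * (sc c (num f) + remainder U t v f + f * ?k)"
    by (simp add: remainder_def scd sum_subtractf algebra_simps sum_distrib_left sc_mult)
  also have "coef \<dots> B = coef (?\<psi> * (sc c (num f) + remainder U t v f + f * sc e 1)) B"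
    using B coef_mult_cong[of U f f ?k "sc e 1", OF _ v] by (intro coef_mult_cong[of U]) auto
  finally show ?thesis by (simp add: sc_mult)
qed

text \<open>The Gershgorin argument in the weighted coordinates \<open>f = expo_inv U v * F\<close>: the columns of
  \<open>remainder\<close> have absolute sums at most \<open>300 T card C\<close>, and the column of the vacuum vanishes.\<close>
lemma conj_eigen_bound:
  assumes U: "finite U" "cluster U v"
    and v: "\<And>B. B \<subseteq> U \<Longrightarrow> coef (sc c (num v) + (\<Sum>i\<in>U. sc (t i) (hop_conj U (-1) v i 1))) B = coef (sc e 1) B"
    and mass: "\<And>x. x \<in> U \<Longrightarrow> cmass U x v \<le> 1" and t: "\<And>i. \<bar>t i\<bar> \<le> T"
    and F: "\<And>B. B \<subseteq> U \<Longrightarrow> coef (bond_ham U c t F) B = \<mu> * coef F B + (if j \<in> U then r * coef (hop U j F) B else 0)"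
  defines "f \<equiv> expo_inv U v * F"
  shows "(\<Sum>B\<in>Pow U. (\<bar>c * card B - (\<mu> - e)\<bar> - 300 * T * card B) * \<bar>coef f B\<bar>) \<le> 50 * \<bar>r\<bar> * nrm U f"
proof -
  let ?\<psi> = "expo U v"
  have F\<psi>: "F = ?\<psi> * f" using expo_inv[OF U(1), of v] by (simp add: f_def mult.assoc[symmetric])
  \<comment> \<open>The conjugated form of a perturbation at the single bond \<open>j\<close>. It
    allows one estimate to serve both the gap and the comparison of Hamiltonians that differ at one
    bond.\<close>
  define d where "d = (if j \<in> U then sc r (hop_conj U (-1) v j f) else 0)"
  have d: "nrm U d \<le> 50 * \<bar>r\<bar> * nrm U f"
    using hop_conj_nrm[OF U(1) mass, of "-1" j f] mult_left_mono[of "nrm U (hop_conj U (-1) v j f)" "50 * nrm U f" "\<bar>r\<bar>"]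
    by (auto simp: d_def nrm_sc) (simp add: nrm_def)
  have eq: "coef (sc c (num f) + remainder U t v f + sc e f) B = coef (sc \<mu> f + d) B" if B: "B \<subseteq> U" for B
  proof -
    let ?p = "sc c (num f) + remainder U t v f + sc e f"
    have "coef (?\<psi> * ?p) B = coef (?\<psi> * (sc \<mu> f + d)) B" if "B \<subseteq> U" for B
    proof -
      have "coef (?\<psi> * ?p) B = coef (bond_ham U c t F) B"
        unfolding F\<psi> using bond_ham_expo[OF U that v] by simp
      also have "\<dots> = coef (sc \<mu> F + (if j \<in> U then sc r (hop U j F) else 0)) B" using F[OF that] by simp
      also have "sc \<mu> F + (if j \<in> U then sc r (hop U j F) else 0) = ?\<psi> * (sc \<mu> f + d)"
        by (simp add: F\<psi> hop_expo[OF U] d_def distrib_left sc_mult)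
      finally show ?thesis .
    qed
    then have "coef (expo_inv U v * (?\<psi> * ?p)) B = coef (expo_inv U v * (?\<psi> * (sc \<mu> f + d))) B"
      by (rule coef_mult_cong[of U, OF refl _ B])
    then show ?thesis using expo_inv[OF U(1), of v] by (simp add: mult.assoc[symmetric] mult.commute[of "expo_inv U v"] del: coef_simps)
  qed
  have "(\<Sum>B\<in>Pow U. \<bar>c * card B - (\<mu> - e)\<bar> * \<bar>coef f B\<bar>) \<le> (\<Sum>B\<in>Pow U. \<bar>coef d B\<bar> + \<bar>coef (remainder U t v f) B\<bar>)"
  proof (rule sum_mono)
    fix B assume "B \<in> Pow U"
    then have "(c * card B - (\<mu> - e)) * coef f B = coef d B - coef (remainder U t v f) B"
      using eq[of B] by (simp add: algebra_simps)
    then show "\<bar>c * card B - (\<mu> - e)\<bar> * \<bar>coef f B\<bar> \<le> \<bar>coef d B\<bar> + \<bar>coef (remainder U t v f) B\<bar>"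
      by (metis abs_mult abs_triangle_ineq4)
  qed
  also have "\<dots> \<le> 50 * \<bar>r\<bar> * nrm U f + (\<Sum>C\<in>Pow U. 300 * T * card C * \<bar>coef f C\<bar>)"
    using d remainder_nrm[where f = f and t = t, OF U(1) mass t] by (simp add: sum.distrib nrm_def)
  finally show ?thesis by (simp add: left_diff_distrib sum_subtractf)
qed

text \<open>In the application \<open>U\<close> is the set of bonds and \<open>c\<close> is twice
  the coupling. The number \<open>k\<close> will be the number of ferromagnetic bonds forced by the
  magnetization, and the perturbation at bond \<open>j\<close> in the last clause will be the change
  of sign at bond 1 between the two spin flip sectors.\<close>

theorem bond_ham_ground_state:
  assumes U: "finite U" "0 \<notin> U" and t: "\<And>i. \<bar>t i\<bar> \<le> T" and c: "588 * T \<le> c" "0 < c"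
  obtains \<psi> e where "coef \<psi> {} = 1"
    and "\<And>B. B \<subseteq> U \<Longrightarrow> coef (bond_ham U c t \<psi>) B = e * coef \<psi> B"
    and "\<And>F \<mu> k. (\<And>B. B \<subseteq> U \<Longrightarrow> coef (bond_ham U c t F) B = \<mu> * coef F B) \<Longrightarrow>
      (\<And>B. B \<subseteq> U \<Longrightarrow> card B < k \<Longrightarrow> coef F B = 0) \<Longrightarrow> \<mu> - e < (c - 300 * T) * real (max 1 k) \<Longrightarrow>
      (\<forall>B\<subseteq>U. coef F B = coef F {} * coef \<psi> B) \<and> (coef F {} \<noteq> 0 \<longrightarrow> \<mu> = e)"
    and "\<And>F \<mu> j r. (\<And>B. B \<subseteq> U \<Longrightarrow> coef (bond_ham U c t F) B =
        \<mu> * coef F B + (if j \<in> U then r * coef (hop U j F) B else 0)) \<Longrightarrow>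
      coef F {} = 1 \<Longrightarrow> e - 50 * \<bar>r\<bar> \<le> \<mu>"
proof -
  have T: "0 \<le> T" using t[of 0] by linarith
  have mt: "\<And>i. \<bar>- t i\<bar> \<le> T" using t by simp
  obtain v where v: "cluster_map U c (-1) (\<lambda>i. - t i) v = v" and mass: "\<And>p. p \<in> U \<Longrightarrow> cmass U p v \<le> 1"
    using cluster_map_fixed_point[where \<tau> = "\<lambda>i. - t i", OF U mt c] by blast
  have cl: "cluster U v" using cluster_cluster_map[of U c "-1" "\<lambda>i. - t i" v] v by simp
  \<comment> \<open>The constant coefficient of the cluster equation, to which \<open>num v\<close>
    contributes nothing.\<close>
  define e where "e = (\<Sum>i\<in>U. t i * coef (hop_conj U (-1) v i 1) {})"
  have eq: "coef (sc c (num v) + (\<Sum>i\<in>U. sc (t i) (hop_conj U (-1) v i 1))) B = coef (sc e 1) B" if B: "B \<subseteq> U" for B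
  proof (cases "B = {}")
    case False
    have fB: "finite B" using B U finite_subset by auto
    then have "card B \<noteq> 0" using False by simp
    have "coef v B = - (\<Sum>i\<in>U. t i * coef (hop_conj U (-1) v i 1) B) / (c * card B)"
      using coef_cluster_map[of U c "-1" "\<lambda>i. - t i" v B] False fB B unfolding v by (simp add: sum_negf)
    then have "c * (card B * coef v B) = - (\<Sum>i\<in>U. t i * coef (hop_conj U (-1) v i 1) B)"
      using c \<open>card B \<noteq> 0\<close> by (simp add: field_simps)
    then show ?thesis using False by simp
  qed (simp add: e_def)
  let ?\<psi> = "expo U v"
  note bound = conj_eigen_bound[OF U(1) cl eq mass t]
  have recover: "F = ?\<psi> * (expo_inv U v * F)" for F
    using expo_inv[OF U(1), of v] by (simp add: mult.assoc[symmetric])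
  have inv0: "coef (expo_inv U v) {} = 1" unfolding expo_inv_def coef_prod_empty by (rule prod.neutral) auto
  show ?thesis
  proof (rule that[of ?\<psi> e])
    show "coef (bond_ham U c t ?\<psi>) B = e * coef ?\<psi> B" if "B \<subseteq> U" for B
    proof -
      have "remainder U t v 1 = 0" by (simp add: remainder_def)
      then show ?thesis using bond_ham_expo[OF U(1) cl that eq, of 1] by (simp add: linear_simps sc_mult)
    qed
  next
    fix F \<mu> k
    assume F: "\<And>B. B \<subseteq> U \<Longrightarrow> coef (bond_ham U c t F) B = \<mu> * coef F B"
      and k: "\<And>B. B \<subseteq> U \<Longrightarrow> card B < k \<Longrightarrow> coef F B = 0"
      and gap: "\<mu> - e < (c - 300 * T) * real (max 1 k)"
    define f where "f = expo_inv U v * F"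
    have fk: "coef f B = 0" if "B \<subseteq> U" "card B < k" for B
      unfolding f_def coef_mult
    proof (rule sum.neutral, rule ballI)
      fix C assume "C \<in> Pow B"
      moreover have "finite B" using that U finite_subset by auto
      ultimately have "B - C \<subseteq> U" "card (B - C) < k" using that card_mono[of B "B - C"] by auto
      then show "coef (expo_inv U v) C * coef F (B - C) = 0" using k by simp
    qed
    have "coef (bond_ham U c t F) B = \<mu> * coef F B + (if 0 \<in> U then 0 * coef (hop U 0 F) B else 0)" if "B \<subseteq> U" for B
      using F[OF that] by simp
    from bound[OF _ _ this] have le: "(\<Sum>B\<in>Pow U. (\<bar>c * card B - (\<mu> - e)\<bar> - 300 * T * card B) * \<bar>coef f B\<bar>) \<le> 0"
      by (simp add: f_def)
    \<comment> \<open>On every nonempty set that can carry \<open>f\<close> the diagonal beats the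
      column sum, so \<open>f\<close> has to vanish there. The vacuum column is zero, hence for
      \<open>B = {}\<close> only \<open>\<bar>\<mu> - e\<bar>\<close> is left, and it vanishes if
      \<open>f\<close> does not.\<close>
    have nn: "0 < \<bar>c * card B - (\<mu> - e)\<bar> - 300 * T * card B" if B: "B \<subseteq> U" "B \<noteq> {}" "k \<le> card B" for B
    proof -
      have "0 < card B" using B U finite_subset card_gt_0_iff by blast
      then have m: "max 1 k \<le> card B" using B by simp
      have "300 * T \<le> c" using c T by linarith
      have "(c - 300 * T) * real (max 1 k) \<le> (c - 300 * T) * card B"
        by (rule mult_left_mono) (use m \<open>300 * T \<le> c\<close> in \<open>auto simp only: of_nat_le_iff\<close>)
      then show ?thesis using gap by (simp add: left_diff_distrib)
    qed
    have each: "0 \<le> (\<bar>c * card B - (\<mu> - e)\<bar> - 300 * T * card B) * \<bar>coef f B\<bar>" if "B \<in> Pow U" for B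
      using that nn[of B] fk[of B] by (cases "B = {}"; cases "card B < k"; force intro: mult_nonneg_nonneg)
    have zero: "(\<bar>c * card B - (\<mu> - e)\<bar> - 300 * T * card B) * \<bar>coef f B\<bar> = 0" if "B \<subseteq> U" for B
    proof -
      have "0 \<le> (\<Sum>B\<in>Pow U. (\<bar>c * card B - (\<mu> - e)\<bar> - 300 * T * card B) * \<bar>coef f B\<bar>)"
        by (rule sum_nonneg) (rule each)
      then have "(\<Sum>B\<in>Pow U. (\<bar>c * card B - (\<mu> - e)\<bar> - 300 * T * card B) * \<bar>coef f B\<bar>) = 0" using le by linarith
      then have "\<forall>B\<in>Pow U. (\<bar>c * card B - (\<mu> - e)\<bar> - 300 * T * card B) * \<bar>coef f B\<bar> = 0"
        using U each by (subst (asm) sum_nonneg_eq_0_iff) auto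
      then show ?thesis using that by blast
    qed
    have f0: "coef f B = 0" if "B \<subseteq> U" "B \<noteq> {}" for B
      using zero[OF that(1)] nn[OF that] fk[OF that(1)] by (cases "card B < k") auto
    have e0: "coef f {} = coef F {}" by (simp add: f_def coef_mult inv0)
    have "coef F B = coef F {} * coef ?\<psi> B" if B: "B \<subseteq> U" for B
    proof -
      have "coef F B = coef (?\<psi> * f) B" using recover[of F] by (simp add: f_def)
      also have "\<dots> = coef (?\<psi> * sc (coef F {}) 1) B"
        using B f0 e0 by (intro coef_mult_cong[of U]) auto
      finally show ?thesis by (simp add: sc_mult)
    qed
    moreover have "\<mu> = e" if "coef F {} \<noteq> 0" using zero[of "{}"] that e0 by simp
    ultimately show "(\<forall>B\<subseteq>U. coef F B = coef F {} * coef ?\<psi> B) \<and> (coef F {} \<noteq> 0 \<longrightarrow> \<mu> = e)" by blast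
  next
    fix F \<mu> j r
    assume F: "\<And>B. B \<subseteq> U \<Longrightarrow> coef (bond_ham U c t F) B =
        \<mu> * coef F B + (if j \<in> U then r * coef (hop U j F) B else 0)" and F1: "coef F {} = 1"
    define f where "f = expo_inv U v * F"
    have le: "(\<Sum>B\<in>Pow U. (\<bar>c * card B - (\<mu> - e)\<bar> - 300 * T * card B) * \<bar>coef f B\<bar>) \<le> 50 * \<bar>r\<bar> * nrm U f"
      unfolding f_def by (rule bound[OF _ _ F])
    show "e - 50 * \<bar>r\<bar> \<le> \<mu>"
    proof (rule ccontr)
      assume neg: "\<not> e - 50 * \<bar>r\<bar> \<le> \<mu>"
      have "\<bar>coef f {}\<bar> \<le> nrm U f" unfolding nrm_def using U by (intro member_le_sum) auto
      moreover have "coef f {} = 1" by (simp add: f_def coef_mult inv0 F1)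
      ultimately have pos: "0 < nrm U f" by simp
      \<comment> \<open>If \<open>\<mu>\<close> lay below the asserted bound, every set, the empty
        one included, would have diagonal excess at least \<open>e - \<mu>\<close>, because
        \<open>300 * T \<le> c\<close>.\<close>
      have "(e - \<mu>) * nrm U f \<le> (\<Sum>B\<in>Pow U. (\<bar>c * card B - (\<mu> - e)\<bar> - 300 * T * card B) * \<bar>coef f B\<bar>)"
        unfolding nrm_def sum_distrib_left
      proof (intro sum_mono mult_right_mono)
        fix B
        have "300 * T * card B \<le> c * card B" using c T by (intro mult_right_mono) auto
        then show "e - \<mu> \<le> \<bar>c * card B - (\<mu> - e)\<bar> - 300 * T * card B" by linarith
      qed auto
      then have "(e - \<mu>) * nrm U f \<le> 50 * \<bar>r\<bar> * nrm U f" using le by linarith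
      then show False using pos neg by simp
    qed
  qed simp
qed

section \<open>Spin configurations\<close>

text \<open>Site 1 is the leftmost tensor factor, so site \<open>j\<close> is bit \<open>N - j\<close> of the row index; a cleared
  bit means spin up.\<close>

definition spin :: "nat \<Rightarrow> nat \<Rightarrow> nat \<Rightarrow> real" where
  "spin N r j = (if bit r (N - j) then - 1 else 1)"

definition swap :: "nat \<Rightarrow> nat \<Rightarrow> nat \<Rightarrow> nat" where
  "swap N i r = flip_bit (N - i) (flip_bit (N - (i + 1)) r)"

definition ferro :: "nat \<Rightarrow> nat \<Rightarrow> nat set" where
  "ferro N r = {i\<in>{1..<N}. spin N r i = spin N r (i + 1)}"

definition mag :: "nat \<Rightarrow> nat \<Rightarrow> real" where
  "mag N r = (\<Sum>j\<in>{1..N}. spin N r j)"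

definition ising :: "nat \<Rightarrow> real \<Rightarrow> real \<Rightarrow> nat \<Rightarrow> real" where
  "ising N J h r = - J * (\<Sum>i\<in>{1..<N}. spin N r i * spin N r (i + 1)) - h * mag N r"

text \<open>The Hamiltonian on real amplitudes. The xx and yy terms cancel on parallel neighbours
  and add up on antiparallel ones, where flipping both spins is the same as exchanging them.\<close>

definition chain_ham :: "nat \<Rightarrow> real \<Rightarrow> real \<Rightarrow> real \<Rightarrow> (nat \<Rightarrow> real) \<Rightarrow> nat \<Rightarrow> real" where
  "chain_ham N J h t u r = ising N J h r * u r +
     t * (\<Sum>i\<in>{1..<N}. if i \<in> ferro N r then 0 else u (swap N i r))"

lemma spin_cases: "spin N r j = 1 \<or> spin N r j = - 1"
  by (cases "bit r (N - j)") (simp_all add: spin_def)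

lemma spin_neq: "spin N r i \<noteq> spin N r j \<Longrightarrow> spin N r j = - spin N r i"
  by (cases "bit r (N - i)"; cases "bit r (N - j)") (simp_all add: spin_def)

lemma spin_sq [simp]: "spin N r j * spin N r j = 1"
  by (cases "bit r (N - j)") (simp_all add: spin_def)

lemma less_exp_iff_bit: "(r::nat) < 2 ^ N \<longleftrightarrow> (\<forall>n\<ge>N. \<not> bit r n)"
proof
  assume "r < 2 ^ N"
  then have "take_bit N r = r" by (simp add: take_bit_nat_eq_self_iff)
  then show "\<forall>n\<ge>N. \<not> bit r n" by (metis bit_take_bit_iff linorder_not_less)
next
  assume "\<forall>n\<ge>N. \<not> bit r n"
  then have "take_bit N r = r" by (intro bit_eqI) (simp add: bit_take_bit_iff, metis linorder_not_less)
  then show "r < 2 ^ N" by (simp add: take_bit_nat_eq_self_iff)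
qed

lemma bit_swap: "i < N \<Longrightarrow> bit (swap N i r) n = (bit r n \<noteq> (n = N - i \<or> n = N - (i + 1)))"
proof -
  assume "i < N"
  then have ne: "N - i \<noteq> N - (i + 1)" by linarith
  show ?thesis unfolding swap_def bit_flip_bit_iff using ne by (cases "n = N - i"; cases "n = N - (i + 1)") simp_all
qed

lemma swap_less:
  assumes "1 \<le> i" "i < N" "r < 2 ^ N" shows "swap N i r < 2 ^ N"
  using assms unfolding less_exp_iff_bit by (auto simp: bit_swap)

lemma swap_swap: "i < N \<Longrightarrow> swap N i (swap N i r) = r"
  by (rule bit_eqI) (auto simp: bit_swap)

lemma spin_swap:
  assumes "1 \<le> i" "i < N" "1 \<le> j" "j \<le> N"
  shows "spin N (swap N i r) j = (if j = i \<or> j = i + 1 then - spin N r j else spin N r j)"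
proof -
  have i: "(N - j = N - i) = (j = i)" and i1: "(N - j = N - (i + 1)) = (j = i + 1)" using assms by linarith+
  show ?thesis unfolding spin_def bit_swap[OF assms(2)] i i1 by simp
qed

lemma ferro_subset: "ferro N r \<subseteq> {1..<N}" by (auto simp: ferro_def)

lemma finite_ferro [simp]: "finite (ferro N r)"
  using ferro_subset finite_subset by blast

lemma mag_swap:
  assumes i: "i \<in> {1..<N}" "i \<notin> ferro N r"
  shows "mag N (swap N i r) = mag N r"
proof -
  have "spin N r i + spin N r (i + 1) = 0"
    using i spin_neq[of N r i "i + 1"] by (auto simp: ferro_def)
  have split: "mag N r' = spin N r' i + spin N r' (i + 1) + (\<Sum>j\<in>{1..N} - {i, i + 1}. spin N r' j)" for r'
    unfolding mag_def using i by (subst sum.subset_diff[of "{i, i + 1}"]) (auto simp: add_ac)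
  have "(\<Sum>j\<in>{1..N} - {i, i + 1}. spin N (swap N i r) j) = (\<Sum>j\<in>{1..N} - {i, i + 1}. spin N r j)"
    using i by (intro sum.cong) (auto simp: spin_swap)
  then show ?thesis unfolding split using i \<open>spin N r i + spin N r (i + 1) = 0\<close> by (simp add: spin_swap)
qed

definition toggle :: "nat set \<Rightarrow> nat \<Rightarrow> nat set \<Rightarrow> nat set" where
  "toggle U x B = (if x \<in> U then (if x \<in> B then B - {x} else insert x B) else B)"

lemma mem_toggle: "y \<in> toggle U x B \<longleftrightarrow> (y \<in> B) \<noteq> (y = x \<and> x \<in> U)"
  by (auto simp: toggle_def)

lemma toggle_toggle: "toggle U x (toggle U y (toggle U x (toggle U y B))) = B"
  by (rule Set.set_eqI) (simp only: mem_toggle, blast)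

lemma coef_flip_in: "coef (flip_in U x f) B = coef f (toggle U x B)"
  by (simp add: flip_in_def toggle_def)

lemma coef_hop: "coef (hop U i f) B = (if i \<in> B then 0 else coef f (toggle U (i + 1) (toggle U (i - 1) B)))"
  by (simp add: hop_def coef_flip_in)

text \<open>Flipping the spins at \<open>i\<close> and \<open>i + 1\<close> keeps their relative
  sign and changes the sign of each relative to its outer neighbour. This is the origin of
  \<open>hop\<close>.\<close>

lemma ferro_swap:
  assumes i: "i \<in> {1..<N}"
  shows "ferro N (swap N i r) = toggle {1..<N} (i + 1) (toggle {1..<N} (i - 1) (ferro N r))"
proof (rule Set.set_eqI)
  fix x
  show "x \<in> ferro N (swap N i r) \<longleftrightarrow> x \<in> toggle {1..<N} (i + 1) (toggle {1..<N} (i - 1) (ferro N r))"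
  proof (cases "x \<in> {1..<N}")
    case True
    have neg: "(- spin N r k = spin N r l) = (spin N r k \<noteq> spin N r l)"
      "(spin N r k = - spin N r l) = (spin N r k \<noteq> spin N r l)" for k l
      by (auto simp: spin_def)
    have "x \<in> ferro N (swap N i r) \<longleftrightarrow> (x \<in> ferro N r) \<noteq> (x + 1 = i \<or> x = i + 1)"
      using i True by (simp add: ferro_def spin_swap neg)
    moreover have "x \<in> toggle {1..<N} (i + 1) (toggle {1..<N} (i - 1) (ferro N r)) \<longleftrightarrow>
        (x \<in> ferro N r) \<noteq> (x + 1 = i \<or> x = i + 1)"
    proof -
      have "x = i + 1 \<and> i + 1 \<in> {1..<N} \<longleftrightarrow> x = i + 1" "x = i - 1 \<and> i - 1 \<in> {1..<N} \<longleftrightarrow> x + 1 = i"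
        using i True by (simp_all, linarith+)
      moreover have "\<not> (x + 1 = i \<and> x = i + 1)" by simp
      ultimately show ?thesis unfolding mem_toggle by blast
    qed
    ultimately show ?thesis by simp
  next
    case False
    then have "x \<notin> ferro N (swap N i r)" "x \<notin> ferro N r" using ferro_subset by blast+
    then show ?thesis using False by (auto simp only: mem_toggle)
  qed
qed

lemma spin_chain:
  assumes "spin N r 1 = spin N r' 1" "ferro N r = ferro N r'" "1 \<le> j" "j \<le> N"
  shows "spin N r j = spin N r' j"
  using assms(3,4)
proof (induction j rule: nat_induct_at_least)
  case (Suc j)
  then have "j \<in> ferro N r \<longleftrightarrow> spin N r j = spin N r (Suc j)" "j \<in> ferro N r' \<longleftrightarrow> spin N r' j = spin N r' (Suc j)"
    by (auto simp: ferro_def)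
  then have iff: "spin N r j = spin N r (Suc j) \<longleftrightarrow> spin N r' j = spin N r' (Suc j)" using assms(2) by metis
  have IH: "spin N r j = spin N r' j" using Suc by simp
  show ?case
  proof (cases "spin N r j = spin N r (Suc j)")
    case True
    then show ?thesis using iff IH by metis
  next
    case False
    then show ?thesis using spin_neq[OF False] spin_neq[of N r' j "Suc j"] iff IH by metis
  qed
qed (use assms in auto)

lemma spin_ext:
  assumes "r < 2 ^ N" "r' < 2 ^ N" "\<And>j. 1 \<le> j \<Longrightarrow> j \<le> N \<Longrightarrow> spin N r j = spin N r' j"
  shows "r = r'"
proof (rule bit_eqI)
  fix n
  show "bit r n = bit r' n"
  proof (cases "n < N")
    case True
    then have "1 \<le> N - n" "N - n \<le> N" "N - (N - n) = n" by auto
    then show ?thesis using assms(3)[of "N - n"] by (auto simp: spin_def split: if_splits)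
  next
    case False
    then show ?thesis using assms(1,2) by (auto simp: less_exp_iff_bit)
  qed
qed

lemma config_eqI:
  assumes "r < 2 ^ N" "r' < 2 ^ N" "spin N r 1 = spin N r' 1" "ferro N r = ferro N r'"
  shows "r = r'"
  using assms spin_ext spin_chain by metis

lemma ex_bits: "\<exists>r::nat. r < 2 ^ N \<and> (\<forall>n<N. bit r n = P n)"
proof -
  have "\<exists>r::nat. \<forall>n. bit r n = (n < N \<and> P n)"
  proof (induction N)
    case (Suc N)
    then obtain r :: nat where r: "\<forall>n. bit r n = (n < N \<and> P n)" by blast
    then show ?case
      by (cases "P N"; intro exI[of _ "if P N then set_bit N r else r"])
         (auto simp: bit_set_bit_iff less_Suc_eq)
  qed (auto intro!: exI[of _ 0])
  then show ?thesis unfolding less_exp_iff_bit by (metis linorder_not_less)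
qed

lemma ex_config: "\<exists>r < 2 ^ N. \<forall>j. 1 \<le> j \<and> j \<le> N \<longrightarrow> spin N r j = (if P j then 1 else - 1)"
proof -
  obtain r :: nat where r: "r < 2 ^ N" "\<forall>n<N. bit r n = (\<not> P (N - n))"
    using ex_bits[of N "\<lambda>n. \<not> P (N - n)"] by blast
  then show ?thesis by (intro exI[of _ r]) (auto simp: spin_def)
qed

lemma neel_spin:
  assumes "ferro N r = {}" "1 \<le> j" "j \<le> N"
  shows "spin N r j = (if odd j then spin N r 1 else - spin N r 1)"
  using assms(2,3)
proof (induction j rule: nat_induct_at_least)
  case (Suc j)
  then have "spin N r j \<noteq> spin N r (Suc j)" using assms(1) by (auto simp: ferro_def)
  then have "spin N r (Suc j) = - spin N r j" by (rule spin_neq)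
  then show ?case using Suc by simp
qed simp

lemma neel_mag:
  assumes "ferro N r = {}"
  shows "mag N r = (if odd N then spin N r 1 else 0)"
proof -
  have "(\<Sum>j\<in>{1..n}. spin N r j) = (if odd n then spin N r 1 else 0)" if "n \<le> N" for n
    using that
  proof (induction n)
    case (Suc n)
    then show ?case using neel_spin[OF assms, of "Suc n"] by simp
  qed simp
  then show ?thesis by (simp add: mag_def)
qed

lemma ex_neel:
  assumes "s = 1 \<or> s = - 1" "1 \<le> N"
  shows "\<exists>r < 2 ^ N. ferro N r = {} \<and> spin N r 1 = s"
proof -
  obtain r where r: "r < 2 ^ N" "\<And>j. 1 \<le> j \<Longrightarrow> j \<le> N \<Longrightarrow> spin N r j = (if odd j = (s = 1) then 1 else - 1)"
    using ex_config[of N "\<lambda>j. odd j = (s = 1)"] by blast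
  then have "ferro N r = {}" "spin N r 1 = s" using assms by (auto simp: ferro_def)
  then show ?thesis using r by blast
qed

text \<open>If two neighbouring spins differ, the step from one to the next exchanges the two bounds.\<close>
lemma mag_prefix:
  assumes "1 \<le> n" "n \<le> N"
  shows "(\<Sum>j\<in>{1..n}. spin N r j) * spin N r n \<le> 1 + card (ferro N r \<inter> {..<n}) \<and>
    - (\<Sum>j\<in>{1..n}. spin N r j) * spin N r n \<le> card (ferro N r \<inter> {..<n})"
  using assms
proof (induction n rule: nat_induct_at_least)
  case base
  then show ?case by simp
next
  case (Suc n)
  let ?M = "\<Sum>j\<in>{1..n}. spin N r j"
  have IH: "?M * spin N r n \<le> 1 + card (ferro N r \<inter> {..<n})" "- ?M * spin N r n \<le> card (ferro N r \<inter> {..<n})"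
    using Suc by auto
  show ?case
  proof (cases "n \<in> ferro N r")
    case True
    then have "ferro N r \<inter> {..<Suc n} = insert n (ferro N r \<inter> {..<n})" by auto
    then have "card (ferro N r \<inter> {..<Suc n}) = Suc (card (ferro N r \<inter> {..<n}))" by simp
    moreover have "spin N r (Suc n) = spin N r n" using True by (simp add: ferro_def)
    ultimately show ?thesis using IH by (simp add: algebra_simps)
  next
    case False
    then have "ferro N r \<inter> {..<Suc n} = ferro N r \<inter> {..<n}" by (auto simp: less_Suc_eq)
    moreover have "spin N r n \<noteq> spin N r (Suc n)" using False Suc by (auto simp: ferro_def)
    then have "spin N r (Suc n) = - spin N r n" by (rule spin_neq)
    ultimately show ?thesis using IH by (simp add: algebra_simps)
  qed
qed

text \<open>The link between field and bond energy: along a Neel piece the spins cancel up to one,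
  so every further unit of magnetization costs a ferromagnetic bond.\<close>

lemma abs_mag_le:
  assumes "1 \<le> N" shows "\<bar>mag N r\<bar> \<le> 1 + card (ferro N r)"
proof -
  have "ferro N r \<inter> {..<N} = ferro N r" using ferro_subset by fastforce
  then show ?thesis using mag_prefix[of N N r] assms
    by (cases "bit r 0") (simp_all add: mag_def spin_def[of N r N], linarith+)
qed

lemma mag_eq: "mag N r = real N - 2 * real (card {j\<in>{1..N}. spin N r j = - 1})"
proof -
  have "mag N r = (\<Sum>j\<in>{1..N}. 1 - 2 * (if spin N r j = - 1 then 1 else 0))"
    unfolding mag_def by (intro sum.cong) (auto simp: spin_def)
  also have "\<dots> = real N - 2 * (\<Sum>j\<in>{1..N}. if spin N r j = - 1 then 1 else 0)"
    by (simp add: sum_subtractf sum_distrib_left)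
  also have "(\<Sum>j\<in>{1..N}. if spin N r j = - 1 then 1 else 0 :: real) = card {j\<in>{1..N}. spin N r j = - 1}"
    by (simp add: sum.If_cases Int_def)
  finally show ?thesis .
qed

lemma odd_mag:
  assumes "odd N" shows "\<bar>mag N r\<bar> \<le> 1 \<or> 3 \<le> \<bar>mag N r\<bar>"
proof -
  define k where "k = int N - 2 * int (card {j\<in>{1..N}. spin N r j = - 1})"
  have "mag N r = of_int k" by (simp add: mag_eq k_def)
  moreover have "odd k" using assms by (simp add: k_def)
  then have "\<bar>k\<bar> \<le> 1 \<or> 3 \<le> \<bar>k\<bar>" by presburger
  then have "\<bar>real_of_int k\<bar> \<le> 1 \<or> 3 \<le> \<bar>real_of_int k\<bar>" by linarith
  ultimately show ?thesis by simp
qed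

lemma sum_spin_spin:
  assumes "1 \<le> N"
  shows "(\<Sum>i\<in>{1..<N}. spin N r i * spin N r (i + 1)) = 2 * real (card (ferro N r)) - (real N - 1)"
proof -
  have "(\<Sum>i\<in>{1..<N}. spin N r i * spin N r (i + 1)) = (\<Sum>i\<in>{1..<N}. 2 * (if i \<in> ferro N r then 1 else 0) - 1)"
    by (intro sum.cong) (auto simp: ferro_def spin_def)
  also have "\<dots> = 2 * (\<Sum>i\<in>{1..<N}. if i \<in> ferro N r then 1 else 0) - real (N - 1)"
    by (simp add: sum_subtractf sum_distrib_left)
  also have "(\<Sum>i\<in>{1..<N}. if i \<in> ferro N r then 1 else 0 :: real) = card ({1..<N} \<inter> ferro N r)"
    by (simp add: sum.If_cases Int_def)
  also have "{1..<N} \<inter> ferro N r = ferro N r" using ferro_subset by blast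
  finally show ?thesis using assms by (simp add: of_nat_diff)
qed

section \<open>Reduction of the chain to bond variables\<close>

definition parity_sign :: "real \<Rightarrow> nat \<Rightarrow> nat \<Rightarrow> real" where
  "parity_sign \<epsilon> N r = (if spin N r 1 = 1 then 1 else \<epsilon>)"

text \<open>The component of \<open>u\<close> of magnetization \<open>m\<close> and eigenvalue \<open>\<epsilon>\<close> under the global spin flip,
  as a function of the set of ferromagnetic bonds.\<close>
lift_definition bond_fun :: "nat \<Rightarrow> real \<Rightarrow> real \<Rightarrow> (nat \<Rightarrow> real) \<Rightarrow> galg" is
  "\<lambda>N m \<epsilon> u B. \<Sum>r\<in>{r. r < 2 ^ N \<and> ferro N r = B \<and> mag N r = m}. parity_sign \<epsilon> N r * u r"
  by (metis (mono_tags, lifting) empty_iff finite_ferro mem_Collect_eq sum.neutral)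

text \<open>An exchange across bond 1 flips the first spin and multiplies \<open>parity_sign\<close>
  by \<open>\<epsilon>\<close>. The whole dependence on the sector thus sits in the sign of one
  hopping amplitude.\<close>

definition hop_sign :: "real \<Rightarrow> real \<Rightarrow> nat \<Rightarrow> real" where
  "hop_sign \<epsilon> t i = (if i = 1 then \<epsilon> * t else t)"

lemma parity_sign_swap:
  assumes "\<epsilon> = 1 \<or> \<epsilon> = - 1" "i \<in> {1..<N}"
  shows "parity_sign \<epsilon> N (swap N i r) = (if i = 1 then \<epsilon> else 1) * parity_sign \<epsilon> N r"
proof -
  have s: "spin N (swap N i r) 1 = (if i = 1 then - spin N r 1 else spin N r 1)"
    using assms(2) by (subst spin_swap) auto
  show ?thesis unfolding parity_sign_def s using assms(1) spin_cases[of N r 1] by auto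
qed

lemma ising_eq:
  assumes "1 \<le> N"
  shows "ising N (- g) h r = 2 * g * card (ferro N r) - g * (real N - 1) - h * mag N r"
  unfolding ising_def sum_spin_spin[OF assms] by (simp add: algebra_simps)

text \<open>Exchanges preserve the magnetization, so the field is the constant \<open>h * m\<close>
  on the class. For \<open>i\<close> outside \<open>B\<close>, the involution
  \<open>swap N i\<close> maps the configurations with bond set \<open>B\<close> bijectively to
  those with the toggled bond set.\<close>

lemma bond_fun_eigen:
  assumes N: "1 \<le> N" and \<epsilon>: "\<epsilon> = 1 \<or> \<epsilon> = - 1"
    and u: "\<And>r. r < 2 ^ N \<Longrightarrow> chain_ham N (- g) h t u r = \<mu> * u r"
  shows "coef (bond_ham {1..<N} (2 * g) (hop_sign \<epsilon> t) (bond_fun N m \<epsilon> u)) B =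
    (\<mu> + h * m + g * (real N - 1)) * coef (bond_fun N m \<epsilon> u) B"
proof -
  define cls where "cls B = {r. r < 2 ^ N \<and> ferro N r = B \<and> mag N r = m}" for B
  have fin: "finite (cls B)" for B by (simp add: cls_def)
  have bf: "coef (bond_fun N m \<epsilon> u) B = (\<Sum>r\<in>cls B. parity_sign \<epsilon> N r * u r)" for B
    by (simp add: bond_fun.rep_eq cls_def)
  have hop: "hop_sign \<epsilon> t i * coef (hop {1..<N} i (bond_fun N m \<epsilon> u)) B =
      (\<Sum>r\<in>cls B. parity_sign \<epsilon> N r * (t * (if i \<in> ferro N r then 0 else u (swap N i r))))"
    if i: "i \<in> {1..<N}" for i
  proof (cases "i \<in> B")
    case True
    then show ?thesis by (simp add: coef_hop) (auto simp: cls_def intro!: sum.neutral[symmetric])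
  next
    case False
    let ?B' = "toggle {1..<N} (i + 1) (toggle {1..<N} (i - 1) B)"
    have iB': "i \<notin> ?B'" using False i by (auto simp: mem_toggle)
    have "(\<Sum>r\<in>cls ?B'. parity_sign \<epsilon> N r * u r) =
        (\<Sum>r\<in>cls B. parity_sign \<epsilon> N (swap N i r) * u (swap N i r))"
    proof (rule sum.reindex_bij_witness[of _ "swap N i" "swap N i"])
      fix r assume "r \<in> cls ?B'"
      then have r: "r < 2 ^ N" "ferro N r = ?B'" "mag N r = m" by (auto simp: cls_def)
      show "swap N i (swap N i r) = r" using i by (simp add: swap_swap)
      then show "parity_sign \<epsilon> N (swap N i (swap N i r)) * u (swap N i (swap N i r)) = parity_sign \<epsilon> N r * u r" by simp
      show "swap N i r \<in> cls B"
        using i r iB' by (simp add: cls_def swap_less ferro_swap toggle_toggle mag_swap)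
    next
      fix r assume "r \<in> cls B"
      then have r: "r < 2 ^ N" "ferro N r = B" "mag N r = m" by (auto simp: cls_def)
      show "swap N i (swap N i r) = r" using i by (simp add: swap_swap)
      show "swap N i r \<in> cls ?B'"
        using i r False by (simp add: cls_def swap_less ferro_swap mag_swap)
    qed
    moreover have "hop_sign \<epsilon> t i * (\<Sum>r\<in>cls B. parity_sign \<epsilon> N (swap N i r) * u (swap N i r)) =
        (\<Sum>r\<in>cls B. parity_sign \<epsilon> N r * (t * (if i \<in> ferro N r then 0 else u (swap N i r))))"
      unfolding sum_distrib_left
    proof (rule sum.cong[OF refl])
      fix r assume "r \<in> cls B"
      then have "i \<notin> ferro N r" using False by (auto simp: cls_def)
      moreover have "hop_sign \<epsilon> t i * (if i = 1 then \<epsilon> else 1) = t" using \<epsilon> by (auto simp: hop_sign_def)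
      ultimately show "hop_sign \<epsilon> t i * (parity_sign \<epsilon> N (swap N i r) * u (swap N i r)) =
          parity_sign \<epsilon> N r * (t * (if i \<in> ferro N r then 0 else u (swap N i r)))"
      proof -
        assume n: "i \<notin> ferro N r" and c: "hop_sign \<epsilon> t i * (if i = 1 then \<epsilon> else 1) = t"
        have "hop_sign \<epsilon> t i * (parity_sign \<epsilon> N (swap N i r) * u (swap N i r)) =
            (hop_sign \<epsilon> t i * (if i = 1 then \<epsilon> else 1)) * (parity_sign \<epsilon> N r * u (swap N i r))"
          unfolding parity_sign_swap[OF \<epsilon> i] by (simp only: mult_ac)
        then show ?thesis unfolding c using n by (simp add: mult_ac)
      qed
    qed
    ultimately show ?thesis using False by (simp add: coef_hop bf)
  qed
  have "coef (bond_ham {1..<N} (2 * g) (hop_sign \<epsilon> t) (bond_fun N m \<epsilon> u)) B =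
      2 * g * (card B * (\<Sum>r\<in>cls B. parity_sign \<epsilon> N r * u r)) +
      (\<Sum>i\<in>{1..<N}. \<Sum>r\<in>cls B. parity_sign \<epsilon> N r * (t * (if i \<in> ferro N r then 0 else u (swap N i r))))"
    using hop by (simp add: bond_ham_def bf)
  also have "\<dots> = (\<Sum>r\<in>cls B. parity_sign \<epsilon> N r * (2 * g * card B * u r +
      t * (\<Sum>i\<in>{1..<N}. if i \<in> ferro N r then 0 else u (swap N i r))))"
    by (subst sum.swap) (simp add: sum_distrib_left sum.distrib distrib_left mult.assoc mult.left_commute)
  also have "\<dots> = (\<Sum>r\<in>cls B. (\<mu> + h * m + g * (real N - 1)) * (parity_sign \<epsilon> N r * u r))"
  proof (rule sum.cong[OF refl])
    fix r assume r: "r \<in> cls B"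
    then have "chain_ham N (- g) h t u r = \<mu> * u r" using u by (simp add: cls_def)
    then have e: "2 * g * card B * u r + t * (\<Sum>i\<in>{1..<N}. if i \<in> ferro N r then 0 else u (swap N i r)) =
        (\<mu> + h * m + g * (real N - 1)) * u r"
      using r by (simp add: chain_ham_def ising_eq[OF N] cls_def algebra_simps)
    show "parity_sign \<epsilon> N r * (2 * g * card B * u r +
        t * (\<Sum>i\<in>{1..<N}. if i \<in> ferro N r then 0 else u (swap N i r))) =
      (\<mu> + h * m + g * (real N - 1)) * (parity_sign \<epsilon> N r * u r)"
      unfolding e by simp
  qed
  also have "\<dots> = (\<mu> + h * m + g * (real N - 1)) * coef (bond_fun N m \<epsilon> u) B"
    by (simp add: bf sum_distrib_left)
  finally show ?thesis .
qed

definition chain_fun :: "nat \<Rightarrow> real \<Rightarrow> real \<Rightarrow> galg \<Rightarrow> nat \<Rightarrow> real" where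
  "chain_fun N m \<epsilon> f r = (if mag N r = m then parity_sign \<epsilon> N r * coef f (ferro N r) else 0)"

lemma chain_fun_eigen:
  assumes N: "1 \<le> N" and \<epsilon>: "\<epsilon> = 1 \<or> \<epsilon> = - 1"
    and f: "\<And>B. B \<subseteq> {1..<N} \<Longrightarrow> coef (bond_ham {1..<N} (2 * g) (hop_sign \<epsilon> t) f) B = e * coef f B"
  shows "chain_ham N (- g) h t (chain_fun N m \<epsilon> f) r = (e - g * (real N - 1) - h * m) * chain_fun N m \<epsilon> f r"
proof -
  have hop: "t * (if i \<in> ferro N r then 0 else chain_fun N m \<epsilon> f (swap N i r)) =
      (if mag N r = m then parity_sign \<epsilon> N r * (hop_sign \<epsilon> t i * coef (hop {1..<N} i f) (ferro N r)) else 0)"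
    if i: "i \<in> {1..<N}" for i
  proof (cases "i \<in> ferro N r")
    case False
    have "t * (if i = 1 then \<epsilon> else 1) = hop_sign \<epsilon> t i" using \<epsilon> by (auto simp: hop_sign_def)
    then show ?thesis using False
      by (simp add: chain_fun_def mag_swap[OF i False] parity_sign_swap[OF \<epsilon> i] ferro_swap[OF i] coef_hop)
  qed (simp add: coef_hop)
  have "chain_ham N (- g) h t (chain_fun N m \<epsilon> f) r = ising N (- g) h r * chain_fun N m \<epsilon> f r +
      (\<Sum>i\<in>{1..<N}. t * (if i \<in> ferro N r then 0 else chain_fun N m \<epsilon> f (swap N i r)))"
    by (simp add: chain_ham_def sum_distrib_left)
  also have "\<dots> = (e - g * (real N - 1) - h * m) * chain_fun N m \<epsilon> f r"
  proof (cases "mag N r = m")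
    case True
    have "(\<Sum>i\<in>{1..<N}. t * (if i \<in> ferro N r then 0 else chain_fun N m \<epsilon> f (swap N i r))) =
        parity_sign \<epsilon> N r * (\<Sum>i\<in>{1..<N}. hop_sign \<epsilon> t i * coef (hop {1..<N} i f) (ferro N r))"
      unfolding sum_distrib_left using hop True by (intro sum.cong) auto
    also have "(\<Sum>i\<in>{1..<N}. hop_sign \<epsilon> t i * coef (hop {1..<N} i f) (ferro N r)) =
        (e - 2 * g * card (ferro N r)) * coef f (ferro N r)"
      using f[OF ferro_subset] by (simp add: bond_ham_def algebra_simps)
    finally show ?thesis using True by (simp add: chain_fun_def ising_eq[OF N] algebra_simps)
  next
    case False
    then have "chain_fun N m \<epsilon> f r = 0" by (simp add: chain_fun_def)
    moreover have "(\<Sum>i\<in>{1..<N}. t * (if i \<in> ferro N r then 0 else chain_fun N m \<epsilon> f (swap N i r))) = 0"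
      using hop False by (intro sum.neutral) auto
    ultimately show ?thesis by simp
  qed
  finally show ?thesis .
qed

text \<open>A configuration is fixed by its bond set and its first spin. Weighting the sector
  \<open>\<epsilon> = -1\<close> with the first spin of \<open>r\<close> cancels the configuration
  with the opposite first spin.\<close>

lemma bond_fun_recover:
  assumes "r < 2 ^ N"
  shows "u r = (coef (bond_fun N (mag N r) 1 u) (ferro N r) +
    spin N r 1 * coef (bond_fun N (mag N r) (- 1) u) (ferro N r)) / 2"
proof -
  define cls where "cls = {r'. r' < 2 ^ N \<and> ferro N r' = ferro N r \<and> mag N r' = mag N r}"
  have "coef (bond_fun N (mag N r) 1 u) (ferro N r) + spin N r 1 * coef (bond_fun N (mag N r) (- 1) u) (ferro N r) =
      (\<Sum>r'\<in>cls. (parity_sign 1 N r' + spin N r 1 * parity_sign (- 1) N r') * u r')"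
    unfolding bond_fun.rep_eq cls_def[symmetric] by (simp add: sum_distrib_left sum.distrib distrib_right mult.assoc)
  also have "\<dots> = (\<Sum>r'\<in>cls. if r' = r then 2 * u r else 0)"
  proof (rule sum.cong[OF refl])
    fix r' assume r': "r' \<in> cls"
    have "parity_sign 1 N r' = 1" "parity_sign (- 1) N r' = spin N r' 1"
      using spin_cases[of N r' 1] by (auto simp: parity_sign_def)
    moreover have "1 + spin N r 1 * spin N r' 1 = (if r' = r then 2 else 0)"
    proof (cases "spin N r 1 = spin N r' 1")
      case True
      then have "r' = r" using r' assms config_eqI[of r N r'] by (auto simp: cls_def)
      then show ?thesis by simp
    next
      case False
      then have "spin N r' 1 = - spin N r 1" using spin_cases[of N r 1] spin_cases[of N r' 1] by auto
      then show ?thesis using False by auto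
    qed
    ultimately show "(parity_sign 1 N r' + spin N r 1 * parity_sign (- 1) N r') * u r' = (if r' = r then 2 * u r else 0)"
      by auto
  qed
  also have "\<dots> = 2 * u r" using assms by (simp add: cls_def)
  finally show ?thesis by simp
qed

lemma bond_fun_zero:
  assumes "1 \<le> N" "card B < nat \<lceil>\<bar>m\<bar> - 1\<rceil>"
  shows "coef (bond_fun N m \<epsilon> u) B = 0"
proof -
  have "{r. r < 2 ^ N \<and> ferro N r = B \<and> mag N r = m} = {}"
  proof (intro equals0I, elim CollectE conjE)
    fix r assume "ferro N r = B" "mag N r = m"
    then have "\<bar>m\<bar> - 1 \<le> of_int (int (card B))" using abs_mag_le[OF assms(1), of r] by auto
    then have "\<lceil>\<bar>m\<bar> - 1\<rceil> \<le> int (card B)" by (rule ceiling_le)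
    then show False using assms(2) by linarith
  qed
  then show ?thesis unfolding bond_fun.rep_eq by (simp only: sum.empty)
qed

section \<open>Ground states of the spin flip sectors and low states of the antiferromagnetic
  chain\<close>

lemma bond_ham_sign_change:
  assumes "finite U"
  shows "coef (bond_ham U c (hop_sign \<epsilon>' t) f) B = coef (bond_ham U c (hop_sign \<epsilon> t) f) B +
    (if 1 \<in> U then (\<epsilon>' - \<epsilon>) * t * coef (hop U 1 f) B else 0)"
proof -
  have "(\<Sum>i\<in>U. hop_sign \<epsilon>' t i * coef (hop U i f) B) = (\<Sum>i\<in>U. hop_sign \<epsilon> t i * coef (hop U i f) B) +
      (\<Sum>i\<in>U. if i = 1 then (\<epsilon>' - \<epsilon>) * t * coef (hop U 1 f) B else 0)"
    unfolding sum.distrib[symmetric] by (intro sum.cong) (auto simp: hop_sign_def algebra_simps)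
  also have "(\<Sum>i\<in>U. if i = 1 then (\<epsilon>' - \<epsilon>) * t * coef (hop U 1 f) B else 0) =
      (if 1 \<in> U then (\<epsilon>' - \<epsilon>) * t * coef (hop U 1 f) B else 0)"
    using assms by (rule sum.delta)
  finally show ?thesis by (simp add: bond_ham_def)
qed

lemma chain_ham_linear:
  "chain_ham N J h t (\<lambda>r. u r - (a * v r + b * w r)) r =
    chain_ham N J h t u r - (a * chain_ham N J h t v r + b * chain_ham N J h t w r)"
proof -
  have "(\<Sum>i\<in>{1..<N}. if i \<in> ferro N r then 0 else u (swap N i r) - (a * v (swap N i r) + b * w (swap N i r))) =
      (\<Sum>i\<in>{1..<N}. if i \<in> ferro N r then 0 else u (swap N i r)) -
      (a * (\<Sum>i\<in>{1..<N}. if i \<in> ferro N r then 0 else v (swap N i r)) +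
       b * (\<Sum>i\<in>{1..<N}. if i \<in> ferro N r then 0 else w (swap N i r)))"
    unfolding sum_distrib_left sum.distrib[symmetric] sum_subtractf[symmetric] by (intro sum.cong) auto
  note * = this
  show ?thesis unfolding chain_ham_def * by (simp only: algebra_simps)
qed

lemma neel_states:
  assumes "1 \<le> N"
  obtains a b where "a < 2 ^ N" "b < 2 ^ N" "spin N a 1 = 1" "spin N b 1 = - 1"
    "ferro N a = {}" "ferro N b = {}" "{r. r < 2 ^ N \<and> ferro N r = {}} = {a, b}" "a \<noteq> b"
proof -
  obtain a b where ab: "a < 2 ^ N" "ferro N a = {}" "spin N a 1 = 1" "b < 2 ^ N" "ferro N b = {}" "spin N b 1 = - 1"
    using ex_neel[of 1 N] ex_neel[of "- 1" N] assms by auto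
  have "r = a \<or> r = b" if "r < 2 ^ N" "ferro N r = {}" for r
    using spin_cases[of N r 1] config_eqI[of r N a] config_eqI[of r N b] that ab by auto
  moreover have "a \<noteq> b" using ab by auto
  ultimately show ?thesis using that[of a b] ab by blast
qed

text \<open>The pair \<open>\<psi>\<close>, \<open>e\<close> is chosen before \<open>h\<close> and
  \<open>m\<close>: the field appears only as the shift \<open>h * m\<close>. In the last clause 100
  = 50 * 2, since passing to the other sector changes the amplitude at bond 1 by
  \<open>2 * \<bar>t\<bar>\<close>.\<close>

definition sector_ground :: "nat \<Rightarrow> real \<Rightarrow> real \<Rightarrow> real \<Rightarrow> galg \<Rightarrow> real \<Rightarrow> bool" where
  "sector_ground N g \<epsilon> t \<psi> e \<longleftrightarrow> coef \<psi> {} = 1 \<and>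
    (\<forall>B\<subseteq>{1..<N}. coef (bond_ham {1..<N} (2 * g) (hop_sign \<epsilon> t) \<psi>) B = e * coef \<psi> B) \<and>
    (\<forall>h u \<mu> m. (\<forall>r<2 ^ N. chain_ham N (- g) h t u r = \<mu> * u r) \<longrightarrow>
      \<mu> + h * m + g * (real N - 1) - e < (2 * g - 300 * \<bar>t\<bar>) * max 1 (\<bar>m\<bar> - 1) \<longrightarrow>
      (\<forall>B\<subseteq>{1..<N}. coef (bond_fun N m \<epsilon> u) B = coef (bond_fun N m \<epsilon> u) {} * coef \<psi> B) \<and>
      (coef (bond_fun N m \<epsilon> u) {} \<noteq> 0 \<longrightarrow> \<mu> + h * m + g * (real N - 1) = e)) \<and>
    (\<forall>F \<epsilon>' e'. (\<epsilon>' = 1 \<or> \<epsilon>' = - 1) \<longrightarrow> coef F {} = 1 \<longrightarrow>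
      (\<forall>B\<subseteq>{1..<N}. coef (bond_ham {1..<N} (2 * g) (hop_sign \<epsilon>' t) F) B = e' * coef F B) \<longrightarrow> e - 100 * \<bar>t\<bar> \<le> e')"

lemmas sector_groundD =
  sector_ground_def[THEN iffD1, THEN conjunct1]
  sector_ground_def[THEN iffD1, THEN conjunct2, THEN conjunct1, THEN spec, THEN mp]
  sector_ground_def[THEN iffD1, THEN conjunct2, THEN conjunct2, THEN conjunct1, THEN spec, THEN spec,
    THEN spec, THEN spec, THEN mp, THEN mp]
  sector_ground_def[THEN iffD1, THEN conjunct2, THEN conjunct2, THEN conjunct2, THEN spec, THEN spec,
    THEN spec, THEN mp, THEN mp, THEN mp]

lemma ex_sector_ground:
  assumes N: "1 \<le> N" and \<epsilon>: "\<epsilon> = 1 \<or> \<epsilon> = - 1" and g: "588 * \<bar>t\<bar> \<le> 2 * g" "0 < g"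
  shows "\<exists>\<psi> e. sector_ground N g \<epsilon> t \<psi> e"
proof -
  have hs: "\<bar>hop_sign \<epsilon> t i\<bar> \<le> \<bar>t\<bar>" for i using \<epsilon> by (auto simp: hop_sign_def)
  have U: "finite {1..<N}" "0 \<notin> {1..<N}" by auto
  have g2: "0 < 2 * g" using g by simp
  show ?thesis
  proof (rule bond_ham_ground_state[OF U hs g(1) g2])
    fix \<psi> e
    assume *: "coef \<psi> {} = 1"
      and \<psi>: "\<And>B. B \<subseteq> {1..<N} \<Longrightarrow> coef (bond_ham {1..<N} (2 * g) (hop_sign \<epsilon> t) \<psi>) B = e * coef \<psi> B"
      and gap: "\<And>F \<mu> k. (\<And>B. B \<subseteq> {1..<N} \<Longrightarrow> coef (bond_ham {1..<N} (2 * g) (hop_sign \<epsilon> t) F) B = \<mu> * coef F B) \<Longrightarrow>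
        (\<And>B. B \<subseteq> {1..<N} \<Longrightarrow> card B < k \<Longrightarrow> coef F B = 0) \<Longrightarrow> \<mu> - e < (2 * g - 300 * \<bar>t\<bar>) * real (max 1 k) \<Longrightarrow>
        (\<forall>B\<subseteq>{1..<N}. coef F B = coef F {} * coef \<psi> B) \<and> (coef F {} \<noteq> 0 \<longrightarrow> \<mu> = e)"
      and stab: "\<And>F \<mu> j r. (\<And>B. B \<subseteq> {1..<N} \<Longrightarrow> coef (bond_ham {1..<N} (2 * g) (hop_sign \<epsilon> t) F) B =
          \<mu> * coef F B + (if j \<in> {1..<N} then r * coef (hop {1..<N} j F) B else 0)) \<Longrightarrow>
        coef F {} = 1 \<Longrightarrow> e - 50 * \<bar>r\<bar> \<le> \<mu>"
    have "sector_ground N g \<epsilon> t \<psi> e" unfolding sector_ground_def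
    proof (intro conjI allI impI)
      show "coef \<psi> {} = 1" by fact
      show "coef (bond_ham {1..<N} (2 * g) (hop_sign \<epsilon> t) \<psi>) B = e * coef \<psi> B" if "B \<subseteq> {1..<N}" for B
        by (rule \<psi>[OF that])
    next
      fix h u \<mu> m
      assume u: "\<forall>r<2 ^ N. chain_ham N (- g) h t u r = \<mu> * u r"
        and lt: "\<mu> + h * m + g * (real N - 1) - e < (2 * g - 300 * \<bar>t\<bar>) * max 1 (\<bar>m\<bar> - 1)"
      define k where "k = nat \<lceil>\<bar>m\<bar> - 1\<rceil>"
      have "\<bar>m\<bar> - 1 \<le> real k" unfolding k_def by (rule real_nat_ceiling_ge)
      then have "max 1 (\<bar>m\<bar> - 1) \<le> real (max 1 k)" by auto
      then have "(2 * g - 300 * \<bar>t\<bar>) * max 1 (\<bar>m\<bar> - 1) \<le> (2 * g - 300 * \<bar>t\<bar>) * real (max 1 k)"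
        using g by (intro mult_left_mono) auto
      then have "\<mu> + h * m + g * (real N - 1) - e < (2 * g - 300 * \<bar>t\<bar>) * real (max 1 k)" using lt by linarith
      note lt' = this
      have *: "(\<forall>B\<subseteq>{1..<N}. coef (bond_fun N m \<epsilon> u) B = coef (bond_fun N m \<epsilon> u) {} * coef \<psi> B) \<and>
          (coef (bond_fun N m \<epsilon> u) {} \<noteq> 0 \<longrightarrow> \<mu> + h * m + g * (real N - 1) = e)"
      proof (rule gap[OF _ _ lt'])
        show "coef (bond_ham {1..<N} (2 * g) (hop_sign \<epsilon> t) (bond_fun N m \<epsilon> u)) B =
            (\<mu> + h * m + g * (real N - 1)) * coef (bond_fun N m \<epsilon> u) B" for B
          by (rule bond_fun_eigen[OF N \<epsilon> u[rule_format]])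
        show "coef (bond_fun N m \<epsilon> u) B = 0" if "card B < k" for B
          by (rule bond_fun_zero[OF N that[unfolded k_def]])
      qed
      show "coef (bond_fun N m \<epsilon> u) B = coef (bond_fun N m \<epsilon> u) {} * coef \<psi> B" if "B \<subseteq> {1..<N}" for B
        using * that by blast
      show "\<mu> + h * m + g * (real N - 1) = e" if "coef (bond_fun N m \<epsilon> u) {} \<noteq> 0"
        using * that by blast
    next
      fix F \<epsilon>' e'
      assume \<epsilon>': "\<epsilon>' = 1 \<or> \<epsilon>' = - 1" and F: "coef F {} = 1"
        "\<forall>B\<subseteq>{1..<N}. coef (bond_ham {1..<N} (2 * g) (hop_sign \<epsilon>' t) F) B = e' * coef F B"
      have "e - 50 * \<bar>(\<epsilon> - \<epsilon>') * t\<bar> \<le> e'"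
      proof (rule stab[of F e' 1])
        fix B assume "B \<subseteq> {1..<N}"
        then show "coef (bond_ham {1..<N} (2 * g) (hop_sign \<epsilon> t) F) B =
            e' * coef F B + (if 1 \<in> {1..<N} then (\<epsilon> - \<epsilon>') * t * coef (hop {1..<N} 1 F) B else 0)"
          using F(2) bond_ham_sign_change[of "{1..<N}" "2 * g" \<epsilon> t F B \<epsilon>'] by simp
      qed (fact F(1))
      moreover have "\<bar>(\<epsilon> - \<epsilon>') * t\<bar> \<le> 2 * \<bar>t\<bar>" using \<epsilon> \<epsilon>' by (auto simp: abs_mult)
      ultimately show "e - 100 * \<bar>t\<bar> \<le> e'" by linarith
    qed
    then show ?thesis by blast
  qed
qed

text \<open>Below the threshold each bond function is a multiple of the sector ground state, with
  its coefficient at the empty set as factor. So an eigenfunction of low energy is determined by its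
  values at the two Neel states.\<close>

lemma chain_eigen_zero:
  assumes p: "sector_ground N g 1 t \<psi>p ep" and m: "sector_ground N g (- 1) t \<psi>m em"
    and u: "\<forall>r<2 ^ N. chain_ham N (- g) h t u r = \<mu> * u r"
    and low: "\<And>r. r < 2 ^ N \<Longrightarrow> \<mu> + h * mag N r + g * (real N - 1) - min ep em <
      (2 * g - 300 * \<bar>t\<bar>) * max 1 (\<bar>mag N r\<bar> - 1)"
    and neel: "\<And>r. r < 2 ^ N \<Longrightarrow> ferro N r = {} \<Longrightarrow> u r = 0" and r: "r < 2 ^ N"
  shows "u r = 0"
proof -
  have z: "coef (bond_fun N m \<epsilon> u) {} = 0" for m \<epsilon>
    using neel by (simp add: bond_fun.rep_eq)
  have "\<mu> + h * mag N r + g * (real N - 1) - ep < (2 * g - 300 * \<bar>t\<bar>) * max 1 (\<bar>mag N r\<bar> - 1)"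
    "\<mu> + h * mag N r + g * (real N - 1) - em < (2 * g - 300 * \<bar>t\<bar>) * max 1 (\<bar>mag N r\<bar> - 1)"
    using low[OF r] by linarith+
  then have "coef (bond_fun N (mag N r) 1 u) (ferro N r) = 0" "coef (bond_fun N (mag N r) (- 1) u) (ferro N r) = 0"
    using sector_groundD(3)[OF p u, of "mag N r"] sector_groundD(3)[OF m u, of "mag N r"] z ferro_subset by auto
  then show ?thesis using bond_fun_recover[OF r, of u] by simp
qed

text \<open>The field gains at most \<open>h * \<bar>m\<bar>\<close>, while the bonds cost
  \<open>\<kappa> * (\<bar>m\<bar> - 1)\<close> once \<open>\<bar>m\<bar> \<ge> 2\<close>. In the
  first estimate equality occurs at \<open>m = 1\<close>, and the excluded value
  \<open>m = 2\<close> would violate it. In the second, equality occurs at \<open>m = 2\<close>,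
  where one ferromagnetic bond pays for two units of magnetization; this is why the window for even
  length is shorter by \<open>2 * h\<close>.\<close>

lemma sector_threshold:
  fixes h \<kappa> :: real
  assumes "0 < h" "2 * h \<le> \<kappa>"
  shows "\<bar>m\<bar> \<le> 1 \<or> 3 \<le> \<bar>m\<bar> \<Longrightarrow> h * m + \<kappa> - h \<le> \<kappa> * max 1 (\<bar>m\<bar> - 1)"
    and "h * m + \<kappa> - 2 * h \<le> \<kappa> * max 1 (\<bar>m\<bar> - 1)"
proof -
  have hm: "h * m \<le> h * \<bar>m\<bar>" using assms by (intro mult_left_mono) auto
  have mul: "2 * h * x \<le> \<kappa> * x" if "0 \<le> x" for x using that assms by (intro mult_right_mono) auto
  show "h * m + \<kappa> - h \<le> \<kappa> * max 1 (\<bar>m\<bar> - 1)" if "\<bar>m\<bar> \<le> 1 \<or> 3 \<le> \<bar>m\<bar>"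
    using that
  proof
    assume "\<bar>m\<bar> \<le> 1"
    then show ?thesis using mult_left_mono[of "\<bar>m\<bar>" 1 h] hm assms by (simp add: max_def)
  next
    assume m: "3 \<le> \<bar>m\<bar>"
    have "h * 3 \<le> h * \<bar>m\<bar>" using m assms by (intro mult_left_mono) auto
    then show ?thesis using m hm mul[of "\<bar>m\<bar> - 2"] by (simp add: max_def algebra_simps)
  qed
  show "h * m + \<kappa> - 2 * h \<le> \<kappa> * max 1 (\<bar>m\<bar> - 1)"
  proof (cases "\<bar>m\<bar> \<le> 2")
    case True
    then have "h * \<bar>m\<bar> \<le> h * 2" using assms by (intro mult_left_mono) auto
    then show ?thesis using hm True by (simp add: max_def)
  next
    case False
    then have "h * 2 \<le> h * \<bar>m\<bar>" using assms by (intro mult_left_mono) auto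
    then show ?thesis using hm False mul[of "\<bar>m\<bar> - 2"] by (simp add: max_def algebra_simps)
  qed
qed

theorem chain_low_states:
  assumes N: "1 \<le> N" and h: "0 < h" "2 * h < g" and t: "\<bar>t\<bar> < (g - 2 * h) / 1000"
  obtains w w' \<mu> \<mu>' \<theta> where
    "\<And>r. chain_ham N (- g) h t w r = \<mu> * w r" "\<And>r. chain_ham N (- g) h t w' r = \<mu>' * w' r"
    "\<And>\<alpha> \<beta>. (\<forall>r<2 ^ N. \<alpha> * w r + \<beta> * w' r = 0) \<Longrightarrow> \<alpha> = 0 \<and> \<beta> = 0"
    "\<And>u \<nu>. \<forall>r<2 ^ N. chain_ham N (- g) h t u r = \<nu> * u r \<Longrightarrow> \<nu> < \<theta> \<Longrightarrow>
      \<exists>\<alpha> \<beta>. (\<forall>r<2 ^ N. u r = \<alpha> * w r + \<beta> * w' r) \<and> (\<alpha> \<noteq> 0 \<longrightarrow> \<nu> = \<mu>) \<and> (\<beta> \<noteq> 0 \<longrightarrow> \<nu> = \<mu>')"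
    "odd N \<Longrightarrow> \<mu>' = \<mu> + 2 * h \<and> \<theta> = \<mu> + 2 * g - 300 * \<bar>t\<bar>"
    "even N \<Longrightarrow> \<bar>\<mu>' - \<mu>\<bar> \<le> 100 * \<bar>t\<bar> \<and> \<theta> = min \<mu> \<mu>' + 2 * g - 2 * h - 300 * \<bar>t\<bar>"
proof -
  have g: "588 * \<bar>t\<bar> \<le> 2 * g" "0 < g" using h t by auto
  define \<kappa> where "\<kappa> = 2 * g - 300 * \<bar>t\<bar>"
  have \<kappa>: "2 * h \<le> \<kappa>" "100 * \<bar>t\<bar> < \<kappa>" "0 < \<kappa>" using h t by (auto simp: \<kappa>_def)
  obtain \<psi>p ep where p: "sector_ground N g 1 t \<psi>p ep" using ex_sector_ground[OF N _ g, of 1] by blast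
  obtain \<psi>m em where m: "sector_ground N g (- 1) t \<psi>m em" using ex_sector_ground[OF N _ g, of "- 1"] by blast
  have close: "\<bar>em - ep\<bar> \<le> 100 * \<bar>t\<bar>"
  proof -
    have "ep - 100 * \<bar>t\<bar> \<le> em"
      using sector_groundD(4)[OF p, of "- 1" \<psi>m em] sector_groundD(1,2)[OF m] by blast
    moreover have "em - 100 * \<bar>t\<bar> \<le> ep"
      using sector_groundD(4)[OF m, of 1 \<psi>p ep] sector_groundD(1,2)[OF p] by blast
    ultimately show ?thesis by linarith
  qed
  have \<psi>0: "coef \<psi>p {} = 1" "coef \<psi>m {} = 1" using sector_groundD(1) p m by blast+
  have eig: "chain_ham N (- g) h t (chain_fun N s 1 \<psi>p) r = (ep - g * (real N - 1) - h * s) * chain_fun N s 1 \<psi>p r" for s r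
    by (rule chain_fun_eigen[OF N disjI1[OF refl] sector_groundD(2)[OF p]])
  have eig': "chain_ham N (- g) h t (chain_fun N s (- 1) \<psi>m) r =
      (em - g * (real N - 1) - h * s) * chain_fun N s (- 1) \<psi>m r" for s r
    by (rule chain_fun_eigen[OF N disjI2[OF refl] sector_groundD(2)[OF m]])
  obtain a b where ab: "a < 2 ^ N" "b < 2 ^ N" "spin N a 1 = 1" "spin N b 1 = - 1"
    "ferro N a = {}" "ferro N b = {}" "{r. r < 2 ^ N \<and> ferro N r = {}} = {a, b}" "a \<noteq> b"
    using neel_states[OF N] by blast
  have ps: "parity_sign \<epsilon> N a = 1" "parity_sign \<epsilon> N b = \<epsilon>" for \<epsilon>
    using ab by (auto simp: parity_sign_def)
  have bf: "coef (bond_fun N s \<epsilon> u) {} = (\<Sum>r\<in>{r\<in>{a, b}. mag N r = s}. parity_sign \<epsilon> N r * u r)" for s \<epsilon> u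
    unfolding bond_fun.rep_eq ab(7)[symmetric] by (intro sum.cong) auto
  have sp: "coef (bond_fun N s 1 u) {} \<noteq> 0 \<Longrightarrow> \<nu> + h * s + g * (real N - 1) = ep"
    if "\<forall>r<2 ^ N. chain_ham N (- g) h t u r = \<nu> * u r" "\<nu> + h * s + g * (real N - 1) - ep < \<kappa> * max 1 (\<bar>s\<bar> - 1)" for u \<nu> s
    using sector_groundD(3)[OF p that(1), folded \<kappa>_def] that(2) by blast
  have sm: "coef (bond_fun N s (- 1) u) {} \<noteq> 0 \<Longrightarrow> \<nu> + h * s + g * (real N - 1) = em"
    if "\<forall>r<2 ^ N. chain_ham N (- g) h t u r = \<nu> * u r" "\<nu> + h * s + g * (real N - 1) - em < \<kappa> * max 1 (\<bar>s\<bar> - 1)" for u \<nu> s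
    using sector_groundD(3)[OF m that(1), folded \<kappa>_def] that(2) by blast
  note zero = chain_eigen_zero[OF p m, folded \<kappa>_def]
  note thr = sector_threshold[OF h(1) \<kappa>(1)]
  \<comment> \<open>A state enters the combination with nonzero coefficient only if its energy is
    \<open>\<nu>\<close>, so the difference is again an eigenfunction for \<open>\<nu>\<close>. It
    vanishes at both Neel states, hence everywhere.\<close>
  have expand: "\<forall>r<2 ^ N. u r = \<alpha> * w r + \<beta> * w' r"
    if u: "\<forall>r<2 ^ N. chain_ham N (- g) h t u r = \<nu> * u r"
      and w: "\<And>r. chain_ham N (- g) h t w r = \<mu> * w r" "\<And>r. chain_ham N (- g) h t w' r = \<mu>' * w' r"
      and low: "\<And>r. r < 2 ^ N \<Longrightarrow> \<nu> + h * mag N r + g * (real N - 1) - min ep em < \<kappa> * max 1 (\<bar>mag N r\<bar> - 1)"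
      and c: "\<alpha> \<noteq> 0 \<longrightarrow> \<nu> = \<mu>" "\<beta> \<noteq> 0 \<longrightarrow> \<nu> = \<mu>'"
      and at: "u a = \<alpha> * w a + \<beta> * w' a" "u b = \<alpha> * w b + \<beta> * w' b"
    for u w w' \<alpha> \<beta> \<nu> \<mu> \<mu>'
  proof -
    let ?d = "\<lambda>r. u r - (\<alpha> * w r + \<beta> * w' r)"
    have "chain_ham N (- g) h t ?d r = \<nu> * ?d r" if "r < 2 ^ N" for r
      unfolding chain_ham_linear w using u that c by (cases "\<alpha> = 0"; cases "\<beta> = 0") (auto simp: algebra_simps)
    then have d: "\<forall>r<2 ^ N. chain_ham N (- g) h t ?d r = \<nu> * ?d r" by blast
    have "?d r = 0" if "r < 2 ^ N" for r
    proof (rule zero[OF d low _ that])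
      show "?d r = 0" if "r < 2 ^ N" "ferro N r = {}" for r
      proof -
        have "r \<in> {a, b}" using that ab(7) by blast
        then show ?thesis using at by auto
      qed
    qed
    then show ?thesis by simp
  qed
  show ?thesis
  proof (cases "odd N")
    case True
    have mag: "mag N a = 1" "mag N b = - 1" using neel_mag[OF ab(5)] neel_mag[OF ab(6)] ab True by auto
    have bfa: "coef (bond_fun N 1 \<epsilon> u) {} = u a" and bfb: "coef (bond_fun N (- 1) \<epsilon> u) {} = \<epsilon> * u b" for \<epsilon> u
    proof -
      have "{r\<in>{a, b}. mag N r = 1} = {a}" "{r\<in>{a, b}. mag N r = - 1} = {b}" using mag by auto
      then show "coef (bond_fun N 1 \<epsilon> u) {} = u a" "coef (bond_fun N (- 1) \<epsilon> u) {} = \<epsilon> * u b"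
        unfolding bf by (simp_all add: ps)
    qed
    define w where "w = chain_fun N 1 1 \<psi>p"
    define w' where "w' = chain_fun N (- 1) 1 \<psi>p"
    have w: "w a = 1" "w b = 0" "w' a = 0" "w' b = 1"
      using mag ab ps \<psi>0 by (auto simp: w_def w'_def chain_fun_def)
    define \<mu> where "\<mu> = ep - g * (real N - 1) - h"
    have we: "chain_ham N (- g) h t w r = \<mu> * w r" "chain_ham N (- g) h t w' r = (\<mu> + 2 * h) * w' r" for r
      using eig[of 1 r] eig[of "- 1" r] by (auto simp: w_def w'_def \<mu>_def algebra_simps)
    \<comment> \<open>For odd \<open>N\<close> the magnetization separates the two Neel states. The
      state \<open>w\<close>, built from the sector \<open>\<epsilon> = 1\<close>, therefore also
      has a nonzero vacuum coefficient for \<open>\<epsilon> = -1\<close>, and the gap property of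
      that sector identifies the two energies.\<close>
    have "ep - em < \<kappa>" using close \<kappa>(2) by linarith
    then have em: "em = ep"
      using sm[of w \<mu> 1] we(1) w by (simp add: bfa \<mu>_def)
    have low: "\<nu> + h * mag N r + g * (real N - 1) - ep < \<kappa> * max 1 (\<bar>mag N r\<bar> - 1)" if "\<nu> < \<mu> + 2 * g - 300 * \<bar>t\<bar>" for \<nu> r
      using thr(1)[OF odd_mag[OF True, of r]] that by (simp add: \<mu>_def \<kappa>_def)
    show ?thesis
    proof (rule that[OF we, where \<theta> = "\<mu> + 2 * g - 300 * \<bar>t\<bar>"])
      show "\<alpha> = 0 \<and> \<beta> = 0" if "\<forall>r<2 ^ N. \<alpha> * w r + \<beta> * w' r = 0" for \<alpha> \<beta>
        using spec[OF that, of a] spec[OF that, of b] ab w by simp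
      show "\<exists>\<alpha> \<beta>. (\<forall>r<2 ^ N. u r = \<alpha> * w r + \<beta> * w' r) \<and> (\<alpha> \<noteq> 0 \<longrightarrow> \<nu> = \<mu>) \<and> (\<beta> \<noteq> 0 \<longrightarrow> \<nu> = \<mu> + 2 * h)"
        if u: "\<forall>r<2 ^ N. chain_ham N (- g) h t u r = \<nu> * u r" and \<nu>: "\<nu> < \<mu> + 2 * g - 300 * \<bar>t\<bar>" for u \<nu>
      proof -
        have c: "u a \<noteq> 0 \<longrightarrow> \<nu> = \<mu>" "u b \<noteq> 0 \<longrightarrow> \<nu> = \<mu> + 2 * h"
        proof -
          have "\<nu> + h * 1 + g * (real N - 1) - ep < \<kappa> * max 1 (\<bar>1\<bar> - 1)"
            "\<nu> + h * (- 1) + g * (real N - 1) - ep < \<kappa> * max 1 (\<bar>- 1\<bar> - 1)"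
            using low[OF \<nu>, of a] low[OF \<nu>, of b] by (simp_all only: mag)
          note s = sp[OF u this(1), unfolded bfa] sp[OF u this(2), unfolded bfb]
          show "u a \<noteq> 0 \<longrightarrow> \<nu> = \<mu>" using s(1) unfolding \<mu>_def by linarith
          show "u b \<noteq> 0 \<longrightarrow> \<nu> = \<mu> + 2 * h" using s(2) unfolding \<mu>_def by force
        qed
        have low': "\<nu> + h * mag N r + g * (real N - 1) - min ep em < \<kappa> * max 1 (\<bar>mag N r\<bar> - 1)" for r
          using low[OF \<nu>, of r] em by simp
        show ?thesis
        proof (intro exI conjI)
          show "\<forall>r<2 ^ N. u r = u a * w r + u b * w' r" by (rule expand[OF u we low' c]) (simp_all add: w)
        qed (rule c)+
      qed
    qed (use True in auto)
  next
    case False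
    have mag: "mag N a = 0" "mag N b = 0" using neel_mag[OF ab(5)] neel_mag[OF ab(6)] False by auto
    have bf0: "coef (bond_fun N 0 \<epsilon> u) {} = u a + \<epsilon> * u b" for \<epsilon> u
    proof -
      have "{r\<in>{a, b}. mag N r = 0} = {a, b}" using mag by auto
      then show ?thesis unfolding bf using ab(8) by (simp add: ps)
    qed
    \<comment> \<open>For even \<open>N\<close> both Neel states have magnetization 0 and are told
      apart only by the spin flip. Each sector supplies one state, and \<open>close\<close> compares
      the two energies.\<close>
    define w where "w = chain_fun N 0 1 \<psi>p"
    define w' where "w' = chain_fun N 0 (- 1) \<psi>m"
    have w: "w a = 1" "w b = 1" "w' a = 1" "w' b = - 1"
      using mag ab ps \<psi>0 by (auto simp: w_def w'_def chain_fun_def)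
    define \<mu> where "\<mu> = ep - g * (real N - 1)"
    define \<mu>' where "\<mu>' = em - g * (real N - 1)"
    have we: "chain_ham N (- g) h t w r = \<mu> * w r" "chain_ham N (- g) h t w' r = \<mu>' * w' r" for r
      using eig[of 0 r] eig'[of 0 r] by (auto simp: w_def w'_def \<mu>_def \<mu>'_def)
    have min: "min \<mu> \<mu>' = min ep em - g * (real N - 1)" by (auto simp: \<mu>_def \<mu>'_def min_def)
    have low: "\<nu> + h * mag N r + g * (real N - 1) - min ep em < \<kappa> * max 1 (\<bar>mag N r\<bar> - 1)"
      if "\<nu> < min \<mu> \<mu>' + 2 * g - 2 * h - 300 * \<bar>t\<bar>" for \<nu> r
      using thr(2)[of "mag N r"] that unfolding min \<kappa>_def by linarith
    show ?thesis
    proof (rule that[OF we, where \<theta> = "min \<mu> \<mu>' + 2 * g - 2 * h - 300 * \<bar>t\<bar>"])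
      show "\<alpha> = 0 \<and> \<beta> = 0" if "\<forall>r<2 ^ N. \<alpha> * w r + \<beta> * w' r = 0" for \<alpha> \<beta>
        using spec[OF that, of a] spec[OF that, of b] ab w by simp
      show "\<exists>\<alpha> \<beta>. (\<forall>r<2 ^ N. u r = \<alpha> * w r + \<beta> * w' r) \<and> (\<alpha> \<noteq> 0 \<longrightarrow> \<nu> = \<mu>) \<and> (\<beta> \<noteq> 0 \<longrightarrow> \<nu> = \<mu>')"
        if u: "\<forall>r<2 ^ N. chain_ham N (- g) h t u r = \<nu> * u r" and \<nu>: "\<nu> < min \<mu> \<mu>' + 2 * g - 2 * h - 300 * \<bar>t\<bar>" for u \<nu>
      proof -
        have l: "\<nu> + h * 0 + g * (real N - 1) - min ep em < \<kappa> * max 1 (\<bar>0\<bar> - 1)" using low[OF \<nu>, of a] mag by simp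
        then have "\<nu> + h * 0 + g * (real N - 1) - ep < \<kappa> * max 1 (\<bar>0\<bar> - 1)"
          "\<nu> + h * 0 + g * (real N - 1) - em < \<kappa> * max 1 (\<bar>0\<bar> - 1)" by linarith+
        note s = sp[OF u this(1), unfolded bf0] sm[OF u this(2), unfolded bf0]
        have c: "(u a + u b) / 2 \<noteq> 0 \<longrightarrow> \<nu> = \<mu>" using s(1) unfolding \<mu>_def by force
        have c': "(u a - u b) / 2 \<noteq> 0 \<longrightarrow> \<nu> = \<mu>'" using s(2) unfolding \<mu>'_def by force
        show ?thesis
        proof (intro exI conjI)
          show "\<forall>r<2 ^ N. u r = (u a + u b) / 2 * w r + (u a - u b) / 2 * w' r"
            by (rule expand[OF u we low[OF \<nu>] c c']) (simp_all add: w field_simps)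
        qed (rule c c')+
      qed
      show "even N \<Longrightarrow> \<bar>\<mu>' - \<mu>\<bar> \<le> 100 * \<bar>t\<bar> \<and>
          min \<mu> \<mu>' + 2 * g - 2 * h - 300 * \<bar>t\<bar> = min \<mu> \<mu>' + 2 * g - 2 * h - 300 * \<bar>t\<bar>"
        using close by (simp add: \<mu>_def \<mu>'_def)
    qed (use False in auto)
  qed
qed

section \<open>The ferromagnetic chain\<close>

definition single :: "nat \<Rightarrow> nat \<Rightarrow> real" where
  "single a r = (if r = a then 1 else 0)"

lemma not_ferro_swap:
  assumes "i \<in> {1..<N}" shows "i \<in> ferro N (swap N i r) \<longleftrightarrow> i \<in> ferro N r"
  unfolding ferro_swap[OF assms] using assms by (auto simp: mem_toggle)

lemma chain_ham_single:
  assumes "ferro N a = {1..<N}"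
  shows "chain_ham N J h t (single a) r = ising N J h a * single a r"
proof -
  have "(if i \<in> ferro N r then 0 else single a (swap N i r)) = 0" if i: "i \<in> {1..<N}" for i
  proof (cases "i \<in> ferro N r")
    case False
    then have "swap N i r \<noteq> a" using not_ferro_swap[OF i, of r] assms i by metis
    then show ?thesis by (simp add: single_def)
  qed simp
  then have "(\<Sum>i\<in>{1..<N}. if i \<in> ferro N r then 0 else single a (swap N i r)) = 0"
    by (intro sum.neutral) blast
  then show ?thesis by (simp add: chain_ham_def single_def)
qed

lemma all_up: "spin N 0 j = 1" "ferro N 0 = {1..<N}" "mag N 0 = N"
  by (auto simp: spin_def ferro_def mag_def)

lemma ex_all_down:
  assumes "1 \<le> N"
  obtains b where "b < 2 ^ N" "spin N b 1 = - 1" "ferro N b = {1..<N}" "mag N b = - real N"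
proof -
  obtain b where b: "b < 2 ^ N" "\<And>j. 1 \<le> j \<Longrightarrow> j \<le> N \<Longrightarrow> spin N b j = - 1"
    using ex_config[of N "\<lambda>_. False"] by auto
  then have "ferro N b = {1..<N}" "mag N b = - real N" "spin N b 1 = - 1"
    using assms by (auto simp: ferro_def mag_def)
  then show ?thesis using that b by blast
qed

lemma ising_excitation:
  assumes "1 \<le> N"
  shows "ising N J h r = ising N J h 0 + 2 * J * card ({1..<N} - ferro N r) + h * (real N - mag N r)"
proof -
  have "card ({1..<N} - ferro N r) = card {1..<N} - card (ferro N r)"
    using ferro_subset by (intro card_Diff_subset) auto
  moreover have "card (ferro N r) \<le> card {1..<N}" using ferro_subset by (intro card_mono) auto
  ultimately have e: "real (card (ferro N r)) = real N - 1 - card ({1..<N} - ferro N r)"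
    using assms by (simp add: of_nat_diff)
  show ?thesis unfolding ising_def sum_spin_spin[OF assms] all_up(3) e
    using assms by (simp add: all_up(2) of_nat_diff algebra_simps)
qed

lemma excited_config:
  assumes N: "1 \<le> N" and r: "r < 2 ^ N" "r \<noteq> 0"
  shows "mag N r \<le> real N - 2" and "ferro N r = {1..<N} \<Longrightarrow> mag N r = - real N"
proof -
  have "\<exists>j. 1 \<le> j \<and> j \<le> N \<and> spin N r j \<noteq> 1"
    using spin_ext[of r N 0] r by (auto simp: all_up(1))
  then obtain j where "j \<in> {j\<in>{1..N}. spin N r j = - 1}" using spin_cases by force
  then have "0 < card {j\<in>{1..N}. spin N r j = - 1}" by (auto simp: card_gt_0_iff)
  then show "mag N r \<le> real N - 2" unfolding mag_eq by simp
  assume f: "ferro N r = {1..<N}"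
  obtain b where b: "b < 2 ^ N" "spin N b 1 = - 1" "ferro N b = {1..<N}" "mag N b = - real N"
    using ex_all_down[OF N] by blast
  have "spin N r 1 \<noteq> 1" using config_eqI[of r N 0] r f by (auto simp: all_up)
  then have "spin N r 1 = spin N b 1" using b(2) spin_cases[of N r 1] by auto
  then have "r = b" using config_eqI[OF r(1) b(1)] f b(3) by simp
  then show "mag N r = - real N" using b by simp
qed

theorem ferromagnetic_low_states:
  assumes N: "1 \<le> N" "J / h + 3 / 2 < real N" and J: "0 < J" and h: "0 < h" and t: "\<bar>t\<bar> < J"
    and u: "\<forall>r<2 ^ N. chain_ham N J h t u r = \<nu> * u r"
    and \<nu>: "\<nu> < ising N J h 0 + 2 * J + 2 * h - \<bar>t\<bar>"
  shows "\<forall>r<2 ^ N. u r = u 0 * single 0 r" and "u 0 \<noteq> 0 \<Longrightarrow> \<nu> = ising N J h 0"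
proof -
  let ?k = "\<lambda>r. real (card ({1..<N} - ferro N r))"
  \<comment> \<open>Passing from rows to columns: \<open>swap N i\<close> is an involution that does
    not change whether bond \<open>i\<close> is ferromagnetic.\<close>
  have swap_sum: "(\<Sum>r<2 ^ N. if i \<in> ferro N r then 0 else \<bar>u (swap N i r)\<bar>) =
      (\<Sum>r<2 ^ N. if i \<in> ferro N r then 0 else \<bar>u r\<bar>)" if i: "i \<in> {1..<N}" for i
    using i not_ferro_swap[OF i]
    by (intro sum.reindex_bij_witness[of _ "swap N i" "swap N i"]) (auto simp: swap_swap swap_less)
  have "(\<Sum>r<2 ^ N. \<bar>\<nu> - ising N J h r\<bar> * \<bar>u r\<bar>) \<le>
      (\<Sum>r<2 ^ N. \<bar>t\<bar> * (\<Sum>i\<in>{1..<N}. if i \<in> ferro N r then 0 else \<bar>u (swap N i r)\<bar>))"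
  proof (rule sum_mono)
    fix r assume "r \<in> {..<2 ^ N :: nat}"
    then have "(\<nu> - ising N J h r) * u r = t * (\<Sum>i\<in>{1..<N}. if i \<in> ferro N r then 0 else u (swap N i r))"
      using u by (simp add: chain_ham_def algebra_simps)
    then have "\<bar>\<nu> - ising N J h r\<bar> * \<bar>u r\<bar> = \<bar>t\<bar> * \<bar>\<Sum>i\<in>{1..<N}. if i \<in> ferro N r then 0 else u (swap N i r)\<bar>"
      by (metis abs_mult)
    also have "\<dots> \<le> \<bar>t\<bar> * (\<Sum>i\<in>{1..<N}. \<bar>if i \<in> ferro N r then 0 else u (swap N i r)\<bar>)"
      by (intro mult_left_mono sum_abs) auto
    also have "(\<Sum>i\<in>{1..<N}. \<bar>if i \<in> ferro N r then 0 else u (swap N i r)\<bar>) =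
        (\<Sum>i\<in>{1..<N}. if i \<in> ferro N r then 0 else \<bar>u (swap N i r)\<bar>)"
      by (intro sum.cong) auto
    finally show "\<bar>\<nu> - ising N J h r\<bar> * \<bar>u r\<bar> \<le>
        \<bar>t\<bar> * (\<Sum>i\<in>{1..<N}. if i \<in> ferro N r then 0 else \<bar>u (swap N i r)\<bar>)" .
  qed
  also have "\<dots> = \<bar>t\<bar> * (\<Sum>i\<in>{1..<N}. \<Sum>r<2 ^ N. if i \<in> ferro N r then 0 else \<bar>u (swap N i r)\<bar>)"
    unfolding sum_distrib_left[symmetric] by (subst sum.swap) simp
  also have "(\<Sum>i\<in>{1..<N}. \<Sum>r<2 ^ N. if i \<in> ferro N r then 0 else \<bar>u (swap N i r)\<bar>) =
      (\<Sum>i\<in>{1..<N}. \<Sum>r<2 ^ N. if i \<in> ferro N r then 0 else \<bar>u r\<bar>)"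
    by (rule sum.cong[OF refl swap_sum])
  also have "\<dots> = (\<Sum>r<2 ^ N. \<Sum>i\<in>{1..<N}. if i \<in> ferro N r then 0 else \<bar>u r\<bar>)"
    by (rule sum.swap)
  also have "\<dots> = (\<Sum>r<2 ^ N. ?k r * \<bar>u r\<bar>)"
  proof (rule sum.cong[OF refl])
    fix r
    have "(\<Sum>i\<in>{1..<N}. if i \<in> ferro N r then 0 else \<bar>u r\<bar>) = (\<Sum>i\<in>{1..<N} - ferro N r. \<bar>u r\<bar>)"
      by (intro sum.mono_neutral_cong_right) auto
    then show "(\<Sum>i\<in>{1..<N}. if i \<in> ferro N r then 0 else \<bar>u r\<bar>) = ?k r * \<bar>u r\<bar>" by simp
  qed
  finally have le: "(\<Sum>r<2 ^ N. (\<bar>\<nu> - ising N J h r\<bar> - \<bar>t\<bar> * ?k r) * \<bar>u r\<bar>) \<le> 0"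
    by (simp add: left_diff_distrib sum_subtractf sum_distrib_left mult.assoc)
  have pos: "0 < \<bar>\<nu> - ising N J h r\<bar> - \<bar>t\<bar> * ?k r" if r: "r < 2 ^ N" "r \<noteq> 0" for r
  proof (cases "ferro N r = {1..<N}")
    case True
    \<comment> \<open>The configuration with all spins down has no kink, so only its field energy
      \<open>2 * h * N\<close> keeps it above the window. This is where the lower bound on
      \<open>N\<close> enters.\<close>
    have "J + 3 / 2 * h < h * real N" using N(2) h by (simp add: field_simps)
    then have "2 * J + 2 * h < h * (real N - mag N r)"
      unfolding excited_config(2)[OF N(1) r True] using h by (simp add: algebra_simps)
    then show ?thesis using \<nu> True unfolding ising_excitation[OF N(1), of J h r] by simp
  next
    case False
    then have "{1..<N} - ferro N r \<noteq> {}" using ferro_subset by blast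
    then have k: "1 \<le> ?k r" by (simp add: Suc_le_eq card_gt_0_iff)
    have "h * 2 \<le> h * (real N - mag N r)" using excited_config(1)[OF N(1) r] h by (intro mult_left_mono) auto
    \<comment> \<open>A kink costs \<open>2 * J\<close> and adds \<open>\<bar>t\<bar>\<close> to the
      column sum. Since \<open>2 * J - \<bar>t\<bar>\<close> is positive, a single kink is the worst
      case.\<close>
    moreover have "(2 * J - \<bar>t\<bar>) * 1 \<le> (2 * J - \<bar>t\<bar>) * ?k r" using k t J by (intro mult_left_mono) auto
    then have "2 * J - \<bar>t\<bar> \<le> 2 * J * ?k r - \<bar>t\<bar> * ?k r" by (simp add: left_diff_distrib)
    ultimately show ?thesis using \<nu> unfolding ising_excitation[OF N(1), of J h r] by linarith
  qed
  have k0: "?k 0 = 0" by (simp add: all_up)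
  have each: "0 \<le> (\<bar>\<nu> - ising N J h r\<bar> - \<bar>t\<bar> * ?k r) * \<bar>u r\<bar>" if "r \<in> {..<2 ^ N}" for r
  proof (cases "r = 0")
    case False
    then show ?thesis using pos[of r] that by (intro mult_nonneg_nonneg) auto
  qed (simp add: all_up)
  have zero: "(\<bar>\<nu> - ising N J h r\<bar> - \<bar>t\<bar> * ?k r) * \<bar>u r\<bar> = 0" if "r < 2 ^ N" for r
  proof -
    have "(\<Sum>r<2 ^ N. (\<bar>\<nu> - ising N J h r\<bar> - \<bar>t\<bar> * ?k r) * \<bar>u r\<bar>) = 0"
      using le sum_nonneg[of "{..<2 ^ N}", OF each] by (rule order.antisym)
    from iffD1[OF sum_nonneg_eq_0_iff[OF finite_lessThan each] this]
    show ?thesis using that by blast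
  qed
  show "\<forall>r<2 ^ N. u r = u 0 * single 0 r"
  proof (intro allI impI)
    fix r :: nat assume r: "r < 2 ^ N"
    show "u r = u 0 * single 0 r"
    proof (cases "r = 0")
      case False
      then have "u r = 0" using zero[OF r] pos[OF r False] by simp
      then show ?thesis using False by (simp add: single_def)
    qed (simp add: single_def)
  qed
  show "\<nu> = ising N J h 0" if "u 0 \<noteq> 0" using zero[of 0] that by (simp add: all_up)
qed

section \<open>Dimensions and spectral projections\<close>

lemma dim_span_indpt:
  fixes S :: "'a::field vec set"
  assumes "S \<subseteq> carrier_vec n" "finite S"
    and "\<not> LinearCombinations.module.lin_dep class_ring (module_vec TYPE('a) n) S"
  shows "vectorspace.dim class_ring (module_vec TYPE('a) n
    \<lparr>carrier := LinearCombinations.module.span class_ring (module_vec TYPE('a) n) S\<rparr>) = card S"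
proof -
  interpret vec_space "TYPE('a)" n .
  show ?thesis using assms by (intro dim_span[of S S]) (auto simp: maximal_def)
qed

context vec_space
begin

lemma lincomb_single: "w \<in> carrier_vec n \<Longrightarrow> lincomb a {w} = a w \<cdot>\<^sub>v w"
  by (rule eq_vecI) (simp_all add: lincomb_index lincomb_dim)

lemma lincomb_pair:
  assumes "w \<in> carrier_vec n" "w' \<in> carrier_vec n" "w \<noteq> w'"
  shows "lincomb a {w, w'} = a w \<cdot>\<^sub>v w + a w' \<cdot>\<^sub>v w'"
  by (rule eq_vecI) (use assms in \<open>simp_all add: lincomb_index lincomb_dim\<close>)

lemma span_single: "w \<in> carrier_vec n \<Longrightarrow> span {w} = {c \<cdot>\<^sub>v w | c. True}"
  by (auto simp: finite_span lincomb_single)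

lemma span_pair:
  assumes w: "w \<in> carrier_vec n" "w' \<in> carrier_vec n" "w \<noteq> w'"
  shows "span {w, w'} = {\<alpha> \<cdot>\<^sub>v w + \<beta> \<cdot>\<^sub>v w' | \<alpha> \<beta>. True}"
proof -
  have "\<exists>a. lincomb a {w, w'} = \<alpha> \<cdot>\<^sub>v w + \<beta> \<cdot>\<^sub>v w'" for \<alpha> \<beta>
    using lincomb_pair[OF w, of "\<lambda>v. if v = w then \<alpha> else \<beta>"] w(3) by (intro exI) auto
  then show ?thesis using w by (auto simp: finite_span lincomb_pair) metis
qed

lemma lin_indpt_single:
  assumes w: "w \<in> carrier_vec n" "w \<noteq> 0\<^sub>v n"
  shows "lin_indpt {w}"
proof (rule finite_lin_indpt2)
  fix a assume "lincomb a {w} = 0\<^sub>v n"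
  then have z: "a w \<cdot>\<^sub>v w = 0\<^sub>v n" using w by (simp add: lincomb_single)
  obtain i where i: "i < n" "w $ i \<noteq> 0" using w by (metis carrier_vecD eq_vecI index_zero_vec)
  then have "a w * w $ i = 0" using arg_cong[OF z, of "\<lambda>v. v $ i"] w by simp
  then show "\<forall>v\<in>{w}. a v = 0" using i by simp
qed (use w in auto)

lemma lin_indpt_pair:
  assumes w: "w \<in> carrier_vec n" "w' \<in> carrier_vec n" "w \<noteq> w'"
    and indep: "\<And>\<alpha> \<beta>. \<alpha> \<cdot>\<^sub>v w + \<beta> \<cdot>\<^sub>v w' = 0\<^sub>v n \<Longrightarrow> \<alpha> = 0 \<and> \<beta> = 0"
  shows "lin_indpt {w, w'}"
proof (rule finite_lin_indpt2)
  fix a assume "lincomb a {w, w'} = 0\<^sub>v n"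
  then have "a w \<cdot>\<^sub>v w + a w' \<cdot>\<^sub>v w' = 0\<^sub>v n" using lincomb_pair[OF w, of a] by simp
  then show "\<forall>v\<in>{w, w'}. a v = 0" using indep by auto
qed (use w in auto)

end

lemma kernel_dim_one:
  fixes A :: "complex mat"
  assumes A: "A \<in> carrier_mat n n" and w: "w \<in> carrier_vec n" "w \<noteq> 0\<^sub>v n"
    and ker: "mat_kernel A = {c \<cdot>\<^sub>v w | c. True}"
  shows "kernel_dim A = 1"
proof -
  interpret kernel n n A by unfold_locales (fact A)
  have "kernel_dim A = vectorspace.dim class_ring (NC.V\<lparr>carrier := NC.span {w}\<rparr>)"
    using ker NC.span_single[OF w(1)] by simp
  also have "\<dots> = card {w}"
    using w NC.lin_indpt_single[OF w] by (intro dim_span_indpt) auto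
  finally show ?thesis by simp
qed

text \<open>The range of the projection is both its column space and the spectral subspace, which is
  spanned by \<open>w\<close> and \<open>w'\<close>. The eigenvalues of \<open>w\<close> and
  \<open>w'\<close> may coincide, so multiplicity is counted correctly.\<close>

lemma mat_rank_spectral_projection:
  assumes A: "A \<in> carrier_mat n n" and w: "w \<in> carrier_vec n" "w' \<in> carrier_vec n"
    and indep: "\<And>\<alpha> \<beta>. \<alpha> \<cdot>\<^sub>v w + \<beta> \<cdot>\<^sub>v w' = 0\<^sub>v n \<Longrightarrow> \<alpha> = 0 \<and> \<beta> = 0"
    and eig: "\<exists>x\<in>S. eigenvector A w (complex_of_real x)" "\<exists>x\<in>S. eigenvector A w' (complex_of_real x)"
    and low: "\<And>x v. x \<in> S \<Longrightarrow> eigenvector A v (complex_of_real x) \<Longrightarrow> \<exists>\<alpha> \<beta>. v = \<alpha> \<cdot>\<^sub>v w + \<beta> \<cdot>\<^sub>v w'"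
  shows "mat_rank (spectral_projection A S) = 2"
proof -
  interpret vec_space "TYPE(complex)" n .
  define P where "P = spectral_projection A S"
  have ne: "w \<noteq> w'"
  proof
    assume "w = w'"
    then have "1 \<cdot>\<^sub>v w + (- 1) \<cdot>\<^sub>v w' = 0\<^sub>v n" using w by (intro eq_vecI) auto
    from indep[OF this] show False by simp
  qed
  have P: "P \<in> carrier_mat n n" "{P *\<^sub>v v | v. v \<in> carrier_vec n} = spectral_subspace A S"
    using spectral_projection_onto[OF A, of S] by (auto simp: P_def orthogonal_projection_onto_def)
  let ?U = "{v. \<exists>x\<in>S. eigenvector A v (complex_of_real x)}"
  have U: "?U \<subseteq> carrier_vec n" using A by (auto simp: eigenvector_def)
  have wc: "{w, w'} \<subseteq> carrier_vec n" using w by simp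
  have "spectral_subspace A S = span ?U" using A by (auto simp: spectral_subspace_def)
  also have "\<dots> = span {w, w'}"
  proof
    have "?U \<subseteq> span {w, w'}" using low span_pair[OF w ne] by auto
    then show "span ?U \<subseteq> span {w, w'}" using span_is_subset[OF _ span_is_submodule[OF wc]] by simp
    show "span {w, w'} \<subseteq> span ?U" using eig by (intro span_is_monotone) auto
  qed
  finally have sub: "spectral_subspace A S = span {w, w'}" .
  have "col_space P = {y \<in> carrier_vec n. \<exists>x\<in>carrier_vec n. P *\<^sub>v x = y}"
    using col_space_eq[OF P(1)] P(1) by simp
  also have "\<dots> = {P *\<^sub>v v | v. v \<in> carrier_vec n}" using P(1) by auto
  finally have "span (set (cols P)) = span {w, w'}" unfolding col_space_def P(2) sub .
  moreover have "dim_row P = n" using P by simp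
  ultimately have "mat_rank P = vectorspace.dim class_ring (V\<lparr>carrier := span {w, w'}\<rparr>)"
    by (simp add: mat_rank_def rank_def)
  also have "\<dots> = card {w, w'}"
    using w lin_indpt_pair[OF w ne indep] by (intro dim_span_indpt) auto
  finally show ?thesis using ne by (simp add: P_def)
qed

lemma real_spectrumI: "eigenvector A v (complex_of_real x) \<Longrightarrow> x \<in> real_spectrum A"
  by (auto simp: real_spectrum_def spectrum_def eigenvalue_def)

lemma real_spectrumE:
  assumes "x \<in> real_spectrum A" obtains v where "eigenvector A v (complex_of_real x)"
  using assms by (auto simp: real_spectrum_def spectrum_def eigenvalue_def)

lemma finite_real_spectrum:
  assumes "A \<in> carrier_mat n n" shows "finite (real_spectrum A)"
  using finite_vimageI[OF card_finite_spectrum(1)[OF assms], of complex_of_real]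
  by (simp add: real_spectrum_def vimage_def inj_on_def)

lemma ground_energyI:
  assumes "A \<in> carrier_mat n n" "x \<in> real_spectrum A" "\<And>y. y \<in> real_spectrum A \<Longrightarrow> x \<le> y"
  shows "ground_energy A = x"
  unfolding ground_energy_def using assms finite_real_spectrum by (intro Min_eqI) auto

section \<open>Action of the Hamiltonian in the product basis\<close>

text \<open>The identity factors to the left and right of a site see the bits above and below
  position \<open>m\<close>, so a one-site operator connects only indices that agree at all other
  bits.\<close>

lemma bits_agree_iff:
  fixes r c :: nat
  shows "r div 2 ^ m div 2 = c div 2 ^ m div 2 \<and> r mod 2 ^ m = c mod 2 ^ m \<longleftrightarrow>
    c = r \<or> c = flip_bit m r"
proof -
  have "r div 2 ^ m div 2 = c div 2 ^ m div 2 \<longleftrightarrow> drop_bit (Suc m) r = drop_bit (Suc m) c"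
    unfolding drop_bit_eq_div power_Suc2 div_mult2_eq ..
  also have "\<dots> \<longleftrightarrow> (\<forall>n>m. bit r n = bit c n)"
  proof
    assume "drop_bit (Suc m) r = drop_bit (Suc m) c"
    then have "bit (drop_bit (Suc m) r) k = bit (drop_bit (Suc m) c) k" for k by simp
    then have *: "bit r (Suc m + k) = bit c (Suc m + k)" for k unfolding bit_drop_bit_eq by simp
    show "\<forall>n>m. bit r n = bit c n"
    proof (intro allI impI)
      fix n assume "n > m"
      then have "n = Suc m + (n - Suc m)" by simp
      then show "bit r n = bit c n" using *[of "n - Suc m"] by simp
    qed
  next
    assume "\<forall>n>m. bit r n = bit c n"
    then show "drop_bit (Suc m) r = drop_bit (Suc m) c" by (intro bit_eqI) (simp add: bit_drop_bit_eq)
  qed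
  finally have d: "r div 2 ^ m div 2 = c div 2 ^ m div 2 \<longleftrightarrow> (\<forall>n>m. bit r n = bit c n)" .
  have "r mod 2 ^ m = c mod 2 ^ m \<longleftrightarrow> take_bit m r = take_bit m c"
    by (simp add: take_bit_eq_mod)
  also have "\<dots> \<longleftrightarrow> (\<forall>n<m. bit r n = bit c n)"
  proof
    assume "take_bit m r = take_bit m c"
    then have "bit (take_bit m r) k = bit (take_bit m c) k" for k by simp
    then show "\<forall>n<m. bit r n = bit c n" unfolding bit_take_bit_iff by blast
  next
    assume "\<forall>n<m. bit r n = bit c n"
    then show "take_bit m r = take_bit m c" by (intro bit_eqI) (auto simp: bit_take_bit_iff)
  qed
  finally have e: "r mod 2 ^ m = c mod 2 ^ m \<longleftrightarrow> (\<forall>n<m. bit r n = bit c n)" .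
  show ?thesis
  proof
    assume "r div 2 ^ m div 2 = c div 2 ^ m div 2 \<and> r mod 2 ^ m = c mod 2 ^ m"
    then have *: "bit r n = bit c n" if "n \<noteq> m" for n
      using that d e by (cases "n < m") auto
    show "c = r \<or> c = flip_bit m r"
    proof (cases "bit r m = bit c m")
      case True
      then have "c = r" using * by (intro bit_eqI) metis
      then show ?thesis ..
    next
      case False
      have "c = flip_bit m r"
      proof (rule bit_eqI)
        fix n show "bit c n = bit (flip_bit m r) n"
          using *[of n] False by (cases "n = m") (simp_all add: bit_flip_bit_iff)
      qed
      then show ?thesis ..
    qed
  next
    assume "c = r \<or> c = flip_bit m r"
    then have "bit r n = bit c n" if "n \<noteq> m" for n using that by (auto simp: bit_flip_bit_iff)
    then show "r div 2 ^ m div 2 = c div 2 ^ m div 2 \<and> r mod 2 ^ m = c mod 2 ^ m"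
      unfolding d e by simp
  qed
qed

lemma flip_bit_less: "r < 2 ^ N \<Longrightarrow> m < N \<Longrightarrow> flip_bit m (r::nat) < 2 ^ N"
  unfolding less_exp_iff_bit by (simp add: bit_flip_bit_iff)

lemma div_mod_bit: "(r::nat) div 2 ^ m mod 2 = of_bool (bit r m)"
  by (simp add: bit_iff_odd mod_2_eq_odd)

lemma site_op_index:
  assumes A: "A \<in> carrier_mat 2 2" and j: "1 \<le> j" "j \<le> N" and rc: "r < 2 ^ N" "c < 2 ^ N"
  shows "site_op N A j $$ (r, c) = (if c = r \<or> c = flip_bit (N - j) r
    then A $$ (of_bool (bit r (N - j)), of_bool (bit c (N - j))) else 0)"
proof -
  define m where "m = N - j"
  have "(2::nat) ^ (j - 1) * 2 * 2 ^ m = 2 ^ (j - 1 + 1 + m)" by (simp add: power_add)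
  also have "j - 1 + 1 + m = N" using j by (simp add: m_def)
  finally have e: "(2::nat) ^ (j - 1) * 2 * 2 ^ m = 2 ^ N" .
  have rc': "r < 2 ^ (j - 1) * 2 * 2 ^ m" "c < 2 ^ (j - 1) * 2 * 2 ^ m" using rc e by simp_all
  note b = div_mod_less[OF rc'(1)] div_mod_less[OF rc'(2)]
  note b' = div_mod_less[OF b(1)] div_mod_less[OF b(3)]
  have K: "kron (1\<^sub>m (2 ^ (j - 1))) A \<in> carrier_mat (2 ^ (j - 1) * 2) (2 ^ (j - 1) * 2)"
    using A by (intro kron_carrier) auto
  have "site_op N A j $$ (r, c) = (if r div 2 ^ m div 2 = c div 2 ^ m div 2 then 1 else 0) *
      A $$ (r div 2 ^ m mod 2, c div 2 ^ m mod 2) * (if r mod 2 ^ m = c mod 2 ^ m then 1 else 0)"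
    unfolding site_op_def m_def[symmetric]
    by (subst kron_index[OF K one_carrier_mat rc'], subst kron_index[OF one_carrier_mat A b(1,3)])
       (use b b' in simp)
  also have "\<dots> = (if c = r \<or> c = flip_bit m r then A $$ (of_bool (bit r m), of_bool (bit c m)) else 0)"
    unfolding bits_agree_iff[symmetric, of c r m] div_mod_bit by simp
  finally show ?thesis by (simp add: m_def)
qed

lemma site_op_mult_vec:
  assumes A: "A \<in> carrier_mat 2 2" and j: "1 \<le> j" "j \<le> N" and v: "v \<in> carrier_vec (2 ^ N)" and r: "r < 2 ^ N"
  defines "b \<equiv> of_bool (bit r (N - j)) :: nat"
  shows "(site_op N A j *\<^sub>v v) $ r = A $$ (b, b) * v $ r + A $$ (b, 1 - b) * v $ (flip_bit (N - j) r)"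
proof -
  define m where "m = N - j"
  have m: "m < N" using j by (simp add: m_def)
  have ne: "r \<noteq> flip_bit m r"
  proof
    assume "r = flip_bit m r"
    then have "bit r m = bit (flip_bit m r) m" by simp
    then show False by (simp add: bit_flip_bit_iff)
  qed
  have fl: "flip_bit m r < 2 ^ N" using flip_bit_less r m by blast
  have "(site_op N A j *\<^sub>v v) $ r = (\<Sum>c = 0..<2 ^ N. site_op N A j $$ (r, c) * v $ c)"
    using site_op_carrier[OF A j] v r by (simp add: scalar_prod_def)
  also have "\<dots> = (\<Sum>c\<in>{r, flip_bit m r}. site_op N A j $$ (r, c) * v $ c)"
    using r fl site_op_index[OF A j r] by (intro sum.mono_neutral_right) (auto simp: m_def)
  also have "\<dots> = site_op N A j $$ (r, r) * v $ r + site_op N A j $$ (r, flip_bit m r) * v $ flip_bit m r"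
    using ne by simp
  also have "site_op N A j $$ (r, r) = A $$ (b, b)"
    using site_op_index[OF A j r r] by (simp add: b_def)
  also have "site_op N A j $$ (r, flip_bit m r) = A $$ (b, 1 - b)"
    using site_op_index[OF A j r fl] by (simp add: b_def m_def bit_flip_bit_iff)
  finally show ?thesis by (simp add: m_def)
qed

lemma sigma_index:
  "sigma_x $$ (0, 0) = 0" "sigma_x $$ (0, 1) = 1" "sigma_x $$ (1, 0) = 1" "sigma_x $$ (1, 1) = 0"
  "sigma_y $$ (0, 0) = 0" "sigma_y $$ (0, 1) = - \<i>" "sigma_y $$ (1, 0) = \<i>" "sigma_y $$ (1, 1) = 0"
  "sigma_z $$ (0, 0) = 1" "sigma_z $$ (0, 1) = 0" "sigma_z $$ (1, 0) = 0" "sigma_z $$ (1, 1) = - 1"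
  by (simp_all add: sigma_x_def sigma_y_def sigma_z_def mat_of_rows_list_def)

lemma sigma_mult_vec:
  assumes "1 \<le> j" "j \<le> N" "v \<in> carrier_vec (2 ^ N)" "r < 2 ^ N"
  shows "(site_op N sigma_x j *\<^sub>v v) $ r = v $ (flip_bit (N - j) r)"
    and "(site_op N sigma_y j *\<^sub>v v) $ r = - \<i> * complex_of_real (spin N r j) * v $ (flip_bit (N - j) r)"
    and "(site_op N sigma_z j *\<^sub>v v) $ r = complex_of_real (spin N r j) * v $ r"
  unfolding site_op_mult_vec[OF sigma_carrier(1) assms] site_op_mult_vec[OF sigma_carrier(2) assms]
    site_op_mult_vec[OF sigma_carrier(3) assms]
  by (cases "bit r (N - j)"; simp add: sigma_index[simplified] spin_def)+

lemma finsum_mat_mult_vec: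
  assumes "finite I" "\<And>i. i \<in> I \<Longrightarrow> f i \<in> carrier_mat n n" "v \<in> carrier_vec n" "r < n"
  shows "(\<Oplus>\<^bsub>module_mat TYPE(complex) n n\<^esub> i\<in>I. f i) \<in> carrier_mat n n"
    and "((\<Oplus>\<^bsub>module_mat TYPE(complex) n n\<^esub> i\<in>I. f i) *\<^sub>v v) $ r = (\<Sum>i\<in>I. (f i *\<^sub>v v) $ r)"
proof -
  interpret M: matrix_vs n n "TYPE(complex)" .
  have "(\<Oplus>\<^bsub>module_mat TYPE(complex) n n\<^esub> i\<in>I. f i) \<in> carrier_mat n n \<and>
      ((\<Oplus>\<^bsub>module_mat TYPE(complex) n n\<^esub> i\<in>I. f i) *\<^sub>v v) $ r = (\<Sum>i\<in>I. (f i *\<^sub>v v) $ r)"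
    using assms(1,2)
  proof (induction I rule: finite_induct)
    case empty
    then show ?case using assms(3,4) by (simp add: module_mat_simps)
  next
    case (insert x F)
    then have "f \<in> F \<rightarrow> carrier_mat n n" "f x \<in> carrier_mat n n" by auto
    from M.finsum_insert[OF insert(1,2) this]
    have e: "(\<Oplus>\<^bsub>module_mat TYPE(complex) n n\<^esub> i\<in>insert x F. f i) =
        f x + (\<Oplus>\<^bsub>module_mat TYPE(complex) n n\<^esub> i\<in>F. f i)" by simp
    have IH: "(\<Oplus>\<^bsub>module_mat TYPE(complex) n n\<^esub> i\<in>F. f i) \<in> carrier_mat n n"
      "((\<Oplus>\<^bsub>module_mat TYPE(complex) n n\<^esub> i\<in>F. f i) *\<^sub>v v) $ r = (\<Sum>i\<in>F. (f i *\<^sub>v v) $ r)"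
      using insert by auto
    have "(f x + (\<Oplus>\<^bsub>module_mat TYPE(complex) n n\<^esub> i\<in>F. f i)) *\<^sub>v v =
        f x *\<^sub>v v + (\<Oplus>\<^bsub>module_mat TYPE(complex) n n\<^esub> i\<in>F. f i) *\<^sub>v v"
      by (rule add_mult_distrib_mat_vec[OF \<open>f x \<in> carrier_mat n n\<close> IH(1) assms(3)])
    moreover have "dim_vec ((\<Oplus>\<^bsub>module_mat TYPE(complex) n n\<^esub> i\<in>F. f i) *\<^sub>v v) = n" using IH(1) by simp
    ultimately show ?case unfolding e using insert(1,2) IH \<open>f x \<in> carrier_mat n n\<close> assms(4)
      by (simp del: index_mult_mat_vec)
  qed
  then show "(\<Oplus>\<^bsub>module_mat TYPE(complex) n n\<^esub> i\<in>I. f i) \<in> carrier_mat n n"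
    "((\<Oplus>\<^bsub>module_mat TYPE(complex) n n\<^esub> i\<in>I. f i) *\<^sub>v v) $ r = (\<Sum>i\<in>I. (f i *\<^sub>v v) $ r)" by blast+
qed

lemma flip_flip_swap: "flip_bit (N - (i + 1)) (flip_bit (N - i) r) = swap N i r"
  unfolding swap_def by (rule bit_eqI) (auto simp: bit_flip_bit_iff)

text \<open>The two factors \<open>- \<i>\<close> of the y-terms multiply to -1, so xx plus yy has
  amplitude \<open>1 - spin N r i * spin N r (i + 1)\<close>: 0 on parallel and 2 on antiparallel
  neighbours. The 2 cancels against the prefactor \<open>t / 2\<close>.\<close>

lemma bond_mult_vec:
  assumes i: "i \<in> {1..<N}" and v: "v \<in> carrier_vec (2 ^ N)" and r: "r < 2 ^ N"
  shows "((site_op N sigma_z i * site_op N sigma_z (i + 1)) *\<^sub>v v) $ r =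
      complex_of_real (spin N r i * spin N r (i + 1)) * v $ r"
    and "((site_op N sigma_x i * site_op N sigma_x (i + 1) + site_op N sigma_y i * site_op N sigma_y (i + 1)) *\<^sub>v v) $ r =
      complex_of_real (1 - spin N r i * spin N r (i + 1)) * v $ (swap N i r)"
proof -
  have ij: "1 \<le> i" "i \<le> N" "1 \<le> i + 1" "i + 1 \<le> N" using i by auto
  have c: "site_op N A i \<in> carrier_mat (2 ^ N) (2 ^ N)" "site_op N A (i + 1) \<in> carrier_mat (2 ^ N) (2 ^ N)"
    if "A \<in> carrier_mat 2 2" for A using that site_op_carrier ij by blast+
  have prod: "((site_op N A i * site_op N A (i + 1)) *\<^sub>v v) = site_op N A i *\<^sub>v (site_op N A (i + 1) *\<^sub>v v)"
    and vc: "site_op N A (i + 1) *\<^sub>v v \<in> carrier_vec (2 ^ N)" if "A \<in> carrier_mat 2 2" for A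
    using c[OF that] v by auto
  have fl: "flip_bit (N - i) r < 2 ^ N" using flip_bit_less[OF r] i by simp
  show "((site_op N sigma_z i * site_op N sigma_z (i + 1)) *\<^sub>v v) $ r =
      complex_of_real (spin N r i * spin N r (i + 1)) * v $ r"
    unfolding prod[OF sigma_carrier(3)] sigma_mult_vec(3)[OF ij(1,2) vc[OF sigma_carrier(3)] r]
      sigma_mult_vec(3)[OF ij(3,4) v r] by simp
  have x: "((site_op N sigma_x i * site_op N sigma_x (i + 1)) *\<^sub>v v) $ r = v $ (swap N i r)"
    unfolding prod[OF sigma_carrier(1)] sigma_mult_vec(1)[OF ij(1,2) vc[OF sigma_carrier(1)] r]
      sigma_mult_vec(1)[OF ij(3,4) v fl] flip_flip_swap ..
  have "N - i \<noteq> N - (i + 1)" using i by auto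
  \<comment> \<open>The second factor is evaluated at the configuration already flipped at site
    \<open>i\<close>, which leaves the spin at \<open>i + 1\<close> unchanged.\<close>
  then have sp: "spin N (flip_bit (N - i) r) (i + 1) = spin N r (i + 1)"
    by (simp add: spin_def bit_flip_bit_iff)
  have ii: "\<i> * (x * (\<i> * z)) = - (x * z)" for x z :: complex
  proof -
    have "\<i> * (x * (\<i> * z)) = (\<i> * \<i>) * (x * z)" by (simp only: mult_ac)
    then show ?thesis by simp
  qed
  have y: "((site_op N sigma_y i * site_op N sigma_y (i + 1)) *\<^sub>v v) $ r =
      - complex_of_real (spin N r i * spin N r (i + 1)) * v $ (swap N i r)"
    unfolding prod[OF sigma_carrier(2)] sigma_mult_vec(2)[OF ij(1,2) vc[OF sigma_carrier(2)] r]
      sigma_mult_vec(2)[OF ij(3,4) v fl] flip_flip_swap sp by (simp add: ii mult.assoc)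
  have "(site_op N sigma_x i * site_op N sigma_x (i + 1) + site_op N sigma_y i * site_op N sigma_y (i + 1)) *\<^sub>v v =
      (site_op N sigma_x i * site_op N sigma_x (i + 1)) *\<^sub>v v + (site_op N sigma_y i * site_op N sigma_y (i + 1)) *\<^sub>v v"
    using c[OF sigma_carrier(1)] c[OF sigma_carrier(2)] v by (intro add_mult_distrib_mat_vec[of _ "2 ^ N" "2 ^ N"]) auto
  moreover have "dim_vec ((site_op N sigma_y i * site_op N sigma_y (i + 1)) *\<^sub>v v) = 2 ^ N"
    using c[OF sigma_carrier(2)] by simp
  ultimately have "((site_op N sigma_x i * site_op N sigma_x (i + 1) + site_op N sigma_y i * site_op N sigma_y (i + 1)) *\<^sub>v v) $ r =
      ((site_op N sigma_x i * site_op N sigma_x (i + 1)) *\<^sub>v v) $ r + ((site_op N sigma_y i * site_op N sigma_y (i + 1)) *\<^sub>v v) $ r"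
    using r by (simp del: index_mult_mat_vec)
  then show "((site_op N sigma_x i * site_op N sigma_x (i + 1) + site_op N sigma_y i * site_op N sigma_y (i + 1)) *\<^sub>v v) $ r =
      complex_of_real (1 - spin N r i * spin N r (i + 1)) * v $ (swap N i r)"
    unfolding x y by (simp add: algebra_simps)
qed

lemma XXZ_carrier: "XXZ N J h t \<in> carrier_mat (2 ^ N) (2 ^ N)"
  using XXZ_self_adjoint by (simp add: self_adjoint_mat_def)

lemma XXZ_mult_vec:
  assumes v: "v \<in> carrier_vec (2 ^ N)" and r: "r < 2 ^ N"
  shows "(XXZ N J h t *\<^sub>v v) $ r = complex_of_real (ising N J h r) * v $ r +
    complex_of_real t * (\<Sum>i\<in>{1..<N}. if i \<in> ferro N r then 0 else v $ (swap N i r))"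
proof -
  define Z where "Z = (\<Oplus>\<^bsub>module_mat TYPE(complex) (2 ^ N) (2 ^ N)\<^esub> i\<in>{1..<N}.
          site_op N sigma_z i * site_op N sigma_z (i + 1))"
  define X where "X = (\<Oplus>\<^bsub>module_mat TYPE(complex) (2 ^ N) (2 ^ N)\<^esub> i\<in>{1..<N}.
          site_op N sigma_x i * site_op N sigma_x (i + 1) + site_op N sigma_y i * site_op N sigma_y (i + 1))"
  define M where "M = (\<Oplus>\<^bsub>module_mat TYPE(complex) (2 ^ N) (2 ^ N)\<^esub> i\<in>{1..N}. site_op N sigma_z i)"
  have so: "site_op N A j \<in> carrier_mat (2 ^ N) (2 ^ N)" if "A \<in> carrier_mat 2 2" "1 \<le> j" "j \<le> N" for A j
    using that by (rule site_op_carrier)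
  have c: "site_op N sigma_z i * site_op N sigma_z (i + 1) \<in> carrier_mat (2 ^ N) (2 ^ N)"
    "site_op N sigma_x i * site_op N sigma_x (i + 1) + site_op N sigma_y i * site_op N sigma_y (i + 1) \<in> carrier_mat (2 ^ N) (2 ^ N)"
    if "i \<in> {1..<N}" for i
    using that so[of _ i] so[of _ "i + 1"] sigma_carrier by (auto intro!: mult_carrier_mat add_carrier_mat)
  have c3: "site_op N sigma_z i \<in> carrier_mat (2 ^ N) (2 ^ N)" if "i \<in> {1..N}" for i
    using that so sigma_carrier by auto
  have Z: "Z \<in> carrier_mat (2 ^ N) (2 ^ N)"
    "(Z *\<^sub>v v) $ r = (\<Sum>i\<in>{1..<N}. ((site_op N sigma_z i * site_op N sigma_z (i + 1)) *\<^sub>v v) $ r)"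
    unfolding Z_def by (rule finsum_mat_mult_vec[OF _ _ v r]; use c(1) in blast)+
  have X: "X \<in> carrier_mat (2 ^ N) (2 ^ N)"
    "(X *\<^sub>v v) $ r = (\<Sum>i\<in>{1..<N}. ((site_op N sigma_x i * site_op N sigma_x (i + 1) +
      site_op N sigma_y i * site_op N sigma_y (i + 1)) *\<^sub>v v) $ r)"
    unfolding X_def by (rule finsum_mat_mult_vec[OF _ _ v r]; use c(2) in blast)+
  have M: "M \<in> carrier_mat (2 ^ N) (2 ^ N)" "(M *\<^sub>v v) $ r = (\<Sum>i\<in>{1..N}. (site_op N sigma_z i *\<^sub>v v) $ r)"
    unfolding M_def by (rule finsum_mat_mult_vec[OF _ _ v r]; use c3 in blast)+
  have Z': "(Z *\<^sub>v v) $ r = complex_of_real (\<Sum>i\<in>{1..<N}. spin N r i * spin N r (i + 1)) * v $ r"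
    unfolding Z(2) of_real_sum sum_distrib_right by (intro sum.cong refl bond_mult_vec(1) v r)
  have X': "(X *\<^sub>v v) $ r = 2 * (\<Sum>i\<in>{1..<N}. if i \<in> ferro N r then 0 else v $ (swap N i r))"
    unfolding X(2) sum_distrib_left
  proof (rule sum.cong[OF refl])
    fix i assume i: "i \<in> {1..<N}"
    have "1 - spin N r i * spin N r (i + 1) = (if i \<in> ferro N r then 0 else 2)"
      using i by (cases "bit r (N - i)"; cases "bit r (N - (i + 1))") (simp_all add: ferro_def spin_def)
    then show "((site_op N sigma_x i * site_op N sigma_x (i + 1) + site_op N sigma_y i * site_op N sigma_y (i + 1)) *\<^sub>v v) $ r =
      2 * (if i \<in> ferro N r then 0 else v $ (swap N i r))"
      unfolding bond_mult_vec(2)[OF i v r] by simp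
  qed
  have M': "(M *\<^sub>v v) $ r = complex_of_real (mag N r) * v $ r"
    unfolding M(2) mag_def of_real_sum sum_distrib_right by (intro sum.cong refl sigma_mult_vec(3) v r) auto
  have sm: "(a \<cdot>\<^sub>m B) *\<^sub>v v = a \<cdot>\<^sub>v (B *\<^sub>v v)" if "B \<in> carrier_mat (2 ^ N) (2 ^ N)" for a B
    using that v by (intro eq_vecI) (auto simp: scalar_prod_def sum_distrib_left mult.assoc)
  have "XXZ N J h t *\<^sub>v v = complex_of_real (- J) \<cdot>\<^sub>v (Z *\<^sub>v v) + complex_of_real (t / 2) \<cdot>\<^sub>v (X *\<^sub>v v) -
      complex_of_real h \<cdot>\<^sub>v (M *\<^sub>v v)"
    unfolding XXZ_def Z_def[symmetric] X_def[symmetric] M_def[symmetric]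
    using Z(1) X(1) M(1) v by (simp add: minus_mult_distrib_mat_vec[of _ "2 ^ N" "2 ^ N"] add_mult_distrib_mat_vec[of _ "2 ^ N" "2 ^ N"] sm)
  moreover have "dim_vec (Z *\<^sub>v v) = 2 ^ N" "dim_vec (X *\<^sub>v v) = 2 ^ N" "dim_vec (M *\<^sub>v v) = 2 ^ N"
    using Z(1) X(1) M(1) by auto
  ultimately have "(XXZ N J h t *\<^sub>v v) $ r = complex_of_real (- J) * (Z *\<^sub>v v) $ r + complex_of_real (t / 2) * (X *\<^sub>v v) $ r -
      complex_of_real h * (M *\<^sub>v v) $ r"
    using r by (simp del: index_mult_mat_vec)
  then show ?thesis unfolding Z' X' M' ising_def by (simp add: algebra_simps)
qed

text \<open>The matrix is real in the product basis, so for a real eigenvalue the real and imaginary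
  parts solve the equation separately. Either may vanish; the classification of low states is
  therefore phrased for solutions, zero included.\<close>

lemma XXZ_eigenvector_parts:
  assumes "eigenvector (XXZ N J h t) v (complex_of_real \<nu>)"
  shows "\<forall>r<2 ^ N. chain_ham N J h t (\<lambda>r. Re (v $ r)) r = \<nu> * Re (v $ r)"
    and "\<forall>r<2 ^ N. chain_ham N J h t (\<lambda>r. Im (v $ r)) r = \<nu> * Im (v $ r)"
proof -
  have v: "v \<in> carrier_vec (2 ^ N)" and eq: "XXZ N J h t *\<^sub>v v = complex_of_real \<nu> \<cdot>\<^sub>v v"
    using assms XXZ_carrier[of N J h t] by (auto simp: eigenvector_def)
  have *: "complex_of_real (ising N J h r) * v $ r +
      complex_of_real t * (\<Sum>i\<in>{1..<N}. if i \<in> ferro N r then 0 else v $ (swap N i r)) = complex_of_real \<nu> * v $ r"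
    if r: "r < 2 ^ N" for r
    using XXZ_mult_vec[OF v r, of J h t] r v unfolding eq by simp
  have if_parts: "Re (if b then 0 else z) = (if b then 0 else Re z)" "Im (if b then 0 else z) = (if b then 0 else Im z)"
    for b z by auto
  show "\<forall>r<2 ^ N. chain_ham N J h t (\<lambda>r. Re (v $ r)) r = \<nu> * Re (v $ r)"
    "\<forall>r<2 ^ N. chain_ham N J h t (\<lambda>r. Im (v $ r)) r = \<nu> * Im (v $ r)"
    using arg_cong[OF *, of _ Re] arg_cong[OF *, of _ Im] by (simp_all add: chain_ham_def if_parts)
qed

definition cvec :: "nat \<Rightarrow> (nat \<Rightarrow> real) \<Rightarrow> complex vec" where
  "cvec N u = vec (2 ^ N) (\<lambda>r. complex_of_real (u r))"

lemma cvec_simps [simp]: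
  "cvec N u \<in> carrier_vec (2 ^ N)" "dim_vec (cvec N u) = 2 ^ N"
  "r < 2 ^ N \<Longrightarrow> cvec N u $ r = complex_of_real (u r)"
  by (simp_all add: cvec_def)

lemma XXZ_eigenvectorI:
  assumes u: "\<And>r. r < 2 ^ N \<Longrightarrow> chain_ham N J h t u r = \<nu> * u r" and ne: "a < 2 ^ N" "u a \<noteq> 0"
  shows "eigenvector (XXZ N J h t) (cvec N u) (complex_of_real \<nu>)"
proof -
  have "XXZ N J h t *\<^sub>v cvec N u = complex_of_real \<nu> \<cdot>\<^sub>v cvec N u"
  proof (rule eq_vecI)
    fix r assume "r < dim_vec (complex_of_real \<nu> \<cdot>\<^sub>v cvec N u)"
    then have r: "r < 2 ^ N" by simp
    have "(\<Sum>i\<in>{1..<N}. if i \<in> ferro N r then 0 else cvec N u $ (swap N i r)) =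
        (\<Sum>i\<in>{1..<N}. complex_of_real (if i \<in> ferro N r then 0 else u (swap N i r)))"
      using swap_less[OF _ _ r] by (intro sum.cong) auto
    then have "(XXZ N J h t *\<^sub>v cvec N u) $ r = complex_of_real (chain_ham N J h t u r)"
      unfolding XXZ_mult_vec[OF cvec_simps(1) r] using r by (simp add: chain_ham_def)
    then show "(XXZ N J h t *\<^sub>v cvec N u) $ r = (complex_of_real \<nu> \<cdot>\<^sub>v cvec N u) $ r"
      using u[OF r] r by simp
  qed (use XXZ_carrier[of N J h t] in simp)
  moreover have "cvec N u \<noteq> 0\<^sub>v (2 ^ N)"
  proof
    assume "cvec N u = 0\<^sub>v (2 ^ N)"
    then have "cvec N u $ a = 0" using ne by simp
    then show False using ne by simp
  qed
  ultimately show ?thesis using XXZ_carrier[of N J h t] by (simp add: eigenvector_def)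
qed

section \<open>Spectral consequences for the two signs of the coupling\<close>

lemma XXZ_ferromagnetic:
  assumes J: "0 < J" and h: "0 < h" and N: "J / h + 3 / 2 < real N" and t: "\<bar>t\<bar> < J"
  shows "nondegenerate_eigenvalue (XXZ N J h t) (ground_energy (XXZ N J h t))"
    and "2 * J + 2 * h - \<bar>t\<bar> \<le> spectral_gap (XXZ N J h t)"
proof -
  let ?K = "XXZ N J h t"
  define E where "E = ising N J h 0"
  define w where "w = cvec N (single 0)"
  have "0 < J / h" using J h by simp
  then have N1: "1 \<le> N" using N by linarith
  have w: "eigenvector ?K w (complex_of_real E)"
    unfolding w_def E_def by (rule XXZ_eigenvectorI[of N J h t _ _ 0])
      (use chain_ham_single[OF all_up(2)] in \<open>simp_all add: single_def\<close>)
  have low: "v = v $ 0 \<cdot>\<^sub>v w \<and> v $ 0 \<noteq> 0 \<and> \<nu> = E"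
    if v: "eigenvector ?K v (complex_of_real \<nu>)" and \<nu>: "\<nu> < E + 2 * J + 2 * h - \<bar>t\<bar>" for v \<nu>
  proof -
    have vc: "v \<in> carrier_vec (2 ^ N)" "v \<noteq> 0\<^sub>v (2 ^ N)" using v XXZ_carrier[of N J h t] by (auto simp: eigenvector_def)
    note parts = XXZ_eigenvector_parts[OF v]
    note re = ferromagnetic_low_states[OF N1 N J h t parts(1) \<nu>[unfolded E_def]]
    note im = ferromagnetic_low_states[OF N1 N J h t parts(2) \<nu>[unfolded E_def]]
    have eq: "v = v $ 0 \<cdot>\<^sub>v w"
    proof (rule eq_vecI)
      fix r assume "r < dim_vec (v $ 0 \<cdot>\<^sub>v w)"
      then have r: "r < 2 ^ N" by (simp add: w_def)
      then have "(v $ 0 \<cdot>\<^sub>v w) $ r = v $ 0 * complex_of_real (single 0 r)" by (simp add: w_def)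
      then show "v $ r = (v $ 0 \<cdot>\<^sub>v w) $ r"
        using re(1)[rule_format, OF r] im(1)[rule_format, OF r] by (simp only: complex_eq_iff) simp
    qed (use vc in \<open>simp add: w_def\<close>)
    have ne: "v $ 0 \<noteq> 0"
    proof
      assume "v $ 0 = 0"
      then have "v = 0\<^sub>v (2 ^ N)" by (subst eq) (auto intro!: eq_vecI simp: w_def)
      then show False using vc by simp
    qed
    then have "Re (v $ 0) \<noteq> 0 \<or> Im (v $ 0) \<noteq> 0" by (simp add: complex_eq_iff)
    then have "\<nu> = E" using re(2) im(2) by (auto simp: E_def)
    then show ?thesis using eq ne by simp
  qed
  have big: "E + 2 * J + 2 * h - \<bar>t\<bar> \<le> y" if "y \<in> real_spectrum ?K" "y \<noteq> E" for y
    using that low by (metis linorder_not_less real_spectrumE)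
  have ground: "ground_energy ?K = E"
  proof (rule ground_energyI[OF XXZ_carrier real_spectrumI[OF w]])
    show "E \<le> y" if "y \<in> real_spectrum ?K" for y
      using big[OF that] J h t by (cases "y = E") auto
  qed
  have C: "char_matrix ?K (complex_of_real E) \<in> carrier_mat (2 ^ N) (2 ^ N)"
    by (rule char_matrix_closed[OF XXZ_carrier])
  have "mat_kernel (char_matrix ?K (complex_of_real E)) = {c \<cdot>\<^sub>v w | c. True}"
  proof (intro equalityI subsetI)
    fix v assume "v \<in> mat_kernel (char_matrix ?K (complex_of_real E))"
    then have v: "v \<in> carrier_vec (2 ^ N)" "char_matrix ?K (complex_of_real E) *\<^sub>v v = 0\<^sub>v (2 ^ N)"
      using mat_kernel[OF C] by auto
    show "v \<in> {c \<cdot>\<^sub>v w | c. True}"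
    proof (cases "v = 0\<^sub>v (2 ^ N)")
      case True
      then have "v = 0 \<cdot>\<^sub>v w" by (auto intro!: eq_vecI simp: w_def)
      then show ?thesis by blast
    next
      case False
      then have "eigenvector ?K v (complex_of_real E)"
        using v eigenvector_char_matrix[OF XXZ_carrier[of N J h t]] by simp
      then have "v = v $ 0 \<cdot>\<^sub>v w" using low J h t by auto
      then show ?thesis by blast
    qed
  next
    fix v assume "v \<in> {c \<cdot>\<^sub>v w | c. True}"
    then obtain c where v: "v = c \<cdot>\<^sub>v w" by blast
    have wk: "w \<in> carrier_vec (2 ^ N)" "char_matrix ?K (complex_of_real E) *\<^sub>v w = 0\<^sub>v (2 ^ N)"
      using w eigenvector_char_matrix[OF XXZ_carrier[of N J h t]] by auto
    then have "char_matrix ?K (complex_of_real E) *\<^sub>v v = 0\<^sub>v (2 ^ N)"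
      unfolding v mult_mat_vec[OF C wk(1)] by (auto intro!: eq_vecI)
    then show "v \<in> mat_kernel (char_matrix ?K (complex_of_real E))"
      unfolding mat_kernel[OF C] using wk(1) v by simp
  qed
  from kernel_dim_one[OF C _ _ this] w XXZ_carrier[of N J h t]
  have "kernel_dim (char_matrix ?K (complex_of_real E)) = 1" by (auto simp: eigenvector_def)
  then show "nondegenerate_eigenvalue ?K (ground_energy ?K)"
    unfolding ground nondegenerate_eigenvalue_def using w by (auto simp: eigenvalue_def)
  \<comment> \<open>The state with all spins down supplies a second eigenvalue. Without one,
    \<open>infdist\<close> to the empty set would be 0 by convention.\<close>
  obtain b where b: "b < 2 ^ N" "spin N b 1 = - 1" "ferro N b = {1..<N}" "mag N b = - real N"
    using ex_all_down[OF N1] by blast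
  have "eigenvector ?K (cvec N (single b)) (complex_of_real (ising N J h b))"
    by (rule XXZ_eigenvectorI[of N J h t _ _ b]) (use chain_ham_single[OF b(3)] b(1) in \<open>simp_all add: single_def\<close>)
  moreover have "ising N J h b \<noteq> E"
    using ising_excitation[OF N1, of J h b] b h N1 by (simp add: E_def)
  ultimately have ne: "real_spectrum ?K - {E} \<noteq> {}" using real_spectrumI by blast
  have "2 * J + 2 * h - \<bar>t\<bar> \<le> infdist E (real_spectrum ?K - {E})"
    unfolding infdist_notempty[OF ne]
  proof (rule cINF_greatest[OF ne])
    fix y assume "y \<in> real_spectrum ?K - {E}"
    then show "2 * J + 2 * h - \<bar>t\<bar> \<le> dist E y" using big[of y] by (simp add: dist_real_def)
  qed
  then show "2 * J + 2 * h - \<bar>t\<bar> \<le> spectral_gap ?K" by (simp add: spectral_gap_def ground)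
qed

text \<open>Only eigenvectors below \<open>\<theta>\<close> are classified, so the rank is asserted
  under the condition that both energies lie below \<open>\<theta>\<close>; the smallness of
  \<open>t\<close> guarantees this in the final step.\<close>

lemma XXZ_antiferromagnetic:
  assumes N: "1 \<le> N" and h: "0 < h" "2 * h < g" and t: "\<bar>t\<bar> < (g - 2 * h) / 1000"
  defines "K \<equiv> XXZ N (- g) h t"
  obtains \<mu> \<mu>' \<theta> where "\<mu> \<in> real_spectrum K" "\<mu>' \<in> real_spectrum K"
    "\<And>y. y \<in> real_spectrum K \<Longrightarrow> y < \<theta> \<Longrightarrow> y = \<mu> \<or> y = \<mu>'"
    "\<mu> < \<theta> \<Longrightarrow> \<mu>' < \<theta> \<Longrightarrow> mat_rank (spectral_projection K {\<mu>, \<mu>'}) = 2"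
    "odd N \<Longrightarrow> \<mu>' = \<mu> + 2 * h \<and> \<theta> = \<mu> + 2 * g - 300 * \<bar>t\<bar>"
    "even N \<Longrightarrow> \<bar>\<mu>' - \<mu>\<bar> \<le> 100 * \<bar>t\<bar> \<and> \<theta> = min \<mu> \<mu>' + 2 * g - 2 * h - 300 * \<bar>t\<bar>"
proof -
  show ?thesis
  proof (rule chain_low_states[OF N h t])
    fix w w' \<mu> \<mu>' \<theta>
    assume w: "\<And>r. chain_ham N (- g) h t w r = \<mu> * w r" "\<And>r. chain_ham N (- g) h t w' r = \<mu>' * w' r"
      and indep: "\<And>\<alpha> \<beta>. (\<forall>r<2 ^ N. \<alpha> * w r + \<beta> * w' r = 0) \<Longrightarrow> \<alpha> = 0 \<and> \<beta> = 0"
      and low: "\<And>u \<nu>. \<forall>r<2 ^ N. chain_ham N (- g) h t u r = \<nu> * u r \<Longrightarrow> \<nu> < \<theta> \<Longrightarrow>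
        \<exists>\<alpha> \<beta>. (\<forall>r<2 ^ N. u r = \<alpha> * w r + \<beta> * w' r) \<and> (\<alpha> \<noteq> 0 \<longrightarrow> \<nu> = \<mu>) \<and> (\<beta> \<noteq> 0 \<longrightarrow> \<nu> = \<mu>')"
      and par: "odd N \<Longrightarrow> \<mu>' = \<mu> + 2 * h \<and> \<theta> = \<mu> + 2 * g - 300 * \<bar>t\<bar>"
        "even N \<Longrightarrow> \<bar>\<mu>' - \<mu>\<bar> \<le> 100 * \<bar>t\<bar> \<and> \<theta> = min \<mu> \<mu>' + 2 * g - 2 * h - 300 * \<bar>t\<bar>"
    let ?w = "cvec N w" and ?w' = "cvec N w'"
    have "\<exists>r<2 ^ N. w r \<noteq> 0" using indep[of 1 0] by auto
    then have ew: "eigenvector K ?w (complex_of_real \<mu>)" using XXZ_eigenvectorI w(1) K_def by blast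
    have "\<exists>r<2 ^ N. w' r \<noteq> 0" using indep[of 0 1] by auto
    then have ew': "eigenvector K ?w' (complex_of_real \<mu>')" using XXZ_eigenvectorI w(2) K_def by blast
    have K: "K \<in> carrier_mat (2 ^ N) (2 ^ N)" unfolding K_def by (rule XXZ_carrier)
    have cindep: "\<alpha> = 0 \<and> \<beta> = 0" if z: "\<alpha> \<cdot>\<^sub>v ?w + \<beta> \<cdot>\<^sub>v ?w' = 0\<^sub>v (2 ^ N)" for \<alpha> \<beta>
    proof -
      have e: "\<alpha> * complex_of_real (w r) + \<beta> * complex_of_real (w' r) = 0" if "r < 2 ^ N" for r
        using arg_cong[OF z, of "\<lambda>v. v $ r"] that by simp
      have "Re \<alpha> = 0 \<and> Re \<beta> = 0" "Im \<alpha> = 0 \<and> Im \<beta> = 0"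
        using arg_cong[OF e, of _ Re] arg_cong[OF e, of _ Im] by (intro indep; simp)+
      then show ?thesis by (simp add: complex_eq_iff)
    qed
    have clow: "\<exists>\<alpha> \<beta>. v = \<alpha> \<cdot>\<^sub>v ?w + \<beta> \<cdot>\<^sub>v ?w' \<and> (\<alpha> \<noteq> 0 \<longrightarrow> \<nu> = \<mu>) \<and> (\<beta> \<noteq> 0 \<longrightarrow> \<nu> = \<mu>')"
      if v: "eigenvector K v (complex_of_real \<nu>)" and \<nu>: "\<nu> < \<theta>" for v \<nu>
    proof -
      have vc: "v \<in> carrier_vec (2 ^ N)" using v K by (auto simp: eigenvector_def)
      note parts = XXZ_eigenvector_parts[OF v[unfolded K_def]]
      obtain a b where re: "\<forall>r<2 ^ N. Re (v $ r) = a * w r + b * w' r" "a \<noteq> 0 \<longrightarrow> \<nu> = \<mu>" "b \<noteq> 0 \<longrightarrow> \<nu> = \<mu>'"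
        using low[OF parts(1) \<nu>] by blast
      obtain a' b' where im: "\<forall>r<2 ^ N. Im (v $ r) = a' * w r + b' * w' r" "a' \<noteq> 0 \<longrightarrow> \<nu> = \<mu>" "b' \<noteq> 0 \<longrightarrow> \<nu> = \<mu>'"
        using low[OF parts(2) \<nu>] by blast
      have "v = Complex a a' \<cdot>\<^sub>v ?w + Complex b b' \<cdot>\<^sub>v ?w'"
        by (rule eq_vecI) (use re im vc in \<open>auto simp: complex_eq_iff\<close>)
      moreover have "Complex a a' \<noteq> 0 \<longrightarrow> \<nu> = \<mu>" "Complex b b' \<noteq> 0 \<longrightarrow> \<nu> = \<mu>'"
        using re(2,3) im(2,3) by (auto simp: complex_eq_iff)
      ultimately show ?thesis by blast
    qed
    show ?thesis
    proof (rule that[of \<mu> \<mu>' \<theta>])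
      show "\<mu> \<in> real_spectrum K" "\<mu>' \<in> real_spectrum K" using ew ew' real_spectrumI by blast+
      show "y = \<mu> \<or> y = \<mu>'" if y: "y \<in> real_spectrum K" "y < \<theta>" for y
      proof (rule ccontr)
        assume ne: "\<not> (y = \<mu> \<or> y = \<mu>')"
        obtain v where v: "eigenvector K v (complex_of_real y)" using y(1) by (rule real_spectrumE)
        then have "v = 0 \<cdot>\<^sub>v ?w + 0 \<cdot>\<^sub>v ?w'" using clow[OF v y(2)] ne by auto
        then have "v = 0\<^sub>v (2 ^ N)" by (auto intro!: eq_vecI)
        then show False using v K by (auto simp: eigenvector_def)
      qed
      show "mat_rank (spectral_projection K {\<mu>, \<mu>'}) = 2" if "\<mu> < \<theta>" "\<mu>' < \<theta>"
      proof (rule mat_rank_spectral_projection[OF K, of ?w ?w'])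
        show "\<exists>\<alpha> \<beta>. v = \<alpha> \<cdot>\<^sub>v ?w + \<beta> \<cdot>\<^sub>v ?w'" if "x \<in> {\<mu>, \<mu>'}" "eigenvector K v (complex_of_real x)" for x v
          using clow[OF that(2)] that(1) \<open>\<mu> < \<theta>\<close> \<open>\<mu>' < \<theta>\<close> by blast
      qed (use cindep ew ew' in auto)
    qed (use par in auto)
  qed
qed

theorem mainTheorem1:
  fixes J h :: real
  assumes "h > 0" and "J \<noteq> 0"
  shows
    "(J > 0 \<longrightarrow>
       (\<exists>tbar > 0. \<exists>C > 0. \<forall>N::nat. \<forall>t::real.
          real N > J / h + 3 / 2 \<and> \<bar>t\<bar> < tbar \<longrightarrow>
            nondegenerate_eigenvalue (XXZ N J h t) (ground_energy (XXZ N J h t)) \<and>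
            spectral_gap (XXZ N J h t) \<ge> 2 * J + 2 * h - C * (J / h) * \<bar>t\<bar>)) \<and>
     (J < 0 \<and> \<bar>J\<bar> > 2 * h \<longrightarrow>
       (\<exists>tbar > 0. \<exists>C > 0. \<forall>N::nat. \<forall>t::real.
          N \<ge> 1 \<and> \<bar>t\<bar> < tbar \<longrightarrow>
            (let K = XXZ N J h t; E = ground_energy K in
              (odd N \<longrightarrow>
                (let S = real_spectrum K
                           \<inter> low_energy_interval t E (E + 2 * \<bar>J\<bar> - C * \<bar>t\<bar>) in
                  (\<exists>E'. E' \<noteq> E \<and> S = {E, E'} \<and> \<bar>E' - E - 2 * h\<bar> \<le> C * \<bar>t\<bar>) \<and>
                  mat_rank (spectral_projection K S) = 2)) \<and>
              (even N \<longrightarrow>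
                (let S = real_spectrum K
                           \<inter> low_energy_interval t E (E + 2 * \<bar>J\<bar> - 2 * h - C * \<bar>t\<bar>) in
                  (\<exists>E'. S = {E, E'} \<and> \<bar>E' - E\<bar> \<le> C * \<bar>t\<bar>) \<and>
                  mat_rank (spectral_projection K S) = 2)))))"
proof (intro conjI impI, goal_cases)
  case J: 1
  show ?case
  \<comment> \<open>With \<open>C = h / J\<close> the factor \<open>C * (J / h)\<close> is 1, which
    matches the loss \<open>\<bar>t\<bar>\<close> of the Gershgorin estimate.\<close>
  proof (rule exI[of _ J], intro conjI exI[of _ "h / J"] allI impI)
    show "J > 0" "h / J > 0" using J assms(1) by auto
    fix N t assume *: "real N > J / h + 3 / 2 \<and> \<bar>t\<bar> < J"
    note ferro = XXZ_ferromagnetic[OF J assms(1) conjunct1[OF *] conjunct2[OF *]]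
    show "nondegenerate_eigenvalue (XXZ N J h t) (ground_energy (XXZ N J h t))" by (rule ferro(1))
    show "spectral_gap (XXZ N J h t) \<ge> 2 * J + 2 * h - h / J * (J / h) * \<bar>t\<bar>"
      using ferro(2) J assms(1) by simp
  qed
next
  case J: 2
  define g where "g = - J"
  have g: "J = - g" "\<bar>J\<bar> = g" "2 * h < g" using J by (auto simp: g_def)
  have *: "let K = XXZ N J h t; E = ground_energy K in
              (odd N \<longrightarrow>
                (let S = real_spectrum K
                           \<inter> low_energy_interval t E (E + 2 * \<bar>J\<bar> - 400 * \<bar>t\<bar>) in
                  (\<exists>E'. E' \<noteq> E \<and> S = {E, E'} \<and> \<bar>E' - E - 2 * h\<bar> \<le> 400 * \<bar>t\<bar>) \<and>
                  mat_rank (spectral_projection K S) = 2)) \<and>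
              (even N \<longrightarrow>
                (let S = real_spectrum K
                           \<inter> low_energy_interval t E (E + 2 * \<bar>J\<bar> - 2 * h - 400 * \<bar>t\<bar>) in
                  (\<exists>E'. S = {E, E'} \<and> \<bar>E' - E\<bar> \<le> 400 * \<bar>t\<bar>) \<and>
                  mat_rank (spectral_projection K S) = 2))"
    if N: "1 \<le> N" and t: "\<bar>t\<bar> < (g - 2 * h) / 1000" for N t
  proof -
    define K where "K = XXZ N (- g) h t"
    show ?thesis
    proof (rule XXZ_antiferromagnetic[OF N assms(1) g(3) t, folded K_def])
      fix \<mu> \<mu>' \<theta>
      assume spec: "\<mu> \<in> real_spectrum K" "\<mu>' \<in> real_spectrum K"
        and low: "\<And>y. y \<in> real_spectrum K \<Longrightarrow> y < \<theta> \<Longrightarrow> y = \<mu> \<or> y = \<mu>'"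
        and rank: "\<mu> < \<theta> \<Longrightarrow> \<mu>' < \<theta> \<Longrightarrow> mat_rank (spectral_projection K {\<mu>, \<mu>'}) = 2"
        and par: "odd N \<Longrightarrow> \<mu>' = \<mu> + 2 * h \<and> \<theta> = \<mu> + 2 * g - 300 * \<bar>t\<bar>"
          "even N \<Longrightarrow> \<bar>\<mu>' - \<mu>\<bar> \<le> 100 * \<bar>t\<bar> \<and> \<theta> = min \<mu> \<mu>' + 2 * g - 2 * h - 300 * \<bar>t\<bar>"
      have t4: "500 * \<bar>t\<bar> < g - 2 * h" using t g(3) by auto
      have ground: "ground_energy K = min \<mu> \<mu>'" if "\<mu> < \<theta>" "\<mu>' < \<theta>"
      proof (rule ground_energyI)
        show "K \<in> carrier_mat (2 ^ N) (2 ^ N)" unfolding K_def by (rule XXZ_carrier)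
        show "min \<mu> \<mu>' \<in> real_spectrum K" using spec by (simp add: min_def)
        show "min \<mu> \<mu>' \<le> y" if "y \<in> real_spectrum K" for y
          using low[OF that] \<open>\<mu> < \<theta>\<close> by (cases "y < \<theta>") auto
      qed
      \<comment> \<open>Spectral information is available strictly below \<open>\<theta>\<close>.
        For \<open>t \<noteq> 0\<close> the margin \<open>100 * \<bar>t\<bar>\<close> keeps the
        closed interval there, and it raises the constant from 300 to 400; for \<open>t = 0\<close>
        the interval is half-open, and \<open>b \<le> \<theta>\<close> is enough.\<close>
      have S: "real_spectrum K \<inter> low_energy_interval t (min \<mu> \<mu>') b = {\<mu>, \<mu>'}"
        if b: "max \<mu> \<mu>' < b" "b \<le> \<theta> - 100 * \<bar>t\<bar>" for b
      proof (intro equalityI subsetI)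
        fix y assume y: "y \<in> real_spectrum K \<inter> low_energy_interval t (min \<mu> \<mu>') b"
        then have "y < \<theta>" using b by (auto simp: low_energy_interval_def split: if_splits)
        then show "y \<in> {\<mu>, \<mu>'}" using low y by auto
      next
        fix y assume "y \<in> {\<mu>, \<mu>'}"
        then show "y \<in> real_spectrum K \<inter> low_energy_interval t (min \<mu> \<mu>') b"
          using spec b by (auto simp: low_energy_interval_def)
      qed
      show ?thesis
      proof (cases "odd N")
        case True
        then have \<mu>: "\<mu>' = \<mu> + 2 * h" "\<theta> = \<mu> + 2 * g - 300 * \<bar>t\<bar>" using par by auto
        have lt: "\<mu> < \<theta>" "\<mu>' < \<theta>" and min: "min \<mu> \<mu>' = \<mu>" using \<mu> t4 assms(1) g(3) by auto
        have "real_spectrum K \<inter> low_energy_interval t \<mu> (\<mu> + 2 * g - 400 * \<bar>t\<bar>) = {\<mu>, \<mu>'}"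
          using S[of "\<mu> + 2 * g - 400 * \<bar>t\<bar>"] \<mu> t4 assms(1) g(3) unfolding min by (simp add: max_def)
        then show ?thesis
          using True rank[OF lt] \<mu>(1) assms(1) unfolding Let_def g(2) unfolding g(1) K_def[symmetric] ground[OF lt] min
          by (auto intro!: exI[of _ \<mu>'])
      next
        case False
        then have \<mu>: "\<bar>\<mu>' - \<mu>\<bar> \<le> 100 * \<bar>t\<bar>" "\<theta> = min \<mu> \<mu>' + 2 * g - 2 * h - 300 * \<bar>t\<bar>" using par by auto
        have mm: "max \<mu> \<mu>' \<le> min \<mu> \<mu>' + 100 * \<bar>t\<bar>" using \<mu>(1) by linarith
        have lt: "\<mu> < \<theta>" "\<mu>' < \<theta>" using mm \<mu>(2) t4 assms(1) g(3) by linarith+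
        have "real_spectrum K \<inter> low_energy_interval t (min \<mu> \<mu>') (min \<mu> \<mu>' + 2 * g - 2 * h - 400 * \<bar>t\<bar>) = {\<mu>, \<mu>'}"
          by (rule S) (use mm \<mu>(2) t4 assms(1) g(3) in linarith)+
        moreover have "{\<mu>, \<mu>'} = {min \<mu> \<mu>', max \<mu> \<mu>'}" by (auto simp: min_def max_def)
        ultimately show ?thesis
          using False rank[OF lt] mm unfolding Let_def g(2) unfolding g(1) K_def[symmetric] ground[OF lt]
          by (auto intro!: exI[of _ "max \<mu> \<mu>'"])
      qed
    qed
  qed
  show ?case
  proof (rule exI[of _ "(g - 2 * h) / 1000"], intro conjI exI[of _ "400 :: real"] allI impI)
    show "0 < (g - 2 * h) / 1000" using g(3) by simp
    show "(0::real) < 400" by simp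
  qed (use * in blast)
qed

end
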